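(* Let $F$ be a pseudo-umbilical biharmonic Riemannian map from a Riemannian manifold $(M_1,g_1)$ to a space form $(M_2(c),g_2)$ of constant sectional curvature $c$, such that the distribution $\ker F_*$ is minimal and the mean curvature vector field $H_2$ of $\operatorname{range}F_*$ is parallel. Then either $F$ is harmonic or $c=\|H_2\|^2$.
   Context: All manifolds and maps are smooth. Let $F:(M_1,g_1)\to(M_2,g_2)$ be a smooth map of Riemannian manifolds with $\dim M_1=m$, $\dim M_2=n$ and $0<\operatorname{rank}F<\min\{m,n\}$. $F$ is a Riemannian map if at every $p\in M_1$ the restriction of $F_{*p}$ to $(\ker F_{*p})^\perp$ is a linear isometry onto $\operatorname{range}F_{*p}\subset T_{F(p)}M_2$. $(\operatorname{range}F_* )^\perp$ is the orthogonal complement of $\operatorname{range}F_*$ in $F^{-1}TM_2$; $m_2=\operatorname{rank}F$ (constant) and $m_1=\dim(\ker F_* )$. $\nabla$ is the Levi-Civita connection of $M_1$ and $\nabla^F$ is the pullback to $F^{-1}TM_2$ of that of $M_2$. The second fundamental form is $(\nabla F_* )(X,Y)=\nabla^F_XF_*(Y)-F_*(\nabla_XY)$; it takes values in $(\operatorname{range}F_* )^\perp$ for $X,Y\in\Gamma((\ker F_* )^\perp)$. The tension field is $\tau(F)=\operatorname{trace}_{g_1}(\nabla F_* )$; $F$ is harmonic if $\tau(F)=0$. $F$ is biharmonic if $\tau^2(F)=-\Delta^F\tau(F)-\operatorname{trace}_{g_1}R^2(F_*(\cdot),\tau(F))F_*(\cdot)=0$, where $\Delta^F=-\operatorname{trace}_{g_1}(\nabla^F\nabla^F-\nabla^F_{\nabla})$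 and $R^2$ is the curvature tensor of $M_2$; on a space form, $R^2(X,Y)Z=c\{g_2(Y,Z)X-g_2(X,Z)Y\}$. $\ker F_*$ is minimal if its mean curvature vector field $\mu^{\ker F_*}=\frac1{m_1}\sum_{j=1}^{m_1}\mathcal H(\nabla_{\tilde e_j}\tilde e_j)$ vanishes, where $\{\tilde e_j\}$ is a local orthonormal frame of $\ker F_*$ and $\mathcal H$ is the orthogonal projection onto $(\ker F_* )^\perp$. $H_2=\frac1{m_2}\sum_{i=1}^{m_2}(\nabla F_* )(e_i,e_i)$ for a local orthonormal frame $\{e_i\}$ of $(\ker F_* )^\perp$; it is a section of $(\operatorname{range}F_* )^\perp$. For a section $V$ of $(\operatorname{range}F_* )^\perp$, $\nabla^{F\perp}_XV$ is the orthogonal projection of $\nabla^F_XV$ on $(\operatorname{range}F_* )^\perp$, and for $X\in\Gamma((\ker F_* )^\perp)$, $A_VF_*X$ is minus the $\operatorname{range}F_*$-component of $\nabla^F_XV$. $H_2$ is parallel if $\nabla^{F\perp}_XH_2=0$ for all $X\in\Gamma(TM_1)$. $F$ is pseudo-umbilical if there is $\lambda\in C^\infty(M_1)$ with $A_{H_2}F_*(X)=\lambda F_*(X)$ for all $X\in\Gamma((\ker F_* )^\perp)$.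
   Formalization: The manifold M_1 is assumed connected; without this the claim fails, since F can be harmonic on one component of M_1 and satisfy c = ||H_2||^2 ≠ 0 on another. *)

theory Defs
  imports "HOL-Analysis.Analysis"
begin

section \<open>Smooth functions on open subsets of Euclidean space\<close>

primrec diff_times_on ::
  "nat \<Rightarrow> 'a::real_normed_vector set \<Rightarrow> ('a \<Rightarrow> 'b::real_normed_vector) \<Rightarrow> bool" where
  "diff_times_on 0 S f \<longleftrightarrow> continuous_on S f"
| "diff_times_on (Suc k) S f \<longleftrightarrow>
     (\<forall>x\<in>S. f differentiable (at x)) \<and>
     (\<forall>v. diff_times_on k S (\<lambda>x. frechet_derivative f (at x) v))"

definition smooth_on :: "'a::real_normed_vector set \<Rightarrow> ('a \<Rightarrow> 'b::real_normed_vector) \<Rightarrow> bool" where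
  "smooth_on S f \<longleftrightarrow> (\<forall>k. diff_times_on k S f)"


section \<open>Linear algebra relative to an inner product\<close>

text \<open>Here h is a positive definite symmetric bilinear form, which in general is not the
  ambient inner product of the type.\<close>

definition inner_form :: "('v::euclidean_space \<Rightarrow> 'v \<Rightarrow> real) \<Rightarrow> bool" where
  "inner_form h \<longleftrightarrow> bilinear h \<and> (\<forall>u v. h u v = h v u) \<and> (\<forall>v. v \<noteq> 0 \<longrightarrow> h v v > 0)"

definition orth_compl :: "('v::euclidean_space \<Rightarrow> 'v \<Rightarrow> real) \<Rightarrow> 'v set \<Rightarrow> 'v set" where
  "orth_compl h S = {v. \<forall>w\<in>S. h v w = 0}"

definition orth_proj :: "('v::euclidean_space \<Rightarrow> 'v \<Rightarrow> real) \<Rightarrow> 'v set \<Rightarrow> 'v \<Rightarrow> 'v" where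
  "orth_proj h S v = (THE w. w \<in> S \<and> v - w \<in> orth_compl h S)"

definition is_onb :: "('v::euclidean_space \<Rightarrow> 'v \<Rightarrow> real) \<Rightarrow> 'v set \<Rightarrow> 'v set \<Rightarrow> bool" where
  "is_onb h S E \<longleftrightarrow> (\<forall>e\<in>E. \<forall>e'\<in>E. h e e' = (if e = e' then 1 else 0)) \<and> span E = S"

text \<open>The trace over the subspace S of a bilinear map B; it does not depend on the orthonormal
  basis chosen.\<close>

definition trace_on ::
  "('v::euclidean_space \<Rightarrow> 'v \<Rightarrow> real) \<Rightarrow> 'v set \<Rightarrow> ('v \<Rightarrow> 'v \<Rightarrow> 'w::real_vector) \<Rightarrow> 'w" where
  "trace_on h S B = (\<Sum>e\<in>(SOME E. is_onb h S E). B e e)"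


section \<open>Riemannian manifolds\<close>

text \<open>A chart is an open set together with a map into the model space; only the values of the
  map on the open set matter.\<close>

type_synonym ('a, 'm) chart = "'a set \<times> ('a \<Rightarrow> real^'m)"

abbreviation cdom :: "('a, 'm::finite) chart \<Rightarrow> 'a set" where "cdom \<equiv> fst"
abbreviation cmap :: "('a, 'm::finite) chart \<Rightarrow> 'a \<Rightarrow> real^'m" where "cmap \<equiv> snd"

definition cinv :: "('a, 'm::finite) chart \<Rightarrow> real^'m \<Rightarrow> 'a" where
  "cinv \<phi> = inv_into (cdom \<phi>) (cmap \<phi>)"

record ('a, 'm) riem_mfd =
  atlas :: "('a, 'm::finite) chart set"
  metric :: "'a \<Rightarrow> real^'m \<Rightarrow> real^'m \<Rightarrow> real"

definition carr :: "('a, 'm::finite) riem_mfd \<Rightarrow> 'a set" where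
  "carr M = (\<Union>\<phi>\<in>atlas M. cdom \<phi>)"

text \<open>The tangent space at p is the type of m-vectors: a vector stands for its components in one
  chart around p chosen once and for all. The maps \<open>comps\<close> and \<open>of_comps\<close> translate
  to and from the components in an arbitrary chart.\<close>

definition chart_at :: "('a, 'm::finite) riem_mfd \<Rightarrow> 'a \<Rightarrow> ('a, 'm) chart" where
  "chart_at M p = (SOME \<phi>. \<phi> \<in> atlas M \<and> p \<in> cdom \<phi>)"

definition pt :: "('a, 'm::finite) riem_mfd \<Rightarrow> 'a \<Rightarrow> real^'m" where
  "pt M p = cmap (chart_at M p) p"

definition comps :: "('a, 'm::finite) riem_mfd \<Rightarrow> ('a, 'm) chart \<Rightarrow> 'a \<Rightarrow> real^'m \<Rightarrow> real^'m" where
  "comps M \<phi> p v = frechet_derivative (cmap \<phi> \<circ> cinv (chart_at M p)) (at (pt M p)) v"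

definition of_comps :: "('a, 'm::finite) riem_mfd \<Rightarrow> ('a, 'm) chart \<Rightarrow> 'a \<Rightarrow> real^'m \<Rightarrow> real^'m" where
  "of_comps M \<phi> p a = frechet_derivative (cmap (chart_at M p) \<circ> cinv \<phi>) (at (cmap \<phi> p)) a"

text \<open>Local representations of a vector field and of the metric in a chart, as functions on the
  image of the chart.\<close>

definition vf_rep ::
  "('a, 'm::finite) riem_mfd \<Rightarrow> ('a, 'm) chart \<Rightarrow> ('a \<Rightarrow> real^'m) \<Rightarrow> real^'m \<Rightarrow> real^'m" where
  "vf_rep M \<phi> X x = comps M \<phi> (cinv \<phi> x) (X (cinv \<phi> x))"

definition metric_rep ::
  "('a, 'm::finite) riem_mfd \<Rightarrow> ('a, 'm) chart \<Rightarrow> real^'m \<Rightarrow> real^'m \<Rightarrow> real^'m \<Rightarrow> real" where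
  "metric_rep M \<phi> x a b =
     metric M (cinv \<phi> x) (of_comps M \<phi> (cinv \<phi> x) a) (of_comps M \<phi> (cinv \<phi> x) b)"

definition is_chart :: "('a::topological_space, 'm::finite) chart \<Rightarrow> bool" where
  "is_chart \<phi> \<longleftrightarrow> open (cdom \<phi>) \<and> open (cmap \<phi> ` cdom \<phi>) \<and>
     homeomorphism (cdom \<phi>) (cmap \<phi> ` cdom \<phi>) (cmap \<phi>) (cinv \<phi>)"

definition riemannian_manifold ::
  "('a::{t2_space, second_countable_topology}, 'm::finite) riem_mfd \<Rightarrow> bool" where
  "riemannian_manifold M \<longleftrightarrow>
     (\<forall>\<phi>\<in>atlas M. is_chart \<phi>) \<and>
     (\<forall>\<phi>\<in>atlas M. \<forall>\<psi>\<in>atlas M.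
        smooth_on (cmap \<phi> ` (cdom \<phi> \<inter> cdom \<psi>)) (cmap \<psi> \<circ> cinv \<phi>)) \<and>
     (\<forall>p\<in>carr M. inner_form (metric M p)) \<and>
     (\<forall>\<phi>\<in>atlas M. \<forall>a b. smooth_on (cmap \<phi> ` cdom \<phi>) (\<lambda>x. metric_rep M \<phi> x a b))"

definition smooth_fun :: "('a, 'm::finite) riem_mfd \<Rightarrow> ('a \<Rightarrow> real) \<Rightarrow> bool" where
  "smooth_fun M f \<longleftrightarrow> (\<forall>\<phi>\<in>atlas M. smooth_on (cmap \<phi> ` cdom \<phi>) (f \<circ> cinv \<phi>))"

definition smooth_vf :: "('a, 'm::finite) riem_mfd \<Rightarrow> 'a set \<Rightarrow> ('a \<Rightarrow> real^'m) \<Rightarrow> bool" where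
  "smooth_vf M U X \<longleftrightarrow> (\<forall>\<phi>\<in>atlas M. smooth_on (cmap \<phi> ` (U \<inter> cdom \<phi>)) (vf_rep M \<phi> X))"

text \<open>Extension of a tangent vector at p to a vector field near p, with constant components in
  the chosen chart at p. Expressions that are tensorial in their arguments are evaluated on
  single vectors by means of this extension.\<close>

definition ext :: "('a, 'm::finite) riem_mfd \<Rightarrow> 'a \<Rightarrow> real^'m \<Rightarrow> 'a \<Rightarrow> real^'m" where
  "ext M p v q = of_comps M (chart_at M p) q v"


section \<open>Levi-Civita connection and curvature\<close>

text \<open>Christoffel symbols of the metric in a chart, as a bilinear map at the point with
  coordinates x:
  \<open>\<Gamma>\<^sup>k(a,b) = 1/2 \<Sum>l. g\<^sup>k\<^sup>l (D\<^sub>a g(b,\<partial>\<^sub>l) + D\<^sub>b g(a,\<partial>\<^sub>l) - D\<^sub>l g(a,b))\<close>.\<close>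

definition christoffel ::
  "('a, 'm::finite) riem_mfd \<Rightarrow> ('a, 'm) chart \<Rightarrow> real^'m \<Rightarrow> real^'m \<Rightarrow> real^'m \<Rightarrow> real^'m" where
  "christoffel M \<phi> x a b =
     matrix_inv (\<chi> i j. metric_rep M \<phi> x (axis i 1) (axis j 1)) *v
     (\<chi> l. (frechet_derivative (\<lambda>y. metric_rep M \<phi> y b (axis l 1)) (at x) a
           + frechet_derivative (\<lambda>y. metric_rep M \<phi> y a (axis l 1)) (at x) b
           - frechet_derivative (\<lambda>y. metric_rep M \<phi> y a b) (at x) (axis l 1)) / 2)"

text \<open>\<open>cov M v Y p\<close> is the Levi-Civita derivative at p of the vector field Y in the direction of
  the tangent vector v at p.\<close>

definition cov ::
  "('a, 'm::finite) riem_mfd \<Rightarrow> real^'m \<Rightarrow> ('a \<Rightarrow> real^'m) \<Rightarrow> 'a \<Rightarrow> real^'m" where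
  "cov M v Y p =
     frechet_derivative (vf_rep M (chart_at M p) Y) (at (pt M p)) v
     + christoffel M (chart_at M p) (pt M p) v (Y p)"

definition lie_bracket ::
  "('a, 'm::finite) riem_mfd \<Rightarrow> ('a \<Rightarrow> real^'m) \<Rightarrow> ('a \<Rightarrow> real^'m) \<Rightarrow> 'a \<Rightarrow> real^'m" where
  "lie_bracket M X Y p =
     frechet_derivative (vf_rep M (chart_at M p) Y) (at (pt M p)) (X p)
     - frechet_derivative (vf_rep M (chart_at M p) X) (at (pt M p)) (Y p)"

definition curv ::
  "('a, 'm::finite) riem_mfd \<Rightarrow> ('a \<Rightarrow> real^'m) \<Rightarrow> ('a \<Rightarrow> real^'m) \<Rightarrow> ('a \<Rightarrow> real^'m) \<Rightarrow>
   'a \<Rightarrow> real^'m" where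
  "curv M X Y Z p =
     cov M (X p) (\<lambda>q. cov M (Y q) Z q) p
     - cov M (Y p) (\<lambda>q. cov M (X q) Z q) p
     - cov M (lie_bracket M X Y p) Z p"

definition curv_at ::
  "('a, 'm::finite) riem_mfd \<Rightarrow> 'a \<Rightarrow> real^'m \<Rightarrow> real^'m \<Rightarrow> real^'m \<Rightarrow> real^'m" where
  "curv_at M p u v w = curv M (ext M p u) (ext M p v) (ext M p w) p"

definition sectional_curv ::
  "('a, 'm::finite) riem_mfd \<Rightarrow> 'a \<Rightarrow> real^'m \<Rightarrow> real^'m \<Rightarrow> real" where
  "sectional_curv M p u v =
     metric M p (curv_at M p u v v) u /
     (metric M p u u * metric M p v v - (metric M p u v)\<^sup>2)"

definition space_form ::
  "('a::{t2_space, second_countable_topology}, 'm::finite) riem_mfd \<Rightarrow> real \<Rightarrow> bool" where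
  "space_form M c \<longleftrightarrow> riemannian_manifold M \<and>
     (\<forall>p\<in>carr M. \<forall>u v. u \<noteq> v \<and> independent {u, v} \<longrightarrow> sectional_curv M p u v = c)"


section \<open>Maps between Riemannian manifolds\<close>

definition smooth_map ::
  "('a::topological_space, 'm::finite) riem_mfd \<Rightarrow> ('b::topological_space, 'n::finite) riem_mfd \<Rightarrow>
   ('a \<Rightarrow> 'b) \<Rightarrow> bool" where
  "smooth_map M1 M2 F \<longleftrightarrow> F ` carr M1 \<subseteq> carr M2 \<and> continuous_on (carr M1) F \<and>
     (\<forall>\<phi>\<in>atlas M1. \<forall>\<psi>\<in>atlas M2.
        smooth_on (cmap \<phi> ` (cdom \<phi> \<inter> F -` cdom \<psi>)) (cmap \<psi> \<circ> F \<circ> cinv \<phi>))"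

definition push ::
  "('a, 'm::finite) riem_mfd \<Rightarrow> ('b, 'n::finite) riem_mfd \<Rightarrow> ('a \<Rightarrow> 'b) \<Rightarrow>
   'a \<Rightarrow> real^'m \<Rightarrow> real^'n" where
  "push M1 M2 F p v =
     frechet_derivative (cmap (chart_at M2 (F p)) \<circ> F \<circ> cinv (chart_at M1 p)) (at (pt M1 p)) v"

definition ker_sp ::
  "('a, 'm::finite) riem_mfd \<Rightarrow> ('b, 'n::finite) riem_mfd \<Rightarrow> ('a \<Rightarrow> 'b) \<Rightarrow> 'a \<Rightarrow> (real^'m) set" where
  "ker_sp M1 M2 F p = {v. push M1 M2 F p v = 0}"

definition hor_sp ::
  "('a, 'm::finite) riem_mfd \<Rightarrow> ('b, 'n::finite) riem_mfd \<Rightarrow> ('a \<Rightarrow> 'b) \<Rightarrow> 'a \<Rightarrow> (real^'m) set" where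
  "hor_sp M1 M2 F p = orth_compl (metric M1 p) (ker_sp M1 M2 F p)"

definition range_sp ::
  "('a, 'm::finite) riem_mfd \<Rightarrow> ('b, 'n::finite) riem_mfd \<Rightarrow> ('a \<Rightarrow> 'b) \<Rightarrow> 'a \<Rightarrow> (real^'n) set" where
  "range_sp M1 M2 F p = range (push M1 M2 F p)"

definition normal_sp ::
  "('a, 'm::finite) riem_mfd \<Rightarrow> ('b, 'n::finite) riem_mfd \<Rightarrow> ('a \<Rightarrow> 'b) \<Rightarrow> 'a \<Rightarrow> (real^'n) set" where
  "normal_sp M1 M2 F p = orth_compl (metric M2 (F p)) (range_sp M1 M2 F p)"

definition riemannian_map ::
  "('a::topological_space, 'm::finite) riem_mfd \<Rightarrow> ('b::topological_space, 'n::finite) riem_mfd \<Rightarrow>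
   ('a \<Rightarrow> 'b) \<Rightarrow> bool" where
  "riemannian_map M1 M2 F \<longleftrightarrow> smooth_map M1 M2 F \<and>
     (\<forall>p\<in>carr M1.
        (\<forall>u\<in>hor_sp M1 M2 F p. \<forall>v\<in>hor_sp M1 M2 F p.
           metric M2 (F p) (push M1 M2 F p u) (push M1 M2 F p v) = metric M1 p u v) \<and>
        push M1 M2 F p ` hor_sp M1 M2 F p = range_sp M1 M2 F p)"

text \<open>A section V of the pullback bundle assigns to p a tangent vector of M2 at F p.
  \<open>cov_pb M1 M2 F v V p\<close> is its derivative at p in the direction v for the pullback of the
  Levi-Civita connection of M2: in components,
  \<open>v(V\<^sup>k) + \<Gamma>\<^sup>k(F\<^sub>*v, V)\<close>, with \<open>\<Gamma>\<close> taken at F p.\<close>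

definition sec_rep ::
  "('b, 'n::finite) riem_mfd \<Rightarrow> ('a \<Rightarrow> 'b) \<Rightarrow> ('a, 'm::finite) chart \<Rightarrow> ('b, 'n) chart \<Rightarrow>
   ('a \<Rightarrow> real^'n) \<Rightarrow> real^'m \<Rightarrow> real^'n" where
  "sec_rep M2 F \<phi> \<psi> V x = comps M2 \<psi> (F (cinv \<phi> x)) (V (cinv \<phi> x))"

definition cov_pb ::
  "('a, 'm::finite) riem_mfd \<Rightarrow> ('b, 'n::finite) riem_mfd \<Rightarrow> ('a \<Rightarrow> 'b) \<Rightarrow>
   real^'m \<Rightarrow> ('a \<Rightarrow> real^'n) \<Rightarrow> 'a \<Rightarrow> real^'n" where
  "cov_pb M1 M2 F v V p =
     frechet_derivative (sec_rep M2 F (chart_at M1 p) (chart_at M2 (F p)) V) (at (pt M1 p)) v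
     + christoffel M2 (chart_at M2 (F p)) (pt M2 (F p)) (push M1 M2 F p v) (V p)"

definition sff ::
  "('a, 'm::finite) riem_mfd \<Rightarrow> ('b, 'n::finite) riem_mfd \<Rightarrow> ('a \<Rightarrow> 'b) \<Rightarrow>
   ('a \<Rightarrow> real^'m) \<Rightarrow> ('a \<Rightarrow> real^'m) \<Rightarrow> 'a \<Rightarrow> real^'n" where
  "sff M1 M2 F X Y p =
     cov_pb M1 M2 F (X p) (\<lambda>q. push M1 M2 F q (Y q)) p
     - push M1 M2 F p (cov M1 (X p) Y p)"

definition sff_at ::
  "('a, 'm::finite) riem_mfd \<Rightarrow> ('b, 'n::finite) riem_mfd \<Rightarrow> ('a \<Rightarrow> 'b) \<Rightarrow>
   'a \<Rightarrow> real^'m \<Rightarrow> real^'m \<Rightarrow> real^'n" where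
  "sff_at M1 M2 F p u v = sff M1 M2 F (ext M1 p u) (ext M1 p v) p"

definition tension ::
  "('a, 'm::finite) riem_mfd \<Rightarrow> ('b, 'n::finite) riem_mfd \<Rightarrow> ('a \<Rightarrow> 'b) \<Rightarrow> 'a \<Rightarrow> real^'n" where
  "tension M1 M2 F p = trace_on (metric M1 p) UNIV (sff_at M1 M2 F p)"

definition harmonic ::
  "('a, 'm::finite) riem_mfd \<Rightarrow> ('b, 'n::finite) riem_mfd \<Rightarrow> ('a \<Rightarrow> 'b) \<Rightarrow> bool" where
  "harmonic M1 M2 F \<longleftrightarrow> (\<forall>p\<in>carr M1. tension M1 M2 F p = 0)"

text \<open>The sign of the Laplacian is such that it is minus the trace of the second covariant
  derivative.\<close>

definition laplacian_pb ::
  "('a, 'm::finite) riem_mfd \<Rightarrow> ('b, 'n::finite) riem_mfd \<Rightarrow> ('a \<Rightarrow> 'b) \<Rightarrow>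
   ('a \<Rightarrow> real^'n) \<Rightarrow> 'a \<Rightarrow> real^'n" where
  "laplacian_pb M1 M2 F V p =
     - trace_on (metric M1 p) UNIV
         (\<lambda>u v. cov_pb M1 M2 F u (\<lambda>q. cov_pb M1 M2 F (ext M1 p v q) V q) p
               - cov_pb M1 M2 F (cov M1 u (ext M1 p v) p) V p)"

definition bitension ::
  "('a, 'm::finite) riem_mfd \<Rightarrow> ('b, 'n::finite) riem_mfd \<Rightarrow> ('a \<Rightarrow> 'b) \<Rightarrow> 'a \<Rightarrow> real^'n" where
  "bitension M1 M2 F p =
     - laplacian_pb M1 M2 F (tension M1 M2 F) p
     - trace_on (metric M1 p) UNIV
         (\<lambda>u v. curv_at M2 (F p) (push M1 M2 F p u) (tension M1 M2 F p) (push M1 M2 F p v))"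

definition biharmonic ::
  "('a, 'm::finite) riem_mfd \<Rightarrow> ('b, 'n::finite) riem_mfd \<Rightarrow> ('a \<Rightarrow> 'b) \<Rightarrow> bool" where
  "biharmonic M1 M2 F \<longleftrightarrow> (\<forall>p\<in>carr M1. bitension M1 M2 F p = 0)"


section \<open>Geometry of the kernel and of the range\<close>

text \<open>A smooth orthonormal frame, over the open set U, of the distribution D of rank k.\<close>

definition local_onf ::
  "('a::topological_space, 'm::finite) riem_mfd \<Rightarrow> ('a \<Rightarrow> (real^'m) set) \<Rightarrow> 'a set \<Rightarrow> nat \<Rightarrow>
   (nat \<Rightarrow> 'a \<Rightarrow> real^'m) \<Rightarrow> bool" where
  "local_onf M D U k E \<longleftrightarrow> open U \<and> U \<subseteq> carr M \<and>
     (\<forall>j<k. smooth_vf M U (E j)) \<and>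
     (\<forall>q\<in>U. (\<forall>i<k. \<forall>j<k. metric M q (E i q) (E j q) = (if i = j then 1 else 0)) \<and>
             span ((\<lambda>j. E j q) ` {..<k}) = D q)"

text \<open>\<open>\<mu>\<close> is the mean curvature vector field of the kernel distribution: around every point it is
  computed from a local orthonormal frame, whose choice does not affect the value.\<close>

definition ker_mean_curvature ::
  "('a::topological_space, 'm::finite) riem_mfd \<Rightarrow> ('b, 'n::finite) riem_mfd \<Rightarrow> ('a \<Rightarrow> 'b) \<Rightarrow>
   ('a \<Rightarrow> real^'m) \<Rightarrow> bool" where
  "ker_mean_curvature M1 M2 F \<mu> \<longleftrightarrow>
     (\<forall>p\<in>carr M1. \<exists>U E. let m\<^sub>1 = dim (ker_sp M1 M2 F p) in
        p \<in> U \<and> local_onf M1 (ker_sp M1 M2 F) U m\<^sub>1 E \<and>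
        \<mu> p = (1 / real m\<^sub>1) *\<^sub>R
          (\<Sum>j<m\<^sub>1. orth_proj (metric M1 p) (hor_sp M1 M2 F p) (cov M1 (E j p) (E j) p)))"

definition ker_minimal ::
  "('a::topological_space, 'm::finite) riem_mfd \<Rightarrow> ('b, 'n::finite) riem_mfd \<Rightarrow> ('a \<Rightarrow> 'b) \<Rightarrow> bool" where
  "ker_minimal M1 M2 F \<longleftrightarrow> ker_mean_curvature M1 M2 F (\<lambda>_. 0)"

definition range_mean_curv ::
  "('a, 'm::finite) riem_mfd \<Rightarrow> ('b, 'n::finite) riem_mfd \<Rightarrow> ('a \<Rightarrow> 'b) \<Rightarrow> 'a \<Rightarrow> real^'n" where
  "range_mean_curv M1 M2 F p =
     (1 / real (dim (range_sp M1 M2 F p))) *\<^sub>R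
       trace_on (metric M1 p) (hor_sp M1 M2 F p) (sff_at M1 M2 F p)"

definition normal_cov ::
  "('a, 'm::finite) riem_mfd \<Rightarrow> ('b, 'n::finite) riem_mfd \<Rightarrow> ('a \<Rightarrow> 'b) \<Rightarrow>
   real^'m \<Rightarrow> ('a \<Rightarrow> real^'n) \<Rightarrow> 'a \<Rightarrow> real^'n" where
  "normal_cov M1 M2 F v V p =
     orth_proj (metric M2 (F p)) (normal_sp M1 M2 F p) (cov_pb M1 M2 F v V p)"

text \<open>\<open>shape_op M1 M2 F V p v\<close> is \<open>A\<^sub>V F\<^sub>*v\<close> for a vector v at p orthogonal to the kernel.\<close>

definition shape_op ::
  "('a, 'm::finite) riem_mfd \<Rightarrow> ('b, 'n::finite) riem_mfd \<Rightarrow> ('a \<Rightarrow> 'b) \<Rightarrow>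
   ('a \<Rightarrow> real^'n) \<Rightarrow> 'a \<Rightarrow> real^'m \<Rightarrow> real^'n" where
  "shape_op M1 M2 F V p v =
     - orth_proj (metric M2 (F p)) (range_sp M1 M2 F p) (cov_pb M1 M2 F v V p)"

definition parallel_mean_curv ::
  "('a, 'm::finite) riem_mfd \<Rightarrow> ('b, 'n::finite) riem_mfd \<Rightarrow> ('a \<Rightarrow> 'b) \<Rightarrow> bool" where
  "parallel_mean_curv M1 M2 F \<longleftrightarrow>
     (\<forall>p\<in>carr M1. \<forall>v. normal_cov M1 M2 F v (range_mean_curv M1 M2 F) p = 0)"

definition pseudo_umbilical ::
  "('a, 'm::finite) riem_mfd \<Rightarrow> ('b, 'n::finite) riem_mfd \<Rightarrow> ('a \<Rightarrow> 'b) \<Rightarrow> bool" where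
  "pseudo_umbilical M1 M2 F \<longleftrightarrow>
     (\<exists>f. smooth_fun M1 f \<and>
       (\<forall>p\<in>carr M1. \<forall>v\<in>hor_sp M1 M2 F p.
          shape_op M1 M2 F (range_mean_curv M1 M2 F) p v = f p *\<^sub>R push M1 M2 F p v))"

end

theory Submission
  imports Defs
begin

text \<open>Write \<open>\<tau>\<close> for the tension field and \<open>r\<close> for the rank. Minimality of the kernel gives \<open>\<tau> = r H\<^sub>2\<close>,
  and \<open>H\<^sub>2\<close> is normal to the range. By parallelism \<open>\<nabla>\<^sub>v H\<^sub>2\<close> is tangent to the range, and
  \<open>g\<^sub>2(\<nabla>\<^sub>a H\<^sub>2, F\<^sub>* b) = - g\<^sub>2(H\<^sub>2, (\<nabla>F\<^sub>*)(a, b))\<close> is symmetric in a and b; so \<open>\<nabla>\<^sub>v H\<^sub>2\<close> vanishes for v in the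
  kernel and, F being pseudo-umbilical, \<open>\<nabla>\<^sub>v H\<^sub>2 = - \<lambda> F\<^sub>* v\<close> for every v. Tracing this pairing gives
  \<open>\<lambda> = |H\<^sub>2|\<^sup>2\<close>. A second differentiation shows that the trace of the second derivative of \<open>\<tau>\<close> is
  \<open>- r (F\<^sub>* grad \<lambda> + \<lambda> \<tau>)\<close>. Pairing the biharmonic equation with \<open>\<tau>\<close>, where the curvature
  contributes \<open>c r |\<tau>|\<^sup>2\<close>, leaves \<open>r (c - \<lambda>) |\<tau>|\<^sup>2 = 0\<close>. Hence the continuous function \<open>\<lambda>\<close> takes only the
  values 0 and c, and it is constant since the manifold is connected.\<close>


section \<open>Calculus of smooth functions\<close>

text \<open>The obstacle is that a tangent vector at q consists of components in
  \<open>chart_at M q\<close>, an arbitrary choice without any regularity in q, and that traces run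
  over bases picked by \<open>SOME\<close>. The regularity of a field can therefore not be read off
  from its definition: before anything is differentiated at p, it is rewritten in the two fixed
  charts at p and F p, where it becomes a formula on an open set of Euclidean space. For this reason
  the local theory is developed without manifolds, in \<open>metric_on\<close> and
  \<open>map_on\<close>, and the transformation laws \<open>chr_transform\<close> and
  \<open>lsff_transform\<close> carry it over. That the second fundamental form is normal on
  horizontal vectors calls for horizontal extensions of these vectors; they come from an operator Q
  built from the two metrics and the differential alone. The space form hypothesis speaks of
  sectional curvatures of independent pairs only. It suffices because the curvature term is tested
  against \<tau>, which is orthogonal to the range, and the skew symmetry of the curvature tensor
  brings this term into sectional form.\<close>

abbreviation fd :: "('a::real_normed_vector \<Rightarrow> 'b::real_normed_vector) \<Rightarrow> 'a \<Rightarrow> 'a \<Rightarrow> 'b"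
  where "fd f x \<equiv> frechet_derivative f (at x)"

lemma fd_eqI: "(f has_derivative f') (at x) \<Longrightarrow> fd f x = f'"
  using frechet_derivative_at by blast

lemma fd_cong:
  assumes "open S" "x \<in> S" "\<And>y. y \<in> S \<Longrightarrow> f y = g y"
  shows "fd f x = fd g x"
proof -
  have "(f has_derivative f') (at x) \<longleftrightarrow> (g has_derivative f') (at x)" for f'
    using has_derivative_transform_within_open[OF _ assms(1,2)] assms(3) by metis
  then show ?thesis
    by (simp add: frechet_derivative_def)
qed

lemma differentiable_cong_open:
  assumes "open S" "x \<in> S" "\<And>y. y \<in> S \<Longrightarrow> f y = g y" "f differentiable at x"
  shows "g differentiable at x"
  using has_derivative_transform_within_open[OF _ assms(1,2)] assms(3,4)
  unfolding differentiable_def by metis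

lemma fd_compose:
  assumes "g differentiable at x" "f differentiable at (g x)"
  shows "fd (\<lambda>y. f (g y)) x = (\<lambda>u. fd f (g x) (fd g x u))"
  using frechet_derivative_compose[OF assms] by (simp add: o_def)

lemma smooth_on_differentiable: "smooth_on S f \<Longrightarrow> x \<in> S \<Longrightarrow> f differentiable at x"
  unfolding smooth_on_def by (metis diff_times_on.simps(2))

lemma smooth_on_fd: "smooth_on S f \<Longrightarrow> smooth_on S (\<lambda>x. fd f x v)"
  unfolding smooth_on_def by (metis diff_times_on.simps(2))

lemma smooth_on_continuous: "smooth_on S f \<Longrightarrow> continuous_on S f"
  unfolding smooth_on_def by (metis diff_times_on.simps(1))

lemma diff_times_on_mono: "diff_times_on k S f \<Longrightarrow> T \<subseteq> S \<Longrightarrow> diff_times_on k T f"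
  by (induction k arbitrary: f) (auto intro: continuous_on_subset)

lemma smooth_on_mono: "smooth_on S f \<Longrightarrow> T \<subseteq> S \<Longrightarrow> smooth_on T f"
  unfolding smooth_on_def using diff_times_on_mono by blast

lemma linear_fd: "f differentiable at x \<Longrightarrow> linear (fd f x)"
  by (rule linear_frechet_derivative)

text \<open>Two applications of the mean value theorem, first along u and then along v. The second
  difference on the left is symmetric in u and v while the form of the right side is not, so letting
  h tend to 0 will identify the two mixed derivatives. The bound on h keeps the whole parallelogram
  in the ball.\<close>

lemma second_difference_mvt:
  fixes f :: "'a::real_normed_vector \<Rightarrow> real"
  assumes "open S" "smooth_on S f" "cball x e \<subseteq> S" "0 < h" "h * (norm u + norm v) \<le> e"
  shows "\<exists>s t. 0 \<le> s \<and> s \<le> h \<and> 0 \<le> t \<and> t \<le> h \<and>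
     f (x + h *\<^sub>R u + h *\<^sub>R v) - f (x + h *\<^sub>R u) - f (x + h *\<^sub>R v) + f x
       = h * h * fd (\<lambda>y. fd f y u) (x + s *\<^sub>R u + t *\<^sub>R v) v"
proof -
  have inS: "x + s *\<^sub>R u + t *\<^sub>R v \<in> S" if "0 \<le> s" "s \<le> h" "0 \<le> t" "t \<le> h" for s t
  proof -
    have "norm (s *\<^sub>R u + t *\<^sub>R v) \<le> s * norm u + t * norm v"
      using norm_triangle_ineq[of "s *\<^sub>R u" "t *\<^sub>R v"] that by simp
    also have "\<dots> \<le> h * norm u + h * norm v"
      using that by (intro add_mono mult_right_mono) auto
    also have "\<dots> \<le> e" using assms(5) by (simp add: algebra_simps)
    finally have "dist x (x + s *\<^sub>R u + t *\<^sub>R v) \<le> e"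
      by (simp add: dist_norm norm_minus_commute algebra_simps)
    then show ?thesis using assms(3) by auto
  qed
  have df: "(f has_derivative fd f y) (at y)" if "y \<in> S" for y
    using smooth_on_differentiable[OF assms(2) that] frechet_derivative_works by blast
  have dfu: "((\<lambda>y. fd f y u) has_derivative fd (\<lambda>y. fd f y u) y) (at y)" if "y \<in> S" for y
    using smooth_on_differentiable[OF smooth_on_fd[OF assms(2)] that] frechet_derivative_works by blast
  have lf: "linear (fd f y)" if "y \<in> S" for y
    using df[OF that] has_derivative_linear by blast
  have lfu: "linear (fd (\<lambda>y. fd f y u) y)" if "y \<in> S" for y
    using dfu[OF that] has_derivative_linear by blast
  \<comment> \<open>The increment along h v as a function of the displacement along u: its own
    increment over [0, h] is the second difference.\<close>
  define k where "k s = f (x + s *\<^sub>R u + h *\<^sub>R v) - f (x + s *\<^sub>R u)" for s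
  have dk: "(k has_derivative (\<lambda>r. r * (fd f (x + s *\<^sub>R u + h *\<^sub>R v) u - fd f (x + s *\<^sub>R u) u)))
      (at s within {0..h})" if "0 \<le> s" "s \<le> h" for s
  proof -
    have 1: "x + s *\<^sub>R u + h *\<^sub>R v \<in> S" "x + s *\<^sub>R u \<in> S"
      using inS[OF that, of h] inS[OF that, of 0] assms(4) by auto
    have "((\<lambda>s. f (x + s *\<^sub>R u + h *\<^sub>R v)) has_derivative (\<lambda>r. fd f (x + s *\<^sub>R u + h *\<^sub>R v) (r *\<^sub>R u)))
       (at s within {0..h})"
      by (rule has_derivative_compose[of "\<lambda>s. x + s *\<^sub>R u + h *\<^sub>R v", OF _ df[OF 1(1)]])
        (auto intro!: derivative_eq_intros)
    moreover have "((\<lambda>s. f (x + s *\<^sub>R u)) has_derivative (\<lambda>r. fd f (x + s *\<^sub>R u) (r *\<^sub>R u)))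
       (at s within {0..h})"
      by (rule has_derivative_compose[of "\<lambda>s. x + s *\<^sub>R u", OF _ df[OF 1(2)]])
        (auto intro!: derivative_eq_intros)
    ultimately show ?thesis unfolding k_def
      by (auto intro!: derivative_eq_intros simp: linear_cmul[OF lf] 1 right_diff_distrib)
  qed
  obtain s where s: "0 < s" "s < h"
    "k h - k 0 = (h - 0) * (fd f (x + s *\<^sub>R u + h *\<^sub>R v) u - fd f (x + s *\<^sub>R u) u)"
    using mvt_simple[OF assms(4) dk] by auto
  \<comment> \<open>With s fixed, the first application has left a difference of values of
    \<open>fd f _ u\<close> along v, which is the increment of l.\<close>
  define l where "l t = fd f (x + s *\<^sub>R u + t *\<^sub>R v) u" for t
  have dl: "(l has_derivative (\<lambda>r. r * fd (\<lambda>y. fd f y u) (x + s *\<^sub>R u + t *\<^sub>R v) v)) (at t within {0..h})"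
    if "0 \<le> t" "t \<le> h" for t
  proof -
    have 1: "x + s *\<^sub>R u + t *\<^sub>R v \<in> S" using inS that s by auto
    have "(l has_derivative (\<lambda>r. fd (\<lambda>y. fd f y u) (x + s *\<^sub>R u + t *\<^sub>R v) (r *\<^sub>R v))) (at t within {0..h})"
      unfolding l_def
      by (rule has_derivative_compose[of "\<lambda>t. x + s *\<^sub>R u + t *\<^sub>R v", OF _ dfu[OF 1]])
        (auto intro!: derivative_eq_intros)
    then show ?thesis by (simp add: linear_cmul[OF lfu[OF 1]])
  qed
  obtain t where t: "0 < t" "t < h" "l h - l 0 = (h - 0) * fd (\<lambda>y. fd f y u) (x + s *\<^sub>R u + t *\<^sub>R v) v"
    using mvt_simple[OF assms(4) dl] by auto
  have "k h - k 0 = h * h * fd (\<lambda>y. fd f y u) (x + s *\<^sub>R u + t *\<^sub>R v) v"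
    using s(3) t(3) by (simp add: l_def)
  then show ?thesis using s(1,2) t(1,2)
    by (intro exI[of _ s] exI[of _ t]) (auto simp: k_def)
qed

lemma diff_times_on_cong:
  assumes "open S" "diff_times_on k S f" "\<And>x. x \<in> S \<Longrightarrow> f x = g x"
  shows "diff_times_on k S g"
  using assms(2,3)
proof (induction k arbitrary: f g)
  case 0
  then show ?case using continuous_on_cong by fastforce
next
  case (Suc k)
  have "fd f x = fd g x" "g differentiable at x" if "x \<in> S" for x
    using that Suc.prems fd_cong[OF assms(1) that] differentiable_cong_open[OF assms(1) that, of f g] by auto
  then show ?case using Suc.IH[of "\<lambda>x. fd f x v" "\<lambda>x. fd g x v" for v] Suc.prems by auto
qed

lemma fd_inner:
  fixes f :: "'a::real_normed_vector \<Rightarrow> 'b::real_inner"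
  assumes "f differentiable at x"
  shows "fd (\<lambda>x. f x \<bullet> b) x v = fd f x v \<bullet> b"
  using fd_eqI[OF has_derivative_inner_left[OF assms[unfolded frechet_derivative_works]]] by simp

lemma smooth_on_inner:
  fixes f :: "'a::real_normed_vector \<Rightarrow> 'b::real_inner"
  assumes "open S" "smooth_on S f"
  shows "smooth_on S (\<lambda>x. f x \<bullet> b)"
proof -
  have "diff_times_on k S (\<lambda>x. f x \<bullet> b)" if "smooth_on S f" for k
    using that
  proof (induction k arbitrary: f)
    case 0
    then show ?case using smooth_on_continuous[OF 0] by (auto intro: continuous_on_inner)
  next
    case (Suc k)
    have d: "f differentiable at x" if "x \<in> S" for x
      using smooth_on_differentiable[OF Suc.prems that] .
    have "diff_times_on k S (\<lambda>x. fd (\<lambda>x. f x \<bullet> b) x v)" for v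
      by (rule diff_times_on_cong[OF assms(1) Suc.IH[OF smooth_on_fd[OF Suc.prems, of v]]])
        (simp add: fd_inner[OF d])
    then show ?case using d by simp
  qed
  then show ?thesis using assms(2) unfolding smooth_on_def by blast
qed

text \<open>Both mixed derivatives are limits of the same second difference divided by the square of
  h, since the intermediate points tend to x and the iterated derivatives are continuous.\<close>

lemma second_derivative_symmetric_real:
  fixes f :: "'a::real_normed_vector \<Rightarrow> real"
  assumes "open S" "smooth_on S f" "x \<in> S"
  shows "fd (\<lambda>y. fd f y u) x v = fd (\<lambda>y. fd f y v) x u"
proof -
  obtain e where e: "e > 0" "cball x e \<subseteq> S"
    using assms(1,3) open_contains_cball by blast
  have ev: "\<forall>\<^sub>F h in at_right (0::real). h > 0 \<and> h * (norm u + norm v) \<le> e"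
  proof -
    have "((\<lambda>h. h * (norm u + norm v)) \<longlongrightarrow> 0 * (norm u + norm v)) (at_right 0)"
      by (intro tendsto_intros)
    then have "\<forall>\<^sub>F h in at_right (0::real). h * (norm u + norm v) < e"
      using order_tendstoD(2) e(1) by fastforce
    then show ?thesis
      using eventually_at_right_less[of 0] by eventually_elim auto
  qed
  let ?q = "\<lambda>h u v s t. 0 \<le> s \<and> s \<le> h \<and> 0 \<le> t \<and> t \<le> h \<and>
     f (x + h *\<^sub>R u + h *\<^sub>R v) - f (x + h *\<^sub>R u) - f (x + h *\<^sub>R v) + f x
       = h * h * fd (\<lambda>y. fd f y u) (x + s *\<^sub>R u + t *\<^sub>R v) v"
  \<comment> \<open>To take limits, the intermediate parameters are needed as functions of h;
    outside the admissible range of h their values are arbitrary.\<close>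
  have ex: "\<exists>s t. \<forall>h. h > 0 \<and> h * (norm u + norm v) \<le> e \<longrightarrow> ?q h u v (s h) (t h)" for u v
  proof -
    have "\<forall>h. \<exists>p. h > 0 \<and> h * (norm u + norm v) \<le> e \<longrightarrow> ?q h u v (fst p) (snd p)"
    proof
      fix h
      show "\<exists>p. h > 0 \<and> h * (norm u + norm v) \<le> e \<longrightarrow> ?q h u v (fst p) (snd p)"
      proof (cases "h > 0 \<and> h * (norm u + norm v) \<le> e")
        case True
        obtain s t where "?q h u v s t"
          using second_difference_mvt[OF assms(1,2) e(2), of h u v] True by blast
        then show ?thesis by (intro exI[of _ "(s, t)"]) simp
      qed blast
    qed
    then obtain p where "\<forall>h. h > 0 \<and> h * (norm u + norm v) \<le> e \<longrightarrow> ?q h u v (fst (p h)) (snd (p h))"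
      using choice[of "\<lambda>h p. h > 0 \<and> h * (norm u + norm v) \<le> e \<longrightarrow> ?q h u v (fst p) (snd p)"] by blast
    then show ?thesis
      by (intro exI[of _ "\<lambda>h. fst (p h)"] exI[of _ "\<lambda>h. snd (p h)"])
  qed
  obtain s t where st: "\<And>h. h > 0 \<and> h * (norm u + norm v) \<le> e \<Longrightarrow> ?q h u v (s h) (t h)"
    using ex[of u v] by auto
  obtain s' t' where st': "\<And>h. h > 0 \<and> h * (norm v + norm u) \<le> e \<Longrightarrow> ?q h v u (s' h) (t' h)"
    using ex[of v u] by auto
  have lim0: "(r \<longlongrightarrow> 0) (at_right 0)" if "\<And>h. h > 0 \<and> h * (norm u + norm v) \<le> e \<Longrightarrow> 0 \<le> r h \<and> r h \<le> h"
    for r :: "real \<Rightarrow> real"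
    by (rule tendsto_sandwich[of "\<lambda>_. 0" _ _ "\<lambda>h. h"])
       (use ev that in \<open>auto elim!: eventually_mono\<close>)
  have cont: "isCont (\<lambda>y. fd (\<lambda>y. fd f y a) y b) x" for a b
    using smooth_on_continuous[OF smooth_on_fd[OF smooth_on_fd[OF assms(2)]]] assms(1,3)
      continuous_on_eq_continuous_at by blast
  have L1: "((\<lambda>h. fd (\<lambda>y. fd f y u) (x + s h *\<^sub>R u + t h *\<^sub>R v) v) \<longlongrightarrow> fd (\<lambda>y. fd f y u) x v) (at_right 0)"
  proof (rule isCont_tendsto_compose[OF cont])
    have "((\<lambda>h. x + s h *\<^sub>R u + t h *\<^sub>R v) \<longlongrightarrow> x + 0 *\<^sub>R u + 0 *\<^sub>R v) (at_right 0)"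
      by (intro tendsto_intros lim0) (use st in auto)
    then show "((\<lambda>h. x + s h *\<^sub>R u + t h *\<^sub>R v) \<longlongrightarrow> x) (at_right 0)" by simp
  qed
  have L2: "((\<lambda>h. fd (\<lambda>y. fd f y v) (x + s' h *\<^sub>R v + t' h *\<^sub>R u) u) \<longlongrightarrow> fd (\<lambda>y. fd f y v) x u) (at_right 0)"
  proof (rule isCont_tendsto_compose[OF cont])
    have "((\<lambda>h. x + s' h *\<^sub>R v + t' h *\<^sub>R u) \<longlongrightarrow> x + 0 *\<^sub>R v + 0 *\<^sub>R u) (at_right 0)"
      by (intro tendsto_intros lim0) (use st' in \<open>auto simp: add.commute\<close>)
    then show "((\<lambda>h. x + s' h *\<^sub>R v + t' h *\<^sub>R u) \<longlongrightarrow> x) (at_right 0)" by simp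
  qed
  have "\<forall>\<^sub>F h in at_right 0. fd (\<lambda>y. fd f y u) (x + s h *\<^sub>R u + t h *\<^sub>R v) v
      = fd (\<lambda>y. fd f y v) (x + s' h *\<^sub>R v + t' h *\<^sub>R u) u"
    using ev
  proof eventually_elim
    case (elim h)
    \<comment> \<open>The second difference does not see the order of u and v, so both mean value
      formulas compute it.\<close>
    have "x + h *\<^sub>R u + h *\<^sub>R v = x + h *\<^sub>R v + h *\<^sub>R u" by simp
    then have "h * h * fd (\<lambda>y. fd f y u) (x + s h *\<^sub>R u + t h *\<^sub>R v) v
      = h * h * fd (\<lambda>y. fd f y v) (x + s' h *\<^sub>R v + t' h *\<^sub>R u) u"
      using st[OF elim] st'[of h] elim by (simp add: algebra_simps)
    then show ?case using elim by simp
  qed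
  then show ?thesis
    using tendsto_unique[OF trivial_limit_at_right_real L1 iffD2[OF tendsto_cong L2]] by simp
qed

theorem second_derivative_symmetric:
  fixes f :: "'a::real_normed_vector \<Rightarrow> 'b::euclidean_space"
  assumes "open S" "smooth_on S f" "x \<in> S"
  shows "fd (\<lambda>y. fd f y u) x v = fd (\<lambda>y. fd f y v) x u"
proof (rule euclidean_eqI)
  fix b :: 'b
  have *: "fd (\<lambda>y. fd f y u) x v \<bullet> b = fd (\<lambda>y. fd (\<lambda>y. f y \<bullet> b) y u) x v" for u v
  proof -
    have "fd (\<lambda>y. fd (\<lambda>y. f y \<bullet> b) y u) x = fd (\<lambda>y. fd f y u \<bullet> b) x"
      using smooth_on_differentiable[OF assms(2)] by (intro fd_cong[OF assms(1,3)] fd_inner) auto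
    then show ?thesis
      using fd_inner smooth_on_differentiable[OF smooth_on_fd[OF assms(2)] assms(3)] by metis
  qed
  show "fd (\<lambda>y. fd f y u) x v \<bullet> b = fd (\<lambda>y. fd f y v) x u \<bullet> b"
    unfolding * by (rule second_derivative_symmetric_real[OF assms(1) smooth_on_inner[OF assms(1,2)] assms(3)])
qed

text \<open>The product rule for a linear map depending on a point, when only its values
  \<open>A y b\<close> on fixed vectors are known to be differentiable. As the space of arguments is
  finite dimensional, expanding \<open>V x\<close> in the standard basis reduces it to products of
  scalars with such values.\<close>

lemma has_derivative_param_linear:
  fixes A :: "'x::real_normed_vector \<Rightarrow> 'v::euclidean_space \<Rightarrow> 'w::real_normed_vector"
  assumes S: "open S" "f x \<in> S" and lin: "\<And>y. y \<in> S \<Longrightarrow> linear (A y)"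
    and dA: "\<And>b. (\<lambda>y. A y b) differentiable at (f x)"
    and df: "(f has_derivative f') (at x)" and dV: "(V has_derivative V') (at x)"
  shows "((\<lambda>x. A (f x) (V x)) has_derivative
           (\<lambda>u. fd (\<lambda>y. A y (V x)) (f x) (f' u) + A (f x) (V' u))) (at x)"
proof -
  have exp: "A y v = (\<Sum>b\<in>Basis. (v \<bullet> b) *\<^sub>R A y b)" if "y \<in> S" for y v
  proof -
    have "A y (\<Sum>b\<in>Basis. (v \<bullet> b) *\<^sub>R b) = (\<Sum>b\<in>Basis. (v \<bullet> b) *\<^sub>R A y b)"
      by (simp add: linear_sum[OF lin[OF that]] linear_cmul[OF lin[OF that]])
    then show ?thesis by (simp only: euclidean_representation)
  qed
  have dA': "((\<lambda>y. A y b) has_derivative fd (\<lambda>y. A y b) (f x)) (at (f x))" for b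
    using dA frechet_derivative_works by blast
  have fdA: "fd (\<lambda>y. A y v) (f x) = (\<lambda>u. \<Sum>b\<in>Basis. (v \<bullet> b) *\<^sub>R fd (\<lambda>y. A y b) (f x) u)" for v
  proof -
    have "fd (\<lambda>y. A y v) (f x) = fd (\<lambda>y. \<Sum>b\<in>Basis. (v \<bullet> b) *\<^sub>R A y b) (f x)"
      by (rule fd_cong[OF S]) (rule exp)
    also have "\<dots> = (\<lambda>u. \<Sum>b\<in>Basis. (v \<bullet> b) *\<^sub>R fd (\<lambda>y. A y b) (f x) u)"
      by (rule fd_eqI) (auto intro!: has_derivative_sum has_derivative_scaleR_right dA')
    finally show ?thesis .
  qed
  have "((\<lambda>x. \<Sum>b\<in>Basis. (V x \<bullet> b) *\<^sub>R A (f x) b) has_derivative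
      (\<lambda>u. \<Sum>b\<in>Basis. (V x \<bullet> b) *\<^sub>R fd (\<lambda>y. A y b) (f x) (f' u) + (V' u \<bullet> b) *\<^sub>R A (f x) b)) (at x)"
    by (intro has_derivative_sum has_derivative_scaleR has_derivative_compose[OF df dA']
        has_derivative_inner_left dV)
  also have "(\<lambda>u. \<Sum>b\<in>Basis. (V x \<bullet> b) *\<^sub>R fd (\<lambda>y. A y b) (f x) (f' u) + (V' u \<bullet> b) *\<^sub>R A (f x) b)
     = (\<lambda>u. fd (\<lambda>y. A y (V x)) (f x) (f' u) + A (f x) (V' u))"
  proof
    fix u
    show "(\<Sum>b\<in>Basis. (V x \<bullet> b) *\<^sub>R fd (\<lambda>y. A y b) (f x) (f' u) + (V' u \<bullet> b) *\<^sub>R A (f x) b)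
      = fd (\<lambda>y. A y (V x)) (f x) (f' u) + A (f x) (V' u)"
      unfolding sum.distrib exp[OF S(2), of "V' u", symmetric] fdA[of "V x"] ..
  qed
  finally have 1: "((\<lambda>x. \<Sum>b\<in>Basis. (V x \<bullet> b) *\<^sub>R A (f x) b) has_derivative
       (\<lambda>u. fd (\<lambda>y. A y (V x)) (f x) (f' u) + A (f x) (V' u))) (at x)" .
  \<comment> \<open>Linearity, and with it the expansion, is available only over S, so the two
    functions agree only near x.\<close>
  have "isCont f x" using df has_derivative_continuous by blast
  then have "\<forall>\<^sub>F z in at x. f z \<in> S"
    using S by (metis isCont_def topological_tendstoD)
  then have "\<forall>\<^sub>F z in at x. (\<Sum>b\<in>Basis. (V z \<bullet> b) *\<^sub>R A (f z) b) = A (f z) (V z)"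
    by eventually_elim (simp only: exp[symmetric])
  then show ?thesis
    by (rule has_derivative_transform_eventually[OF 1 _ _ UNIV_I]) (simp only: exp[OF S(2), symmetric])
qed

text \<open>The rule for linear maps is used twice: for a fixed second argument, and then with the
  pair \<open>(f x, V x)\<close> as the parameter.\<close>

lemma has_derivative_param_bilinear:
  fixes B :: "'x::real_normed_vector \<Rightarrow> 'v::euclidean_space \<Rightarrow> 'v2::euclidean_space \<Rightarrow> 'w::real_normed_vector"
  assumes S: "open S" "f x \<in> S" and lin: "\<And>y. y \<in> S \<Longrightarrow> bilinear (B y)"
    and dB: "\<And>a b. (\<lambda>y. B y a b) differentiable at (f x)"
    and df: "(f has_derivative f') (at x)" and dV: "(V has_derivative V') (at x)"
    and dZ: "(Z has_derivative Z') (at x)"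
  shows "((\<lambda>x. B (f x) (V x) (Z x)) has_derivative
           (\<lambda>u. fd (\<lambda>y. B y (V x) (Z x)) (f x) (f' u) + B (f x) (V' u) (Z x) + B (f x) (V x) (Z' u))) (at x)"
proof -
  let ?A = "\<lambda>(y, a). B y a"
  have 1: "((\<lambda>p. B (fst p) (snd p) b) has_derivative
      (\<lambda>u. fd (\<lambda>y. B y (V x) b) (f x) (fst u) + B (f x) (snd u) b)) (at (f x, V x))" for b
  proof -
    have "((\<lambda>p. (\<lambda>y a. B y a b) (fst p) (snd p)) has_derivative
        (\<lambda>u. fd (\<lambda>y. B y (snd (f x, V x)) b) (fst (f x, V x)) (fst u) + B (fst (f x, V x)) (snd u) b))
        (at (f x, V x))"
      by (rule has_derivative_param_linear[of S])
        (use S lin dB in \<open>auto simp: bilinear_def intro!: has_derivative_fst has_derivative_snd has_derivative_ident\<close>)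
    then show ?thesis by simp
  qed
  have "((\<lambda>x. ?A (f x, V x) (Z x)) has_derivative
     (\<lambda>u. fd (\<lambda>p. ?A p (Z x)) (f x, V x) (f' u, V' u) + ?A (f x, V x) (Z' u))) (at x)"
  proof (rule has_derivative_param_linear[of "S \<times> UNIV" "\<lambda>x. (f x, V x)"])
    show "(\<lambda>p. ?A p b) differentiable at (f x, V x)" for b
      using 1[of b] by (auto simp: differentiable_def split_def)
  qed (use S lin df dV dZ in \<open>auto simp: bilinear_def open_Times intro!: has_derivative_Pair\<close>)
  moreover have "fd (\<lambda>p. ?A p (Z x)) (f x, V x) = (\<lambda>u. fd (\<lambda>y. B y (V x) (Z x)) (f x) (fst u) + B (f x) (snd u) (Z x))"
    using fd_eqI[OF 1[of "Z x"]] by (simp add: split_def)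
  ultimately show ?thesis by simp
qed

section \<open>Differentiability of determinants and of solutions of linear systems\<close>

lemma differentiable_det:
  fixes A :: "'x::real_normed_vector \<Rightarrow> real^'n^'n"
  assumes "\<And>i j. (\<lambda>y. A y $ i $ j) differentiable at x"
  shows "(\<lambda>y. det (A y)) differentiable at x"
proof -
  have "(\<lambda>y. \<Prod>i\<in>UNIV. A y $ i $ p i) differentiable at x" for p :: "'n \<Rightarrow> 'n"
    by (rule differentiableI[OF has_derivative_prod])
      (rule assms[unfolded frechet_derivative_works])
  then show ?thesis
    unfolding det_def by (intro differentiable_sum ballI differentiable_mult) auto
qed

lemma differentiable_vec:
  fixes f :: "'x::real_normed_vector \<Rightarrow> real^'n"
  shows "(\<And>i. (\<lambda>y. f y $ i) differentiable at x) \<Longrightarrow> f differentiable at x"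
  by (subst differentiable_componentwise_within) (auto simp: Basis_vec_def inner_axis)

lemma matrix_inv_mult_vec:
  fixes A :: "real^'n^'n"
  assumes "invertible A"
  shows "A *v (matrix_inv A *v w) = w"
proof -
  have "A ** matrix_inv A = mat 1"
    using assms unfolding invertible_def matrix_inv_def by (rule someI2_ex) auto
  then show ?thesis by (simp add: matrix_vector_mul_assoc)
qed

text \<open>By Cramer's rule each component is a quotient of polynomials in the entries, with a
  denominator that does not vanish on S.\<close>

lemma differentiable_matrix_inv:
  fixes A :: "'x::real_normed_vector \<Rightarrow> real^'n^'n"
  assumes S: "open S" "x \<in> S" and inv: "\<And>y. y \<in> S \<Longrightarrow> invertible (A y)"
    and dA: "\<And>i j. (\<lambda>y. A y $ i $ j) differentiable at x"
    and dw: "\<And>i. (\<lambda>y. w y $ i) differentiable at x"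
  shows "(\<lambda>y. matrix_inv (A y) *v w y) differentiable at x"
proof (rule differentiable_cong_open[OF S])
  have nz: "det (A y) \<noteq> 0" if "y \<in> S" for y
    using inv[OF that] invertible_det_nz by blast
  show "(\<chi> k. det (\<chi> i j. if j = k then w y $ i else A y $ i $ j) / det (A y)) = matrix_inv (A y) *v w y"
    if "y \<in> S" for y
    by (rule cramer[OF nz[OF that], THEN iffD1, OF matrix_inv_mult_vec[OF inv[OF that]], symmetric])
  show "(\<lambda>y. \<chi> k. det (\<chi> i j. if j = k then w y $ i else A y $ i $ j) / det (A y)) differentiable at x"
  proof (rule differentiable_vec, simp, intro differentiable_divide differentiable_det dA)
    fix k i j
    show "(\<lambda>y. (\<chi> i j. if j = k then w y $ i else A y $ i $ j) $ i $ j) differentiable at x"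
      using dA dw by (cases "j = k") auto
  qed (use nz S in auto)
qed

lemma linear_fd_param:
  fixes A :: "'x::real_normed_vector \<Rightarrow> 'v::real_vector \<Rightarrow> 'w::real_normed_vector"
  assumes S: "open S" "x \<in> S" and lin: "\<And>y. y \<in> S \<Longrightarrow> linear (A y)"
    and d: "\<And>b. (\<lambda>y. A y b) differentiable at x"
  shows "linear (\<lambda>b. fd (\<lambda>y. A y b) x u)"
proof (rule linearI)
  have d': "((\<lambda>y. A y b) has_derivative fd (\<lambda>y. A y b) x) (at x)" for b
    using d frechet_derivative_works by blast
  fix a b :: 'v and r :: real
  have "fd (\<lambda>y. A y (a + b)) x = fd (\<lambda>y. A y a + A y b) x"
    by (rule fd_cong[OF S]) (rule linear_add[OF lin])
  also have "\<dots> = (\<lambda>u. fd (\<lambda>y. A y a) x u + fd (\<lambda>y. A y b) x u)"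
    by (intro fd_eqI has_derivative_add d')
  finally show "fd (\<lambda>y. A y (a + b)) x u = fd (\<lambda>y. A y a) x u + fd (\<lambda>y. A y b) x u" by simp
  have "fd (\<lambda>y. A y (r *\<^sub>R a)) x = fd (\<lambda>y. r *\<^sub>R A y a) x"
    by (rule fd_cong[OF S]) (rule linear_cmul[OF lin])
  also have "\<dots> = (\<lambda>u. r *\<^sub>R fd (\<lambda>y. A y a) x u)"
    by (intro fd_eqI has_derivative_scaleR_right d')
  finally show "fd (\<lambda>y. A y (r *\<^sub>R a)) x u = r *\<^sub>R fd (\<lambda>y. A y a) x u" by simp
qed

text \<open>The last term, in which the second derivative of s appears, is the failure of second
  derivatives to be tensorial; in \<open>lsff_transform\<close> the Christoffel symbols compensate
  for it.\<close>

lemma second_derivative_compose: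
  fixes f :: "'b::euclidean_space \<Rightarrow> 'c::real_normed_vector" and s :: "'a::real_normed_vector \<Rightarrow> 'b"
  assumes "open U" "open V" "smooth_on U s" "smooth_on V f" "\<And>y. y \<in> U \<Longrightarrow> s y \<in> V" "x \<in> U"
  shows "fd (\<lambda>y. fd (\<lambda>z. f (s z)) y b) x a =
     fd (\<lambda>z. fd f z (fd s x b)) (s x) (fd s x a) + fd f (s x) (fd (\<lambda>y. fd s y b) x a)"
proof -
  have "fd (\<lambda>y. fd (\<lambda>z. f (s z)) y b) x = fd (\<lambda>y. fd f (s y) (fd s y b)) x"
    by (rule fd_cong[OF assms(1,6)])
      (simp add: fd_compose smooth_on_differentiable[OF assms(3)] smooth_on_differentiable[OF assms(4)] assms(5))
  also have "((\<lambda>y. fd f (s y) (fd s y b)) has_derivative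
     (\<lambda>a. fd (\<lambda>z. fd f z (fd s x b)) (s x) (fd s x a) + fd f (s x) (fd (\<lambda>y. fd s y b) x a))) (at x)"
    by (rule has_derivative_param_linear[OF assms(2)])
      (use assms(5,6) smooth_on_differentiable[OF assms(3)] smooth_on_differentiable[OF assms(4)]
        smooth_on_differentiable[OF smooth_on_fd[OF assms(3)]] smooth_on_differentiable[OF smooth_on_fd[OF assms(4)]]
        in \<open>auto simp: frechet_derivative_works[symmetric] intro: linear_fd\<close>)
  from fd_eqI[OF this]
  have "fd (\<lambda>y. fd f (s y) (fd s y b)) x = (\<lambda>a. fd (\<lambda>z. fd f z (fd s x b)) (s x) (fd s x a) + fd f (s x) (fd (\<lambda>y. fd s y b) x a))" .
  finally show ?thesis by simp
qed


section \<open>Inner products on a Euclidean space\<close>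

lemma inner_form_bilinear: "inner_form h \<Longrightarrow> bilinear h"
  by (simp add: inner_form_def)

lemma inner_form_sym: "inner_form h \<Longrightarrow> h u v = h v u"
  by (simp add: inner_form_def)

lemma inner_form_eq_0: "inner_form h \<Longrightarrow> h v v = 0 \<longleftrightarrow> v = 0"
  unfolding inner_form_def by (metis bilinear_lzero less_irrefl)

lemma inner_form_eqI:
  assumes "inner_form h" "\<And>w. h u w = h v w"
  shows "u = v"
proof -
  have "h (u - v) (u - v) = 0"
    using assms(2) bilinear_lsub[OF inner_form_bilinear[OF assms(1)]] by simp
  then show ?thesis using inner_form_eq_0[OF assms(1)] by simp
qed

lemmas inner_form_simps =
  bilinear_ladd[OF inner_form_bilinear] bilinear_radd[OF inner_form_bilinear]
  bilinear_lsub[OF inner_form_bilinear] bilinear_rsub[OF inner_form_bilinear]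
  bilinear_lmul[OF inner_form_bilinear] bilinear_rmul[OF inner_form_bilinear]
  bilinear_lneg[OF inner_form_bilinear] bilinear_rneg[OF inner_form_bilinear]
  bilinear_lzero[OF inner_form_bilinear] bilinear_rzero[OF inner_form_bilinear]

lemma inner_form_sum_left: "inner_form h \<Longrightarrow> h (\<Sum>i\<in>I. f i) v = (\<Sum>i\<in>I. h (f i) v)"
  using linear_sum[of "\<lambda>u. h u v"] by (simp add: inner_form_def bilinear_def)

lemma inner_form_sum_right: "inner_form h \<Longrightarrow> h v (\<Sum>i\<in>I. f i) = (\<Sum>i\<in>I. h v (f i))"
  using linear_sum[of "h v"] by (simp add: inner_form_def bilinear_def)

section \<open>Orthonormal bases and traces\<close>

definition orthonormal :: "('v::euclidean_space \<Rightarrow> 'v \<Rightarrow> real) \<Rightarrow> 'v set \<Rightarrow> bool" where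
  "orthonormal h E \<longleftrightarrow> (\<forall>e\<in>E. \<forall>e'\<in>E. h e e' = (if e = e' then 1 else 0))"

lemma is_onb_orthonormal: "is_onb h S E \<longleftrightarrow> orthonormal h E \<and> span E = S"
  by (simp add: is_onb_def orthonormal_def)

lemma inner_form_orthonormal_sum:
  assumes "inner_form h" "orthonormal h E" "finite T" "T \<subseteq> E" "e \<in> T"
  shows "h (\<Sum>x\<in>T. f x *\<^sub>R x) e = f e"
proof -
  have "h (\<Sum>x\<in>T. f x *\<^sub>R x) e = (\<Sum>x\<in>T. f x * h x e)"
    by (simp add: inner_form_sum_left[OF assms(1)] inner_form_simps[OF assms(1)])
  also have "\<dots> = (\<Sum>x\<in>T. if x = e then f e else 0)"
    using assms(2,4,5) by (intro sum.cong) (auto simp: orthonormal_def subset_iff)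
  finally show ?thesis using assms(3,5) by simp
qed

text \<open>Pairing a vanishing combination with one of its vectors isolates the coefficient.
  Independence is also what makes an orthonormal set finite, which \<open>is_onb\<close> does not
  demand.\<close>

lemma orthonormal_independent:
  assumes "inner_form h" "orthonormal h E"
  shows "independent E"
  unfolding independent_explicit_finite_subsets
proof (intro allI impI ballI)
  fix T u v
  assume *: "T \<subseteq> E" "finite T" "(\<Sum>x\<in>T. u x *\<^sub>R x) = 0" "v \<in> T"
  have "u v = h (\<Sum>x\<in>T. u x *\<^sub>R x) v"
    using inner_form_orthonormal_sum[OF assms *(2,1,4)] by simp
  then show "u v = 0" using *(3) by (simp add: inner_form_simps[OF assms(1)])
qed

lemma orthonormal_finite: "inner_form h \<Longrightarrow> orthonormal h E \<Longrightarrow> finite E"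
  using orthonormal_independent independent_imp_finite by blast

lemma inner_form_orth_span:
  assumes "inner_form h" "\<And>e. e \<in> E \<Longrightarrow> h v e = 0" "w \<in> span E"
  shows "h v w = 0"
proof -
  have "linear (h v)" using inner_form_bilinear[OF assms(1)] by (simp add: bilinear_def)
  then show ?thesis using linear_eq_0_on_span assms(2,3) by blast
qed

lemma onb_residual:
  assumes "inner_form h" "orthonormal h E" "e \<in> E"
  shows "h (v - (\<Sum>e\<in>E. h v e *\<^sub>R e)) e = 0"
  using inner_form_orthonormal_sum[OF assms(1,2) orthonormal_finite[OF assms(1,2)] subset_refl assms(3)]
  by (simp add: inner_form_simps[OF assms(1)])

lemma onb_expand:
  assumes "inner_form h" "is_onb h S E" "v \<in> S"
  shows "v = (\<Sum>e\<in>E. h v e *\<^sub>R e)"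
proof -
  have E: "orthonormal h E" "span E = S" using assms(2) by (auto simp: is_onb_orthonormal)
  let ?w = "v - (\<Sum>e\<in>E. h v e *\<^sub>R e)"
  have "?w \<in> span E"
    using assms(3) E(2) by (intro span_diff span_sum span_scale) (auto intro: span_base)
  then have "h ?w ?w = 0"
    using inner_form_orth_span[OF assms(1)] onb_residual[OF assms(1) E(1)] by blast
  then show ?thesis using inner_form_eq_0[OF assms(1)] by simp
qed

text \<open>Take an orthonormal subset of S of largest cardinality, which is bounded by the
  dimension. If it did not span S, the normalised residual of a missed vector would enlarge
  it.\<close>

theorem onb_exists:
  fixes h :: "'v::euclidean_space \<Rightarrow> 'v \<Rightarrow> real"
  assumes h: "inner_form h" and S: "subspace S"
  shows "\<exists>E. is_onb h S E"
proof -
  let ?P = "\<lambda>E. orthonormal h E \<and> E \<subseteq> S"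
  have "?P {}" by (simp add: orthonormal_def)
  moreover have "\<forall>E. ?P E \<longrightarrow> card E < Suc DIM('v)"
    using independent_bound orthonormal_independent[OF h] by (auto simp: less_Suc_eq_le)
  ultimately obtain E where E: "orthonormal h E" "E \<subseteq> S" and max: "\<And>E'. ?P E' \<Longrightarrow> card E' \<le> card E"
    using ex_has_greatest_nat[of ?P "{}" card "Suc DIM('v)"] by blast
  have fin: "finite E" using orthonormal_finite[OF h E(1)] .
  have "S \<subseteq> span E"
  proof (rule ccontr)
    assume "\<not> S \<subseteq> span E"
    then obtain v where v: "v \<in> S" "v \<notin> span E" by blast
    define w where "w = v - (\<Sum>e\<in>E. h v e *\<^sub>R e)"
    have s: "(\<Sum>e\<in>E. h v e *\<^sub>R e) \<in> span E"
      by (intro span_sum span_scale span_base)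
    have "w \<noteq> 0" using v(2) s by (auto simp: w_def)
    then have pos: "h w w > 0" using h by (simp add: inner_form_def)
    have "w \<in> S"
      using v(1) s E(2) S span_minimal[OF E(2) S] by (auto simp: w_def intro: subspace_diff)
    have orth1: "h w e = 0" if "e \<in> E" for e
      unfolding w_def by (rule onb_residual[OF h E(1) that])
    then have orth: "h w e = 0" "h e w = 0" if "e \<in> E" for e
      using that inner_form_sym[OF h, of e w] by auto
    define u where "u = (1 / sqrt (h w w)) *\<^sub>R w"
    have u: "h u u = 1" "\<And>e. e \<in> E \<Longrightarrow> h u e = 0" "\<And>e. e \<in> E \<Longrightarrow> h e u = 0"
      using pos orth by (simp_all add: u_def inner_form_simps[OF h] power2_eq_square[symmetric] real_sqrt_pow2)
    have "u \<notin> E" using u(1,2) by fastforce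
    moreover have "?P (insert u E)"
      using E u \<open>w \<in> S\<close> S \<open>u \<notin> E\<close> by (auto simp: orthonormal_def u_def subspace_scale)
    ultimately have "card (insert u E) \<le> card E" using max by blast
    then show False using \<open>u \<notin> E\<close> fin by simp
  qed
  then have "span E = S" using span_minimal[OF E(2) S] by blast
  then show ?thesis using E(1) by (auto simp: is_onb_orthonormal)
qed

lemma onb_finite: "inner_form h \<Longrightarrow> is_onb h S E \<Longrightarrow> finite E"
  using orthonormal_finite by (auto simp: is_onb_orthonormal)

lemma onb_card: "inner_form h \<Longrightarrow> is_onb h S E \<Longrightarrow> card E = dim S"
  using orthonormal_independent[of h E] dim_span_eq_card_independent[of E] by (auto simp: is_onb_orthonormal)

lemma onb_subspace: "is_onb h S E \<Longrightarrow> subspace S"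
  by (auto simp: is_onb_orthonormal)

lemma onb_subset: "is_onb h S E \<Longrightarrow> E \<subseteq> S"
  by (auto simp: is_onb_orthonormal span_base)

text \<open>Expand each vector of one basis in the other and swap the sums; the coefficients
  \<open>h e d\<close> are symmetric. This makes the choice by \<open>SOME\<close> in
  \<open>trace_on\<close> harmless for bilinear maps.\<close>

lemma onb_trace_eq:
  assumes h: "inner_form h" and E: "is_onb h S E" and E': "is_onb h S E'" and B: "bilinear B"
  shows "(\<Sum>e\<in>E. B e e) = (\<Sum>e\<in>E'. B e e)"
proof -
  have l: "linear (B x)" "linear (\<lambda>x. B x y)" for x y
    using B by (auto simp: bilinear_def)
  have "(\<Sum>e\<in>E. B e e) = (\<Sum>e\<in>E. \<Sum>d\<in>E'. h e d *\<^sub>R B d e)"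
  proof (rule sum.cong[OF refl])
    fix e assume "e \<in> E"
    then have "e = (\<Sum>d\<in>E'. h e d *\<^sub>R d)"
      using onb_expand[OF h E'] onb_subset[OF E] by blast
    then have "B e e = B (\<Sum>d\<in>E'. h e d *\<^sub>R d) e" by simp
    then show "B e e = (\<Sum>d\<in>E'. h e d *\<^sub>R B d e)"
      by (simp add: linear_sum[OF l(2)] linear_cmul[OF l(2)])
  qed
  also have "\<dots> = (\<Sum>d\<in>E'. \<Sum>e\<in>E. h d e *\<^sub>R B d e)"
    by (subst sum.swap) (simp add: inner_form_sym[OF h])
  also have "\<dots> = (\<Sum>d\<in>E'. B d d)"
  proof (rule sum.cong[OF refl])
    fix d assume "d \<in> E'"
    then have "d = (\<Sum>e\<in>E. h d e *\<^sub>R e)"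
      using onb_expand[OF h E] onb_subset[OF E'] by blast
    then have "B d d = B d (\<Sum>e\<in>E. h d e *\<^sub>R e)" by simp
    then show "(\<Sum>e\<in>E. h d e *\<^sub>R B d e) = B d d"
      by (simp add: linear_sum[OF l(1)] linear_cmul[OF l(1)])
  qed
  finally show ?thesis .
qed

lemma trace_on_eq:
  assumes "inner_form h" "is_onb h S E" "bilinear B"
  shows "trace_on h S B = (\<Sum>e\<in>E. B e e)"
  unfolding trace_on_def
  by (rule onb_trace_eq[OF assms(1) _ assms(2,3)]) (use assms(2) in \<open>auto intro: someI_ex\<close>)

text \<open>A trace formula free of orthonormal vectors: the \<open>\<theta> b\<close> are dual to
  the standard basis with respect to h, so the right side is the contraction with the inverse
  metric. Unlike orthonormal bases chosen point by point, this dual basis varies differentiably with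
  h.\<close>

lemma onb_trace_dual:
  assumes h: "inner_form h" and E: "is_onb h UNIV E" and B: "bilinear B"
    and \<theta>: "\<And>b v. b \<in> Basis \<Longrightarrow> h (\<theta> b) v = v \<bullet> b"
  shows "(\<Sum>e\<in>E. B e e) = (\<Sum>b\<in>Basis. B b (\<theta> b))"
proof -
  have l: "linear (B x)" "linear (\<lambda>x. B x y)" for x y
    using B by (auto simp: bilinear_def)
  have "(\<Sum>e\<in>E. B e e) = (\<Sum>e\<in>E. \<Sum>b\<in>Basis. (e \<bullet> b) *\<^sub>R B b e)"
  proof (rule sum.cong[OF refl])
    fix e
    have "B e e = B (\<Sum>b\<in>Basis. (e \<bullet> b) *\<^sub>R b) e" by (simp add: euclidean_representation)
    then show "B e e = (\<Sum>b\<in>Basis. (e \<bullet> b) *\<^sub>R B b e)"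
      by (simp only: linear_sum[OF l(2)] linear_cmul[OF l(2)])
  qed
  also have "\<dots> = (\<Sum>b\<in>Basis. \<Sum>e\<in>E. h (\<theta> b) e *\<^sub>R B b e)"
    by (subst sum.swap) (simp add: \<theta>)
  also have "\<dots> = (\<Sum>b\<in>Basis. B b (\<theta> b))"
  proof (rule sum.cong[OF refl])
    fix b :: 'a
    have "\<theta> b = (\<Sum>e\<in>E. h (\<theta> b) e *\<^sub>R e)"
      using onb_expand[OF h E] by blast
    then have "B b (\<theta> b) = B b (\<Sum>e\<in>E. h (\<theta> b) e *\<^sub>R e)" by simp
    then show "(\<Sum>e\<in>E. h (\<theta> b) e *\<^sub>R B b e) = B b (\<theta> b)"
      by (simp only: linear_sum[OF l(1)] linear_cmul[OF l(1)])
  qed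
  finally show ?thesis .
qed

section \<open>Orthogonal complements and projections\<close>

lemma orth_compl_subspace: "inner_form h \<Longrightarrow> subspace (orth_compl h S)"
  by (auto simp: subspace_def orth_compl_def inner_form_simps)

lemma orth_compl_Int:
  assumes "inner_form h" "v \<in> S" "v \<in> orth_compl h S"
  shows "v = 0"
  using assms inner_form_eq_0[OF assms(1)] by (auto simp: orth_compl_def)

lemma orth_decomposition:
  assumes h: "inner_form h" and S: "subspace S"
  shows "\<exists>w. w \<in> S \<and> v - w \<in> orth_compl h S"
proof -
  obtain E where E: "is_onb h S E" using onb_exists[OF h S] by blast
  then have o: "orthonormal h E" "span E = S" by (auto simp: is_onb_orthonormal)
  let ?w = "\<Sum>e\<in>E. h v e *\<^sub>R e"
  have "?w \<in> S" unfolding o(2)[symmetric] by (intro span_sum span_scale span_base)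
  moreover have "v - ?w \<in> orth_compl h S"
    using inner_form_orth_span[OF h onb_residual[OF h o(1)]] o(2) by (auto simp: orth_compl_def)
  ultimately show ?thesis by blast
qed

text \<open>Existence and uniqueness give the definite description in \<open>orth_proj\<close> its
  meaning: two candidates differ by a vector of S that is orthogonal to S.\<close>

lemma orth_proj:
  assumes h: "inner_form h" and S: "subspace S"
  shows "orth_proj h S v \<in> S" "v - orth_proj h S v \<in> orth_compl h S"
proof -
  have "\<exists>!w. w \<in> S \<and> v - w \<in> orth_compl h S"
  proof (rule ex_ex1I[OF orth_decomposition[OF assms]])
    fix w w' assume *: "w \<in> S \<and> v - w \<in> orth_compl h S" "w' \<in> S \<and> v - w' \<in> orth_compl h S"
    have "w - w' = (v - w') - (v - w)" by simp
    then have "w - w' \<in> orth_compl h S"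
      using * subspace_diff[OF orth_compl_subspace[OF h]] by metis
    moreover have "w - w' \<in> S" using * S subspace_diff by blast
    ultimately show "w = w'" using orth_compl_Int[OF h] by fastforce
  qed
  from theI'[OF this]
  show "orth_proj h S v \<in> S" "v - orth_proj h S v \<in> orth_compl h S"
    unfolding orth_proj_def by auto
qed

lemma onb_Un:
  assumes h: "inner_form h" and E: "is_onb h S E" and E': "is_onb h (orth_compl h S) E'"
  shows "is_onb h UNIV (E \<union> E')" "E \<inter> E' = {}"
proof -
  have sub: "E \<subseteq> S" "E' \<subseteq> orth_compl h S" using onb_subset E E' by auto
  have o: "orthonormal h E" "orthonormal h E'" "span E = S" "span E' = orth_compl h S"
    using E E' by (auto simp: is_onb_orthonormal)
  show disj: "E \<inter> E' = {}"
  proof -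
    have False if "e \<in> E" "e \<in> E'" for e
      using orth_compl_Int[OF h, of e S] that sub o(1) inner_form_eq_0[OF h, of e]
      by (auto simp: orthonormal_def)
    then show ?thesis by blast
  qed
  have "h e e' = 0" "h e' e = 0" if "e \<in> E" "e' \<in> E'" for e e'
    using that sub inner_form_sym[OF h] by (auto simp: orth_compl_def)
  then have "orthonormal h (E \<union> E')"
    using o(1,2) disj unfolding orthonormal_def by (metis Un_iff disjoint_iff)
  moreover have "v \<in> span (E \<union> E')" for v
  proof -
    obtain w where w: "w \<in> S" "v - w \<in> orth_compl h S"
      using orth_decomposition[OF h onb_subspace[OF E]] by blast
    have "w + (v - w) \<in> span (E \<union> E')"
      using w o(3,4) span_mono[of E "E \<union> E'"] span_mono[of E' "E \<union> E'"] by (intro span_add) auto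
    then show ?thesis by simp
  qed
  ultimately show "is_onb h UNIV (E \<union> E')" by (auto simp: is_onb_orthonormal)
qed

lemma trace_on_split:
  assumes h: "inner_form h" and S: "subspace S" and B: "bilinear B"
  shows "trace_on h UNIV B = trace_on h S B + trace_on h (orth_compl h S) B"
proof -
  obtain E where E: "is_onb h S E" using onb_exists[OF h S] by blast
  obtain E' where E': "is_onb h (orth_compl h S) E'" using onb_exists[OF h orth_compl_subspace[OF h]] by blast
  show ?thesis
    using onb_Un[OF h E E'] onb_finite[OF h E] onb_finite[OF h E']
    by (simp add: trace_on_eq[OF h _ B] trace_on_eq[OF h E B] trace_on_eq[OF h E' B] sum.union_disjoint)
qed

lemma orth_proj_unique:
  assumes "inner_form h" "subspace S" "w \<in> S" "v - w \<in> orth_compl h S"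
  shows "orth_proj h S v = w"
proof -
  have "orth_proj h S v - w \<in> orth_compl h S"
    using subspace_diff[OF orth_compl_subspace[OF assms(1)] assms(4) orth_proj(2)[OF assms(1,2), of v]] by simp
  moreover have "orth_proj h S v - w \<in> S"
    using orth_proj(1)[OF assms(1,2)] assms(2,3) by (simp add: subspace_diff)
  ultimately show ?thesis using orth_compl_Int[OF assms(1)] by fastforce
qed

lemma orth_proj_compl:
  assumes "inner_form h" "subspace S"
  shows "orth_proj h (orth_compl h S) v = v - orth_proj h S v"
proof (rule orth_proj_unique[OF assms(1) orth_compl_subspace[OF assms(1)] orth_proj(2)[OF assms]])
  show "v - (v - orth_proj h S v) \<in> orth_compl h (orth_compl h S)"
    using orth_proj(1)[OF assms, of v] inner_form_sym[OF assms(1)] by (auto simp: orth_compl_def)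
qed


section \<open>Metrics on open subsets of Euclidean space\<close>

definition gram :: "(real^'m \<Rightarrow> real^'m \<Rightarrow> real) \<Rightarrow> real^'m^'m" where
  "gram h = (\<chi> i j. h (axis i 1) (axis j 1))"

text \<open>The vector representing a linear form w, obtained by raising its index. Written with the
  inverse Gram matrix, as in \<open>christoffel\<close>, it visibly depends differentiably on the
  metric.\<close>

definition sharp :: "(real^'m \<Rightarrow> real^'m \<Rightarrow> real) \<Rightarrow> (real^'m \<Rightarrow> real) \<Rightarrow> real^'m" where
  "sharp h w = matrix_inv (gram h) *v (\<chi> l. w (axis l 1))"

lemma vec_expansion: "(v :: real^'m) = (\<Sum>j\<in>UNIV. v $ j *\<^sub>R axis j 1)"
  using basis_expansion[of v] by (simp add: scalar_mult_eq_scaleR)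

lemma linear_vec: 
  fixes f :: "real^'m \<Rightarrow> 'b::real_vector"
  shows "linear f \<Longrightarrow> f v = (\<Sum>j\<in>UNIV. v $ j *\<^sub>R f (axis j 1))"
  by (subst vec_expansion) (simp only: linear_sum linear_cmul)

lemma gram_mult: "inner_form h \<Longrightarrow> (gram h *v v) $ i = h (axis i 1) v"
  using linear_vec[of "h (axis i 1)" v]
  by (simp add: gram_def matrix_vector_mult_def inner_form_def bilinear_def mult.commute)

lemma invertible_gram:
  assumes "inner_form h"
  shows "invertible (gram h)"
proof -
  have "v = 0" if "gram h *v v = 0" for v
  proof (rule inner_form_eqI[OF assms])
    fix w
    have "h w v = (\<Sum>j\<in>UNIV. w $ j *\<^sub>R h (axis j 1) v)"
      by (rule linear_vec) (use assms in \<open>simp add: inner_form_def bilinear_def\<close>)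
    also have "\<dots> = 0" using gram_mult[OF assms, of v] that by simp
    finally show "h v w = h 0 w"
      by (simp add: inner_form_simps[OF assms] inner_form_sym[OF assms, of v])
  qed
  then show ?thesis
    using matrix_left_invertible_ker invertible_left_inverse by metis
qed

lemma sharp:
  assumes "inner_form h" "linear w"
  shows "h (sharp h w) v = w v"
proof -
  have e: "h (axis i 1) (sharp h w) = w (axis i 1)" for i
    using gram_mult[OF assms(1), of "sharp h w" i] matrix_inv_mult_vec[OF invertible_gram[OF assms(1)]]
    by (simp add: sharp_def)
  have "h (sharp h w) v = h v (sharp h w)" by (rule inner_form_sym[OF assms(1)])
  also have "\<dots> = (\<Sum>j\<in>UNIV. v $ j *\<^sub>R h (axis j 1) (sharp h w))"
    by (rule linear_vec) (use assms in \<open>simp add: inner_form_def bilinear_def\<close>)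
  also have "\<dots> = w v" unfolding e by (rule linear_vec[OF assms(2), symmetric])
  finally show ?thesis .
qed

text \<open>Christoffel symbols of a metric given as a function on Euclidean space, free of manifold
  and atlas. The form in l handed to \<open>sharp\<close> is the right side of the Koszul formula
  for constant fields.\<close>

definition chr :: "(real^'m \<Rightarrow> real^'m \<Rightarrow> real^'m \<Rightarrow> real) \<Rightarrow> real^'m \<Rightarrow> real^'m \<Rightarrow> real^'m \<Rightarrow> real^'m" where
  "chr g x a b = sharp (g x)
     (\<lambda>l. (fd (\<lambda>y. g y b l) x a + fd (\<lambda>y. g y a l) x b - fd (\<lambda>y. g y a b) x l) / 2)"

locale metric_on =
  fixes U :: "(real^'m) set" and g :: "real^'m \<Rightarrow> real^'m \<Rightarrow> real^'m \<Rightarrow> real"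
  assumes open_U: "open U"
    and inner: "x \<in> U \<Longrightarrow> inner_form (g x)"
    and smooth_g: "smooth_on U (\<lambda>x. g x a b)"
begin

lemma bil: "x \<in> U \<Longrightarrow> bilinear (g x)"
  using inner inner_form_bilinear by blast

lemma g_differentiable: "x \<in> U \<Longrightarrow> (\<lambda>y. g y a b) differentiable at x"
  using smooth_on_differentiable[OF smooth_g] .

lemma dg_differentiable: "x \<in> U \<Longrightarrow> (\<lambda>y. fd (\<lambda>y. g y a b) y u) differentiable at x"
  using smooth_on_differentiable[OF smooth_on_fd[OF smooth_g]] .

lemma dg_sym: "x \<in> U \<Longrightarrow> fd (\<lambda>y. g y a b) x = fd (\<lambda>y. g y b a) x"
  by (rule fd_cong[OF open_U]) (auto intro: inner_form_sym[OF inner])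

lemma dg_linear:
  assumes "x \<in> U"
  shows "linear (\<lambda>b. fd (\<lambda>y. g y a b) x u)" "linear (\<lambda>a. fd (\<lambda>y. g y a b) x u)"
    "linear (\<lambda>u. fd (\<lambda>y. g y a b) x u)"
  using linear_fd_param[OF open_U assms, of "\<lambda>y. g y a"] linear_fd_param[OF open_U assms, of "\<lambda>y a. g y a b"]
    bil g_differentiable[OF assms] linear_fd[OF g_differentiable[OF assms]]
  by (auto simp: bilinear_def)

lemma has_derivative_metric:
  assumes "f x \<in> U" "(f has_derivative f') (at x)" "(V has_derivative V') (at x)" "(Z has_derivative Z') (at x)"
  shows "((\<lambda>x. g (f x) (V x) (Z x)) has_derivative
           (\<lambda>u. fd (\<lambda>y. g y (V x) (Z x)) (f x) (f' u) + g (f x) (V' u) (Z x) + g (f x) (V x) (Z' u))) (at x)"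
  by (rule has_derivative_param_bilinear[OF open_U assms(1) bil g_differentiable[OF assms(1)] assms(2-4)])

lemma g_chr:
  assumes "x \<in> U"
  shows "g x (chr g x a b) l = (fd (\<lambda>y. g y b l) x a + fd (\<lambda>y. g y a l) x b - fd (\<lambda>y. g y a b) x l) / 2"
  unfolding chr_def
proof (rule sharp[OF inner[OF assms]])
  note l = dg_linear[OF assms]
  show "linear (\<lambda>l. (fd (\<lambda>y. g y b l) x a + fd (\<lambda>y. g y a l) x b - fd (\<lambda>y. g y a b) x l) / 2)"
    by (rule linearI) (simp_all add: linear_add[OF l(1)] linear_add[OF l(3)] linear_cmul[OF l(1)]
        linear_cmul[OF l(3)] field_simps)
qed

lemma chr_sym:
  assumes "x \<in> U"
  shows "chr g x a b = chr g x b a"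
proof (rule inner_form_eqI[OF inner[OF assms]])
  show "g x (chr g x a b) w = g x (chr g x b a) w" for w
    unfolding g_chr[OF assms] dg_sym[OF assms, of a b] by simp
qed

lemma chr_bilinear:
  assumes "x \<in> U"
  shows "bilinear (chr g x)"
proof -
  note l = dg_linear[OF assms]
  have 1: "linear (\<lambda>b. chr g x a b)" for a
    by (rule linearI; rule inner_form_eqI[OF inner[OF assms]])
      (simp_all add: g_chr[OF assms] inner_form_simps[OF inner[OF assms]] linear_add[OF l(1)] linear_add[OF l(2)]
        linear_add[OF l(3)] linear_cmul[OF l(1)] linear_cmul[OF l(2)] linear_cmul[OF l(3)] field_simps)
  then show ?thesis using chr_sym[OF assms] by (simp add: bilinear_def)
qed

text \<open>Metric compatibility for constant fields: in the sum of two Koszul formulas everything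
  but the derivative in direction a cancels.\<close>

lemma dg_eq: "x \<in> U \<Longrightarrow> fd (\<lambda>y. g y b c) x a = g x (chr g x a b) c + g x b (chr g x a c)"
  by (simp add: g_chr dg_sym[of x a b] dg_sym[of x a c] dg_sym[of x c b] inner_form_sym[OF inner, of x b "chr g x a c"]
      field_simps)

lemma chr_differentiable:
  assumes "x \<in> U"
  shows "(\<lambda>y. chr g y a b) differentiable at x"
  unfolding chr_def sharp_def
  by (rule differentiable_matrix_inv[OF open_U assms invertible_gram[OF inner]])
    (auto simp: gram_def intro!: g_differentiable dg_differentiable assms differentiable_divide
      differentiable_add differentiable_diff)

text \<open>Stated along a map f because the rule has to serve two connections: with f the identity
  it concerns the Levi-Civita derivative, in general the pullback connection.\<close>

lemma metric_compatible:
  assumes x: "f x \<in> U" and f: "f differentiable at x" and V: "V differentiable at x" and Z: "Z differentiable at x"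
  shows "fd (\<lambda>y. g (f y) (V y) (Z y)) x u =
     g (f x) (fd V x u + chr g (f x) (fd f x u) (V x)) (Z x) + g (f x) (V x) (fd Z x u + chr g (f x) (fd f x u) (Z x))"
  using fd_eqI[OF has_derivative_metric[of f, OF x f[unfolded frechet_derivative_works]
        V[unfolded frechet_derivative_works] Z[unfolded frechet_derivative_works]]]
  by (simp add: dg_eq[OF x] inner_form_simps[OF inner[OF x]])

text \<open>Differentiate \<open>g y w z\<close> in directions v and u. The second derivative is
  symmetric in u and v, and so is the sum of the two mixed terms, which pair one Christoffel symbol
  with another; antisymmetrising leaves only the curvature. R is the curvature on constant fields,
  which have no bracket term.\<close>

lemma curvature_skew:
  assumes x: "x \<in> U"
  defines "R \<equiv> \<lambda>u v w. (fd (\<lambda>y. chr g y v w) x u + chr g x u (chr g x v w))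
      - (fd (\<lambda>y. chr g y u w) x v + chr g x v (chr g x u w))"
  shows "g x (R u v w) z = - g x (R u v z) w"
proof -
  note d = chr_differentiable[OF x]
  have *: "fd (\<lambda>y. fd (\<lambda>y. g y w z) y v) x u =
      g x (fd (\<lambda>y. chr g y v w) x u + chr g x u (chr g x v w)) z + g x (chr g x v w) (chr g x u z)
    + (g x (chr g x u w) (chr g x v z) + g x w (fd (\<lambda>y. chr g y v z) x u + chr g x u (chr g x v z)))" for u v
  proof -
    have "fd (\<lambda>y. fd (\<lambda>y. g y w z) y v) x u = fd (\<lambda>y. g y (chr g y v w) z + g y w (chr g y v z)) x u"
      by (rule fun_cong[OF fd_cong[OF open_U x]]) (rule dg_eq)
    also have "\<dots> = fd (\<lambda>y. g y (chr g y v w) z) x u + fd (\<lambda>y. g y w (chr g y v z)) x u"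
    proof -
      have "(\<lambda>y. g y (chr g y v w) z) differentiable at x" "(\<lambda>y. g y w (chr g y v z)) differentiable at x"
        using has_derivative_metric[of "\<lambda>y. y", OF x has_derivative_ident] d[unfolded frechet_derivative_works]
          has_derivative_const differentiableI by blast+
      then show ?thesis
        using fd_eqI[OF has_derivative_add] by (fastforce simp: frechet_derivative_works)
    qed
    finally show ?thesis
      using metric_compatible[of "\<lambda>y. y", OF x _ d differentiable_const]
        metric_compatible[of "\<lambda>y. y", OF x _ differentiable_const d] by simp
  qed
  have "fd (\<lambda>y. fd (\<lambda>y. g y w z) y v) x u = fd (\<lambda>y. fd (\<lambda>y. g y w z) y u) x v"
    by (rule second_derivative_symmetric[OF open_U smooth_g x])
  then show ?thesis
    unfolding * R_def
    by (simp add: inner_form_simps[OF inner[OF x]] inner_form_sym[OF inner[OF x], of _ w])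
qed

end

text \<open>Tested against \<open>fd T x l\<close>, which reaches every vector by surjectivity, both
  sides are given by Koszul formulas. The one for g brings in six terms with second derivatives of
  T: four cancel by symmetry, and the remaining two agree and form the inhomogeneous term.\<close>

lemma chr_transform:
  assumes "metric_on U g" "metric_on V h" and T: "smooth_on U T" "\<And>y. y \<in> U \<Longrightarrow> T y \<in> V"
    and iso: "\<And>y a b. y \<in> U \<Longrightarrow> g y a b = h (T y) (fd T y a) (fd T y b)"
    and x: "x \<in> U" and surj: "surj (fd T x)"
  shows "fd T x (chr g x a b) = fd (\<lambda>y. fd T y b) x a + chr h (T x) (fd T x a) (fd T x b)"
proof -
  interpret g: metric_on U g by fact
  interpret h: metric_on V h by fact
  note Tx = T(2)[OF x]
  have dT: "T differentiable at x" "(\<lambda>y. fd T y a) differentiable at x" for a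
    using smooth_on_differentiable[OF _ x] smooth_on_fd T(1) by blast+
  have D: "fd (\<lambda>y. g y b l) x a = fd (\<lambda>z. h z (fd T x b) (fd T x l)) (T x) (fd T x a)
    + h (T x) (fd (\<lambda>y. fd T y b) x a) (fd T x l) + h (T x) (fd T x b) (fd (\<lambda>y. fd T y l) x a)" for a b l
  proof -
    have "fd (\<lambda>y. g y b l) x = fd (\<lambda>y. h (T y) (fd T y b) (fd T y l)) x"
      by (rule fd_cong[OF g.open_U x]) (rule iso)
    then show ?thesis
      using fd_eqI[OF h.has_derivative_metric[of T, OF Tx dT(1)[unfolded frechet_derivative_works]
            dT(2)[unfolded frechet_derivative_works] dT(2)[unfolded frechet_derivative_works]]] by simp
  qed
  have sym: "fd (\<lambda>y. fd T y b) x a = fd (\<lambda>y. fd T y a) x b" for a b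
    by (rule second_derivative_symmetric[OF g.open_U T(1) x])
  show ?thesis
  proof (rule inner_form_eqI[OF h.inner[OF Tx]])
    fix w
    obtain l where w: "w = fd T x l" using surj by blast
    have "h (T x) (fd T x (chr g x a b)) (fd T x l) = g x (chr g x a b) l" using iso[OF x] by simp
    then show "h (T x) (fd T x (chr g x a b)) w
        = h (T x) (fd (\<lambda>y. fd T y b) x a + chr h (T x) (fd T x a) (fd T x b)) w"
      by (simp add: w inner_form_simps[OF h.inner[OF Tx]] h.g_chr[OF Tx] g.g_chr[OF x] D
          sym[of l a] sym[of l b] sym[of a b]
          inner_form_sym[OF h.inner[OF Tx], of "fd T x b"] inner_form_sym[OF h.inner[OF Tx], of "fd T x a"]
          field_simps)
  qed
qed


section \<open>Maps between open subsets of Euclidean spaces\<close>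

text \<open>The covariant derivative along f of the field \<open>fd f y b\<close>, minus the image
  of the covariant derivative of the constant field b.\<close>

definition lsff :: "(real^'m \<Rightarrow> real^'n) \<Rightarrow> (real^'m \<Rightarrow> real^'m \<Rightarrow> real^'m \<Rightarrow> real) \<Rightarrow>
    (real^'n \<Rightarrow> real^'n \<Rightarrow> real^'n \<Rightarrow> real) \<Rightarrow> real^'m \<Rightarrow> real^'m \<Rightarrow> real^'m \<Rightarrow> real^'n" where
  "lsff f g h x a b =
     fd (\<lambda>y. fd f y b) x a + chr h (f x) (fd f x a) (fd f x b) - fd f x (chr g x a b)"

locale map_on = g: metric_on U g + h: metric_on V h
  for U :: "(real^'m) set" and g and V :: "(real^'n) set" and h +
  fixes f :: "real^'m \<Rightarrow> real^'n"
  assumes smooth_f: "smooth_on U f" and maps: "x \<in> U \<Longrightarrow> f x \<in> V"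
begin

abbreviation S where "S \<equiv> lsff f g h"

lemma f_differentiable: "x \<in> U \<Longrightarrow> f differentiable at x"
  using smooth_on_differentiable[OF smooth_f] .

lemma df_differentiable: "x \<in> U \<Longrightarrow> (\<lambda>y. fd f y a) differentiable at x"
  using smooth_on_differentiable[OF smooth_on_fd[OF smooth_f]] .

lemma ddf_differentiable: "x \<in> U \<Longrightarrow> (\<lambda>y. fd (\<lambda>y. fd f y a) y b) differentiable at x"
  using smooth_on_differentiable[OF smooth_on_fd[OF smooth_on_fd[OF smooth_f]]] .

lemma df_linear: "x \<in> U \<Longrightarrow> linear (fd f x)"
  using linear_fd f_differentiable by blast

lemma ddf_sym: "x \<in> U \<Longrightarrow> fd (\<lambda>y. fd f y b) x a = fd (\<lambda>y. fd f y a) x b"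
  by (rule second_derivative_symmetric[OF g.open_U smooth_f])

lemma S_sym: "x \<in> U \<Longrightarrow> S x a b = S x b a"
  unfolding lsff_def ddf_sym[of x b a] g.chr_sym[of x a b] h.chr_sym[OF maps, of x "fd f x a"] ..

lemma S_bilinear:
  assumes x: "x \<in> U"
  shows "bilinear (S x)"
proof -
  have l: "linear (\<lambda>b. fd (\<lambda>y. fd f y b) x a)" for a
    by (rule linear_fd_param[OF g.open_U x df_linear df_differentiable[OF x]])
  note b = g.chr_bilinear[OF x] h.chr_bilinear[OF maps[OF x]]
  have 1: "linear (S x a)" for a
    by (rule linearI)
      (simp_all add: lsff_def linear_add[OF l] linear_cmul[OF l] linear_add[OF df_linear[OF x]]
        linear_cmul[OF df_linear[OF x]] bilinear_radd[OF b(1)] bilinear_radd[OF b(2)]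
        bilinear_rmul[OF b(1)] bilinear_rmul[OF b(2)] algebra_simps)
  then show ?thesis using S_sym[OF x] by (simp add: bilinear_def)
qed

lemma S_differentiable:
  assumes x: "x \<in> U"
  shows "(\<lambda>y. S y a b) differentiable at x"
proof -
  note f = f_differentiable[OF x, unfolded frechet_derivative_works]
    and df = df_differentiable[OF x, unfolded frechet_derivative_works]
  have "(\<lambda>y. chr h (f y) (fd f y a) (fd f y b)) differentiable at x"
    by (rule differentiableI[OF has_derivative_param_bilinear[OF h.open_U maps[OF x] h.chr_bilinear
          h.chr_differentiable[OF maps[OF x]] f df df]])
  moreover have "(\<lambda>y. fd f y (chr g y a b)) differentiable at x"
    by (rule differentiableI[OF has_derivative_param_linear[OF g.open_U x df_linear df_differentiable[OF x]
          has_derivative_ident g.chr_differentiable[OF x, unfolded frechet_derivative_works]]])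
  ultimately show ?thesis
    unfolding lsff_def by (intro differentiable_add differentiable_diff ddf_differentiable x)
qed

text \<open>The pulled back form \<open>T = f\<^sup>* h\<close> is \<open>g(Q\<cdot>, \<cdot>)\<close> for an operator field \<open>Q\<close>. If f is
  isometric on horizontal vectors then \<open>Q\<close> is the horizontal projection, so it extends horizontal
  vectors to horizontal fields \<open>Q b\<close> with \<open>df (Q b) = df b\<close>.\<close>

definition pull :: "real^'m \<Rightarrow> real^'m \<Rightarrow> real^'m \<Rightarrow> real" where
  "pull x a b = h (f x) (fd f x a) (fd f x b)"

definition Q :: "real^'m \<Rightarrow> real^'m \<Rightarrow> real^'m" where
  "Q x b = sharp (g x) (pull x b)"

definition hor :: "real^'m \<Rightarrow> (real^'m) set" where
  "hor x = orth_compl (g x) {k. fd f x k = 0}"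

definition riem :: bool where
  "riem \<longleftrightarrow> (\<forall>x\<in>U. \<forall>u\<in>hor x. \<forall>v\<in>hor x. pull x u v = g x u v)"

lemma pull_linear: "x \<in> U \<Longrightarrow> linear (pull x b)"
  unfolding pull_def using linear_compose[OF df_linear, of x "h (f x) (fd f x b)"] h.bil[OF maps]
  by (auto simp: bilinear_def o_def)

lemma g_Q: "x \<in> U \<Longrightarrow> g x (Q x b) w = pull x b w"
  unfolding Q_def by (rule sharp[OF g.inner pull_linear])

lemma Q_differentiable:
  assumes x: "x \<in> U"
  shows "(\<lambda>y. Q y b) differentiable at x"
  unfolding Q_def sharp_def
proof (rule differentiable_matrix_inv[OF g.open_U x invertible_gram[OF g.inner]])
  note f = f_differentiable[OF x, unfolded frechet_derivative_works]
    and df = df_differentiable[OF x, unfolded frechet_derivative_works]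
  show "(\<lambda>y. (\<chi> l. pull y b (axis l 1)) $ i) differentiable at x" for i
    using differentiableI[OF h.has_derivative_metric[OF maps[OF x] f df df]] by (simp add: pull_def)
qed (auto simp: gram_def intro: g.g_differentiable[OF x])

lemma ker_subspace: "x \<in> U \<Longrightarrow> subspace {k. fd f x k = 0}"
  using linear_subspace_kernel[OF df_linear] .

text \<open>Split b and the test vector into kernel and horizontal parts. The pulled back form sees
  only the horizontal parts, where it equals g, so \<open>Q x b\<close> represents the same form as
  the horizontal part of b.\<close>

lemma
  assumes riem and x: "x \<in> U"
  shows Q_projection: "Q x b \<in> hor x" "fd f x (b - Q x b) = 0"
proof -
  let ?K = "{k. fd f x k = 0}"
  note lin = df_linear[OF x] and gx = g.inner[OF x] and hx = h.inner[OF maps[OF x]]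
  have dec: "\<exists>k v. w = k + v \<and> fd f x k = 0 \<and> v \<in> hor x" for w
  proof -
    obtain k where "k \<in> ?K" "w - k \<in> hor x"
      using orth_decomposition[OF gx ker_subspace[OF x], of w] unfolding hor_def by blast
    then show ?thesis by (intro exI[of _ k] exI[of _ "w - k"]) simp
  qed
  obtain k v where b: "b = k + v" "fd f x k = 0" "v \<in> hor x" using dec by blast
  have "Q x b = v"
  proof (rule inner_form_eqI[OF gx])
    fix w
    obtain k' v' where w: "w = k' + v'" "fd f x k' = 0" "v' \<in> hor x" using dec by blast
    have "g x (Q x b) w = pull x v v'"
      using b(2) w(2) by (simp add: g_Q[OF x] pull_def b(1) w(1) linear_add[OF lin])
    also have "\<dots> = g x v v'" using assms b(3) w(3) by (simp add: riem_def)
    also have "\<dots> = g x v w" using b(3) w(2) by (simp add: w(1) inner_form_simps[OF gx] hor_def orth_compl_def)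
    finally show "g x (Q x b) w = g x v w" .
  qed
  then show "Q x b \<in> hor x" "fd f x (b - Q x b) = 0" using b by auto
qed

lemma Q_hor:
  assumes riem and x: "x \<in> U" and b: "b \<in> hor x"
  shows "Q x b = b"
proof -
  have "b - Q x b \<in> hor x"
    using Q_projection(1)[OF assms(1,2), of b] b orth_compl_subspace[OF g.inner[OF x]]
    by (auto simp: hor_def intro: subspace_diff)
  moreover have "b - Q x b \<in> {k. fd f x k = 0}" using Q_projection(2)[OF assms(1,2)] by simp
  ultimately have "b - Q x b = 0"
    unfolding hor_def by (rule orth_compl_Int[OF g.inner[OF x], rotated])
  then show ?thesis by simp
qed

text \<open>On U, \<open>h (f y) (fd f y b) (fd f y c)\<close> equals
  \<open>g y (Q y b) (Q y c)\<close>, and both are differentiated in direction a. The first yields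
  the pullback derivatives of the images of b and c, the second the Christoffel terms that
  \<open>lsff\<close> subtracts from them.\<close>

lemma S_skew:
  assumes r: riem and x: "x \<in> U" and b: "b \<in> hor x" and c: "c \<in> hor x"
  shows "h (f x) (S x a b) (fd f x c) + h (f x) (S x a c) (fd f x b) = 0"
proof -
  note fx = maps[OF x] and lin = df_linear[OF x] and gx = g.inner[OF x] and hx = h.inner[OF maps[OF x]]
  \<comment> \<open>\<open>fd f y (Q y b)\<close> and \<open>fd f y b\<close> agree for all y in U,
    so where \<open>Q x b = b\<close> the derivative of the horizontal extension is
    vertical.\<close>
  have dQ: "fd f x (fd (\<lambda>y. Q y b) x a) = 0" if "b \<in> hor x" for b
  proof -
    have "fd (\<lambda>y. fd f y (Q y b)) x = fd (\<lambda>y. fd f y b) x"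
    proof (rule fd_cong[OF g.open_U x])
      fix y assume y: "y \<in> U"
      show "fd f y (Q y b) = fd f y b"
        using Q_projection(2)[OF r y, of b] by (simp add: linear_diff[OF df_linear[OF y]])
    qed
    moreover have "fd (\<lambda>y. fd f y (Q y b)) x = (\<lambda>u. fd (\<lambda>y. fd f y (Q x b)) x u + fd f x (fd (\<lambda>y. Q y b) x u))"
      by (rule fd_eqI[OF has_derivative_param_linear[OF g.open_U x df_linear df_differentiable[OF x]
          has_derivative_ident Q_differentiable[OF x, unfolded frechet_derivative_works]]])
    ultimately have "(\<lambda>u. fd (\<lambda>y. fd f y b) x u + fd f x (fd (\<lambda>y. Q y b) x u)) = fd (\<lambda>y. fd f y b) x"
      unfolding Q_hor[OF r x that] by simp
    from fun_cong[OF this, of a] show ?thesis by simp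
  qed
  have "fd (\<lambda>y. h (f y) (fd f y b) (fd f y c)) x a = fd (\<lambda>y. g y (Q y b) (Q y c)) x a"
  proof (rule fun_cong[OF fd_cong[OF g.open_U x]])
    fix y assume y: "y \<in> U"
    have "fd f y (Q y b) = fd f y b" for b
      using Q_projection(2)[OF r y, of b] by (simp add: linear_diff[OF df_linear[OF y]])
    moreover have "pull y (Q y b) (Q y c) = g y (Q y b) (Q y c)"
      using r y Q_projection(1)[OF r y, of b] Q_projection(1)[OF r y, of c] by (simp add: riem_def)
    ultimately show "h (f y) (fd f y b) (fd f y c) = g y (Q y b) (Q y c)"
      by (simp add: pull_def)
  qed
  also have "\<dots> = g x (fd (\<lambda>y. Q y b) x a + chr g x a b) c + g x b (fd (\<lambda>y. Q y c) x a + chr g x a c)"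
    using g.metric_compatible[of "\<lambda>y. y", OF x _ Q_differentiable[OF x] Q_differentiable[OF x]]
    by (simp add: Q_hor[OF r x b] Q_hor[OF r x c])
  also have "\<dots> = pull x c (fd (\<lambda>y. Q y b) x a + chr g x a b) + pull x b (fd (\<lambda>y. Q y c) x a + chr g x a c)"
    using g_Q[OF x, of b] g_Q[OF x, of c]
    by (simp add: Q_hor[OF r x b] Q_hor[OF r x c] inner_form_sym[OF gx, of _ c])
  also have "\<dots> = h (f x) (fd f x c) (fd f x (chr g x a b)) + h (f x) (fd f x b) (fd f x (chr g x a c))"
    by (simp add: pull_def linear_add[OF lin] dQ[OF b] dQ[OF c])
  finally show ?thesis
    using h.metric_compatible[OF fx f_differentiable[OF x] df_differentiable[OF x, of b] df_differentiable[OF x, of c], of a]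
    by (simp add: lsff_def inner_form_simps[OF hx] inner_form_sym[OF hx, of _ "fd f x b"]
      inner_form_sym[OF hx, of _ "fd f x c"])
qed

text \<open>The trilinear form in a, b, c is symmetric in the first two arguments and skew in the
  last two; running through the permutations shows it to be its own negative. The same argument
  underlies the uniqueness of the Levi-Civita connection.\<close>

lemma S_normal:
  assumes r: riem and x: "x \<in> U" and "a \<in> hor x" "b \<in> hor x" "c \<in> hor x"
  shows "h (f x) (S x a b) (fd f x c) = 0"
  using S_skew[OF r x assms(4,5), of a] S_skew[OF r x assms(3,4), of c] S_skew[OF r x assms(5,3), of b]
    S_sym[OF x, of a b] S_sym[OF x, of b c] S_sym[OF x, of a c]
  by simp

end

text \<open>Tensoriality under isometric coordinate changes. Differentiating
  \<open>f (s y) = T (f0 y)\<close> twice produces second derivatives of s and T, and these are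
  exactly the inhomogeneous terms of \<open>chr_transform\<close> in source and target.\<close>

lemma lsff_transform:
  assumes "map_on U0 g0 V0 h0 f0" "map_on U g V h f"
    and s: "smooth_on U0 s" "\<And>y. y \<in> U0 \<Longrightarrow> s y \<in> U" "surj (fd s x)"
      "\<And>y a b. y \<in> U0 \<Longrightarrow> g0 y a b = g (s y) (fd s y a) (fd s y b)"
    and T: "smooth_on V0 T" "\<And>y. y \<in> V0 \<Longrightarrow> T y \<in> V" "surj (fd T (f0 x))"
      "\<And>y a b. y \<in> V0 \<Longrightarrow> h0 y a b = h (T y) (fd T y a) (fd T y b)"
    and eq: "\<And>y. y \<in> U0 \<Longrightarrow> f (s y) = T (f0 y)"
    and x: "x \<in> U0"
  shows "lsff f g h (s x) (fd s x a) (fd s x b) = fd T (f0 x) (lsff f0 g0 h0 x a b)"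
proof -
  interpret m0: map_on U0 g0 V0 h0 f0 by fact
  interpret m: map_on U g V h f by fact
  note x0 = m0.maps[OF x] and sx = s(2)[OF x]
  have lin: "linear (fd T (f0 x))" "linear (fd f (s x))"
    using linear_fd smooth_on_differentiable[OF T(1) x0] m.df_linear[OF sx] by auto
  have 1: "fd f (s y) (fd s y v) = fd T (f0 y) (fd f0 y v)" if "y \<in> U0" for y v
  proof -
    have "fd (\<lambda>y. f (s y)) y = fd (\<lambda>y. T (f0 y)) y"
      by (rule fd_cong[OF m0.g.open_U that eq])
    then show ?thesis
      using fd_compose[OF smooth_on_differentiable[OF s(1) that] m.f_differentiable[OF s(2)[OF that]]]
        fd_compose[OF m0.f_differentiable[OF that] smooth_on_differentiable[OF T(1) m0.maps[OF that]]]
      by metis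
  qed
  have "fd (\<lambda>y. fd (\<lambda>y. f (s y)) y b) x a = fd (\<lambda>y. fd (\<lambda>y. T (f0 y)) y b) x a"
    by (rule fun_cong[OF fd_cong[OF m0.g.open_U x]], rule fun_cong[OF fd_cong[OF m0.g.open_U]]) (auto simp: eq)
  then have 2: "fd (\<lambda>z. fd f z (fd s x b)) (s x) (fd s x a) + fd f (s x) (fd (\<lambda>y. fd s y b) x a)
    = fd (\<lambda>z. fd T z (fd f0 x b)) (f0 x) (fd f0 x a) + fd T (f0 x) (fd (\<lambda>y. fd f0 y b) x a)"
    using second_derivative_compose[OF m0.g.open_U m.g.open_U s(1) m.smooth_f s(2) x]
      second_derivative_compose[OF m0.g.open_U m0.h.open_U m0.smooth_f T(1) m0.maps x] by simp
  have 3: "fd s x (chr g0 x a b) = fd (\<lambda>y. fd s y b) x a + chr g (s x) (fd s x a) (fd s x b)"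
    by (rule chr_transform[OF m0.g.metric_on_axioms m.g.metric_on_axioms s(1,2,4) x s(3)])
  have 4: "fd T (f0 x) (chr h0 (f0 x) a b) = fd (\<lambda>y. fd T y b) (f0 x) a + chr h (T (f0 x)) (fd T (f0 x) a) (fd T (f0 x) b)" for a b
    by (rule chr_transform[OF m0.h.metric_on_axioms m.h.metric_on_axioms T(1,2,4) x0 T(3)])
  have 5: "fd f (s x) (chr g (s x) (fd s x a) (fd s x b)) = fd T (f0 x) (fd f0 x (chr g0 x a b)) - fd f (s x) (fd (\<lambda>y. fd s y b) x a)"
    using arg_cong[OF 3, of "fd f (s x)"] by (simp add: linear_add[OF lin(2)] 1[OF x])
  show ?thesis
    unfolding lsff_def 5 using 2
    by (simp add: 1[OF x] eq[OF x] 4 linear_add[OF lin(1)] linear_diff[OF lin(1)] algebra_simps)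
qed


section \<open>Riemannian manifolds in charts\<close>

lemma metric_on_subset: "metric_on U g \<Longrightarrow> open V \<Longrightarrow> V \<subseteq> U \<Longrightarrow> metric_on V g"
  unfolding metric_on_def using smooth_on_mono by blast

lemma christoffel_chr: "christoffel M \<phi> = chr (metric_rep M \<phi>)"
  by (intro ext) (simp add: christoffel_def chr_def sharp_def gram_def)

text \<open>\<open>comps\<close> and \<open>of_comps\<close> are derivatives of transition maps, so
  every change of components comes down to the chain rule for these.\<close>

definition ctrans :: "('a, 'm::finite) chart \<Rightarrow> ('a, 'm) chart \<Rightarrow> real^'m \<Rightarrow> real^'m" where
  "ctrans \<phi> \<psi> = cmap \<psi> \<circ> cinv \<phi>"

lemma comps_trans: "comps M \<phi> p = fd (ctrans (chart_at M p) \<phi>) (pt M p)"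
  by (rule ext) (simp add: comps_def ctrans_def)

lemma of_comps_trans: "of_comps M \<phi> p = fd (ctrans \<phi> (chart_at M p)) (cmap \<phi> p)"
  by (rule ext) (simp add: of_comps_def ctrans_def)

locale riemannian =
  fixes M :: "('a::{t2_space, second_countable_topology}, 'm::finite) riem_mfd"
  assumes mfd: "riemannian_manifold M"
begin

lemma chart_at:
  assumes "p \<in> carr M"
  shows "chart_at M p \<in> atlas M" "p \<in> cdom (chart_at M p)"
proof -
  have "\<exists>\<phi>. \<phi> \<in> atlas M \<and> p \<in> cdom \<phi>" using assms by (auto simp: carr_def)
  from someI_ex[OF this] show "chart_at M p \<in> atlas M" "p \<in> cdom (chart_at M p)"
    unfolding chart_at_def by auto
qed

lemma carrI: "\<phi> \<in> atlas M \<Longrightarrow> p \<in> cdom \<phi> \<Longrightarrow> p \<in> carr M"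
  by (auto simp: carr_def)

lemma chart:
  assumes "\<phi> \<in> atlas M"
  shows "open (cdom \<phi>)" "open (cmap \<phi> ` cdom \<phi>)" "continuous_on (cmap \<phi> ` cdom \<phi>) (cinv \<phi>)"
    "continuous_on (cdom \<phi>) (cmap \<phi>)"
    "p \<in> cdom \<phi> \<Longrightarrow> cinv \<phi> (cmap \<phi> p) = p"
  using mfd assms unfolding riemannian_manifold_def is_chart_def homeomorphism_def by auto

lemma open_carr: "open (carr M)"
  unfolding carr_def using chart(1) by blast

lemma open_chart_image:
  assumes "\<phi> \<in> atlas M" "open W"
  shows "open (cmap \<phi> ` (cdom \<phi> \<inter> W))"
proof -
  have "cmap \<phi> ` (cdom \<phi> \<inter> W) = cinv \<phi> -` W \<inter> cmap \<phi> ` cdom \<phi>"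
    using chart(5)[OF assms(1)] by force
  then show ?thesis
    using continuous_on_open_vimage[OF chart(2)[OF assms(1)]] chart(3)[OF assms(1)] assms(2) by metis
qed

section \<open>Transition maps and changes of components\<close>

lemma trans_smooth: "\<phi> \<in> atlas M \<Longrightarrow> \<psi> \<in> atlas M \<Longrightarrow> smooth_on (cmap \<phi> ` (cdom \<phi> \<inter> cdom \<psi>)) (ctrans \<phi> \<psi>)"
  using mfd unfolding riemannian_manifold_def ctrans_def by blast

lemma trans_apply: "\<phi> \<in> atlas M \<Longrightarrow> p \<in> cdom \<phi> \<Longrightarrow> ctrans \<phi> \<psi> (cmap \<phi> p) = cmap \<psi> p"
  by (simp add: ctrans_def chart)

lemma trans_differentiable:
  "\<phi> \<in> atlas M \<Longrightarrow> \<psi> \<in> atlas M \<Longrightarrow> p \<in> cdom \<phi> \<Longrightarrow> p \<in> cdom \<psi> \<Longrightarrow> ctrans \<phi> \<psi> differentiable at (cmap \<phi> p)"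
  by (rule smooth_on_differentiable[OF trans_smooth]) auto

lemma trans_chain:
  assumes "\<phi> \<in> atlas M" "\<psi> \<in> atlas M" "\<xi> \<in> atlas M" "p \<in> cdom \<phi>" "p \<in> cdom \<psi>" "p \<in> cdom \<xi>"
  shows "fd (ctrans \<psi> \<xi>) (cmap \<psi> p) (fd (ctrans \<phi> \<psi>) (cmap \<phi> p) v) = fd (ctrans \<phi> \<xi>) (cmap \<phi> p) v"
proof -
  have "fd (ctrans \<phi> \<xi>) (cmap \<phi> p) = fd (\<lambda>x. ctrans \<psi> \<xi> (ctrans \<phi> \<psi> x)) (cmap \<phi> p)"
    by (rule fd_cong[OF open_chart_image[OF assms(1) chart(1)[OF assms(2)]]])
      (use assms in \<open>auto simp: trans_apply\<close>)
  also have "\<dots> = (\<lambda>u. fd (ctrans \<psi> \<xi>) (ctrans \<phi> \<psi> (cmap \<phi> p)) (fd (ctrans \<phi> \<psi>) (cmap \<phi> p) u))"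
    by (rule fd_compose) (use assms in \<open>auto simp: trans_apply intro: trans_differentiable\<close>)
  finally show ?thesis using assms by (simp add: trans_apply)
qed

lemma trans_same:
  assumes "\<phi> \<in> atlas M" "p \<in> cdom \<phi>"
  shows "fd (ctrans \<phi> \<phi>) (cmap \<phi> p) v = v"
proof -
  have "fd (ctrans \<phi> \<phi>) (cmap \<phi> p) = fd (\<lambda>x. x) (cmap \<phi> p)"
    by (rule fd_cong[OF chart(2)[OF assms(1)]]) (use assms in \<open>auto simp: trans_apply\<close>)
  then show ?thesis by simp
qed

lemma trans_inverse:
  assumes "\<phi> \<in> atlas M" "\<psi> \<in> atlas M" "p \<in> cdom \<phi>" "p \<in> cdom \<psi>"
  shows "fd (ctrans \<psi> \<phi>) (cmap \<psi> p) (fd (ctrans \<phi> \<psi>) (cmap \<phi> p) v) = v"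
  using trans_chain[OF assms(1,2,1,3,4,3)] trans_same[OF assms(1,3)] by simp

lemma trans_surj:
  assumes "\<phi> \<in> atlas M" "\<psi> \<in> atlas M" "p \<in> cdom \<phi>" "p \<in> cdom \<psi>"
  shows "surj (fd (ctrans \<phi> \<psi>) (cmap \<phi> p))"
  using trans_inverse[OF assms(2,1,4,3)] by (metis surjI)

lemma linear_comps: "\<phi> \<in> atlas M \<Longrightarrow> p \<in> cdom \<phi> \<Longrightarrow> linear (comps M \<phi> p)"
  unfolding comps_trans pt_def by (intro linear_fd trans_differentiable chart_at carrI)

lemma linear_of_comps: "\<phi> \<in> atlas M \<Longrightarrow> p \<in> cdom \<phi> \<Longrightarrow> linear (of_comps M \<phi> p)"
  unfolding of_comps_trans by (intro linear_fd trans_differentiable chart_at carrI)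

lemma comps_of_comps [simp]: "\<phi> \<in> atlas M \<Longrightarrow> p \<in> cdom \<phi> \<Longrightarrow> comps M \<phi> p (of_comps M \<phi> p a) = a"
  unfolding comps_trans of_comps_trans pt_def by (intro trans_inverse chart_at carrI)

lemma of_comps_comps [simp]: "\<phi> \<in> atlas M \<Longrightarrow> p \<in> cdom \<phi> \<Longrightarrow> of_comps M \<phi> p (comps M \<phi> p v) = v"
  unfolding comps_trans of_comps_trans pt_def by (intro trans_inverse chart_at carrI)

lemma comps_chart_at [simp]: "p \<in> carr M \<Longrightarrow> comps M (chart_at M p) p v = v"
  unfolding comps_trans pt_def by (intro trans_same chart_at)

lemma of_comps_chart_at [simp]: "p \<in> carr M \<Longrightarrow> of_comps M (chart_at M p) p v = v"
  unfolding of_comps_trans by (intro trans_same chart_at)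

lemma metric_inner: "p \<in> carr M \<Longrightarrow> inner_form (metric M p)"
  using mfd by (simp add: riemannian_manifold_def)

lemma metric_rep_comps:
  "\<phi> \<in> atlas M \<Longrightarrow> p \<in> cdom \<phi> \<Longrightarrow>
    metric_rep M \<phi> (cmap \<phi> p) (comps M \<phi> p u) (comps M \<phi> p v) = metric M p u v"
  by (simp add: metric_rep_def chart)

lemma metric_rep_chart_at: "p \<in> carr M \<Longrightarrow> metric_rep M (chart_at M p) (pt M p) = metric M p"
  by (intro ext) (simp add: metric_rep_def chart chart_at pt_def)

lemma metric_on_chart:
  assumes \<phi>: "\<phi> \<in> atlas M"
  shows "metric_on (cmap \<phi> ` cdom \<phi>) (metric_rep M \<phi>)"
proof
  show "open (cmap \<phi> ` cdom \<phi>)" by (rule chart(2)[OF \<phi>])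
  show "smooth_on (cmap \<phi> ` cdom \<phi>) (\<lambda>x. metric_rep M \<phi> x a b)" for a b
    using mfd \<phi> by (simp add: riemannian_manifold_def)
  fix x assume "x \<in> cmap \<phi> ` cdom \<phi>"
  then obtain p where p: "p \<in> cdom \<phi>" "x = cmap \<phi> p" by blast
  note i = metric_inner[OF carrI[OF \<phi> p(1)]] and l = linear_of_comps[OF \<phi> p(1)]
  have e: "metric_rep M \<phi> x = (\<lambda>a b. metric M p (of_comps M \<phi> p a) (of_comps M \<phi> p b))"
    by (intro ext) (simp add: metric_rep_def p chart[OF \<phi>])
  have nz: "of_comps M \<phi> p v \<noteq> 0" if "v \<noteq> 0" for v
    using comps_of_comps[OF \<phi> p(1), of v] that linear_0[OF linear_comps[OF \<phi> p(1)]] by metis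
  have "bilinear (metric_rep M \<phi> x)"
    unfolding e bilinear_def
    by (auto intro!: linearI simp: linear_add[OF l] linear_cmul[OF l] inner_form_simps[OF i])
  then show "inner_form (metric_rep M \<phi> x)"
    using i nz unfolding inner_form_def e by auto
qed

lemma metric_rep_trans:
  assumes "\<phi> \<in> atlas M" "\<psi> \<in> atlas M" "y \<in> cmap \<phi> ` (cdom \<phi> \<inter> cdom \<psi>)"
  shows "metric_rep M \<phi> y a b = metric_rep M \<psi> (ctrans \<phi> \<psi> y) (fd (ctrans \<phi> \<psi>) y a) (fd (ctrans \<phi> \<psi>) y b)"
proof -
  obtain p where p: "p \<in> cdom \<phi>" "p \<in> cdom \<psi>" "y = cmap \<phi> p" using assms(3) by blast
  have "of_comps M \<psi> p (fd (ctrans \<phi> \<psi>) y a) = of_comps M \<phi> p a" for a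
    unfolding of_comps_trans p(3) by (intro trans_chain assms p chart_at carrI[OF assms(1)])
  then show ?thesis
    by (simp add: metric_rep_def p trans_apply assms chart)
qed

section \<open>Fields with constant components, their covariant derivatives, and curvature\<close>

lemma vf_rep_ext:
  assumes "p \<in> carr M" "y \<in> cmap (chart_at M p) ` cdom (chart_at M p)"
  shows "vf_rep M (chart_at M p) (ext M p v) y = v"
proof -
  note c = chart_at[OF assms(1)]
  obtain q where "q \<in> cdom (chart_at M p)" "y = cmap (chart_at M p) q" using assms(2) by blast
  then show ?thesis using c by (simp add: vf_rep_def ext_def chart)
qed

lemma pt_in: "p \<in> carr M \<Longrightarrow> pt M p \<in> cmap (chart_at M p) ` cdom (chart_at M p)"
  by (simp add: pt_def chart_at)

lemma cinv_pt: "p \<in> carr M \<Longrightarrow> cinv (chart_at M p) (pt M p) = p"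
  by (simp add: pt_def chart_at chart)

lemma ext_self [simp]: "p \<in> carr M \<Longrightarrow> ext M p v p = v"
  by (simp add: ext_def)

lemma fd_vf_rep_ext: "p \<in> carr M \<Longrightarrow> fd (vf_rep M (chart_at M p) (ext M p v)) (pt M p) u = 0"
  using fd_cong[OF chart(2)[OF chart_at(1)] pt_in, of p "vf_rep M (chart_at M p) (ext M p v)" "\<lambda>_. v"]
  by (simp add: vf_rep_ext)

lemma cov_ext: "p \<in> carr M \<Longrightarrow> cov M u (ext M p v) p = chr (metric_rep M (chart_at M p)) (pt M p) u v"
  by (simp add: cov_def fd_vf_rep_ext christoffel_chr)

text \<open>The Christoffel symbols of the chart at p compute covariant derivatives also at nearby points
  q, although \<open>cov\<close> is defined through the unrelated chart at q.\<close>

lemma vf_rep_cov_ext: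
  assumes P: "P \<in> carr M" and y: "y \<in> cmap (chart_at M P) ` cdom (chart_at M P)"
  shows "vf_rep M (chart_at M P) (\<lambda>q. cov M (ext M P v q) (ext M P w) q) y
    = chr (metric_rep M (chart_at M P)) y v w"
proof -
  let ?\<psi> = "chart_at M P"
  note \<psi> = chart_at(1)[OF P]
  obtain q where q: "q \<in> cdom ?\<psi>" "y = cmap ?\<psi> q" using y by blast
  let ?\<xi> = "chart_at M q"
  note qc = carrI[OF \<psi> q(1)]
  note \<xi> = chart_at[OF qc]
  let ?T = "ctrans ?\<psi> ?\<xi>" and ?T' = "ctrans ?\<xi> ?\<psi>"
  let ?N = "cmap ?\<psi> ` (cdom ?\<psi> \<inter> cdom ?\<xi>)" and ?N' = "cmap ?\<xi> ` (cdom ?\<xi> \<inter> cdom ?\<psi>)"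
  have oN: "open ?N" "open ?N'" using open_chart_image chart(1) \<psi> \<xi> by auto
  have yN: "y \<in> ?N" and yN': "?T y \<in> ?N'"
    using q \<xi> \<psi> by (auto simp: trans_apply)
  have T'T: "?T' (?T z) = z" "?T z \<in> ?N'" if "z \<in> ?N" for z
    using that \<psi> \<xi> by (auto simp: trans_apply)
  \<comment> \<open>In the chart at q, the field with constant components w at P has the components
    \<open>fd ?T _ w\<close>, the base point being pulled back by the inverse transition.\<close>
  have rep: "vf_rep M ?\<xi> (ext M P w) z = fd ?T (?T' z) w" if z: "z \<in> ?N'" for z
  proof -
    obtain q' where q': "q' \<in> cdom ?\<xi>" "q' \<in> cdom ?\<psi>" "z = cmap ?\<xi> q'"
      using z by auto
    note c' = chart_at[OF carrI[OF \<psi> q'(2)]]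
    show ?thesis
      unfolding vf_rep_def ext_def q'(3) chart(5)[OF \<xi>(1) q'(1)] comps_trans of_comps_trans pt_def
        trans_apply[OF \<xi>(1) q'(1)]
      by (rule trans_chain[OF \<psi> c'(1) \<xi>(1) q'(2) c'(2) q'(1)])
  qed
  have dT: "(\<lambda>y. fd ?T y w) differentiable at y"
    by (rule smooth_on_differentiable[OF smooth_on_fd[OF trans_smooth[OF \<psi> \<xi>(1)]] yN])
  have dT': "?T' differentiable at (?T y)"
    by (rule smooth_on_differentiable[OF trans_smooth[OF \<xi>(1) \<psi>] yN'])
  have "(\<lambda>z. fd ?T (?T' z) w) differentiable at (?T y)"
    by (rule differentiable_compose[of "\<lambda>y. fd ?T y w", OF _ dT']) (simp add: T'T[OF yN] dT)
  then have drep: "vf_rep M ?\<xi> (ext M P w) differentiable at (?T y)"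
    by (rule differentiable_cong_open[OF oN(2) yN', rotated]) (simp add: rep)
  have D: "fd (vf_rep M ?\<xi> (ext M P w)) (?T y) (fd ?T y v) = fd (\<lambda>y. fd ?T y w) y v"
  proof -
    have "fd (\<lambda>z. vf_rep M ?\<xi> (ext M P w) (?T z)) y = fd (\<lambda>z. fd ?T z w) y"
      by (rule fd_cong[OF oN(1) yN]) (simp add: rep T'T)
    then show ?thesis
      using fd_compose[OF smooth_on_differentiable[OF trans_smooth[OF \<psi> \<xi>(1)] yN] drep] by metis
  qed
  have pt: "pt M q = ?T y" by (simp add: pt_def q trans_apply \<psi>)
  have ex: "ext M P u q = fd ?T y u" for u
    by (simp add: ext_def of_comps_trans q)
  have "cov M (ext M P v q) (ext M P w) q
     = fd (\<lambda>y. fd ?T y w) y v + chr (metric_rep M ?\<xi>) (?T y) (fd ?T y v) (fd ?T y w)"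
    by (simp add: cov_def christoffel_chr pt ex D)
  \<comment> \<open>The second derivative of the transition map is precisely the correction between
    the Christoffel symbols of the two charts.\<close>
  also have "\<dots> = fd ?T y (chr (metric_rep M ?\<psi>) y v w)"
  proof (rule chr_transform[symmetric, OF _ metric_on_chart[OF \<xi>(1)] trans_smooth[OF \<psi> \<xi>(1)] _ _ yN])
    show "metric_on ?N (metric_rep M ?\<psi>)"
      by (rule metric_on_subset[OF metric_on_chart[OF \<psi>] oN(1)]) auto
    show "surj (fd ?T y)" unfolding q(2) by (rule trans_surj[OF \<psi> \<xi>(1) q(1) \<xi>(2)])
    show "?T z \<in> cmap ?\<xi> ` cdom ?\<xi>" if "z \<in> ?N" for z using T'T(2)[OF that] by auto
  qed (rule metric_rep_trans[OF \<psi> \<xi>(1)])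
  finally show ?thesis
    unfolding vf_rep_def q(2) chart(5)[OF \<psi> q(1)] comps_trans pt_def
    using trans_inverse[OF \<psi> \<xi>(1) q(1) \<xi>(2)] by simp
qed

text \<open>The extensions have constant components in the chart at P, so their bracket vanishes,
  and \<open>vf_rep_cov_ext\<close> lets the inner covariant derivative be differentiated as a
  Christoffel symbol of that one chart.\<close>

lemma curv_at_eq:
  assumes P: "P \<in> carr M"
  defines "G \<equiv> chr (metric_rep M (chart_at M P))" and "x \<equiv> pt M P"
  shows "curv_at M P u v w = (fd (\<lambda>y. G y v w) x u + G x u (G x v w)) - (fd (\<lambda>y. G y u w) x v + G x v (G x u w))"
proof -
  interpret m: metric_on "cmap (chart_at M P) ` cdom (chart_at M P)" "metric_rep M (chart_at M P)"
    by (rule metric_on_chart[OF chart_at(1)[OF P]])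
  have *: "cov M u (\<lambda>q. cov M (ext M P v q) (ext M P w) q) P = fd (\<lambda>y. G y v w) x u + G x u (G x v w)" for u v
  proof -
    have "fd (vf_rep M (chart_at M P) (\<lambda>q. cov M (ext M P v q) (ext M P w) q)) x = fd (\<lambda>y. G y v w) x"
      unfolding x_def G_def by (rule fd_cong[OF m.open_U pt_in[OF P] vf_rep_cov_ext[OF P]])
    then show ?thesis
      by (simp add: cov_def[of _ u] christoffel_chr P cov_ext G_def x_def)
  qed
  have "lie_bracket M (ext M P u) (ext M P v) P = 0"
    by (simp add: lie_bracket_def fd_vf_rep_ext P)
  moreover have "G x 0 w = 0"
    unfolding G_def x_def by (rule bilinear_lzero[OF m.chr_bilinear[OF pt_in[OF P]]])
  ultimately show ?thesis
    by (simp add: curv_at_def curv_def * P cov_ext G_def[symmetric] x_def[symmetric])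
qed

lemma curv_at_skew:
  assumes P: "P \<in> carr M"
  shows "metric M P (curv_at M P u v w) z = - metric M P (curv_at M P u v z) w"
  using metric_on.curvature_skew[OF metric_on_chart[OF chart_at(1)[OF P]] pt_in[OF P],
      where u=u and v=v and w=w and z=z]
  by (simp add: curv_at_eq[OF P] metric_rep_chart_at[OF P])

text \<open>Sectional curvature says nothing about the zero vector, while vertical vectors have zero
  image; \<open>curv_sectional\<close> treats that case by this fact.\<close>

lemma curv_at_zero:
  assumes P: "P \<in> carr M"
  shows "curv_at M P 0 v w = 0"
proof -
  interpret m: metric_on "cmap (chart_at M P) ` cdom (chart_at M P)" "metric_rep M (chart_at M P)"
    by (rule metric_on_chart[OF chart_at(1)[OF P]])
  note x = pt_in[OF P]
  have "fd (\<lambda>y. chr (metric_rep M (chart_at M P)) y 0 w) (pt M P) = fd (\<lambda>_. 0) (pt M P)"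
    by (rule fd_cong[OF m.open_U x]) (rule bilinear_lzero[OF m.chr_bilinear])
  then show ?thesis
    using linear_0[OF linear_fd[OF m.chr_differentiable[OF x]]]
    by (simp add: curv_at_eq[OF P] bilinear_lzero[OF m.chr_bilinear[OF x]] bilinear_rzero[OF m.chr_bilinear[OF x]])
qed

end


section \<open>Smooth maps in charts\<close>

definition frep :: "('a \<Rightarrow> 'b) \<Rightarrow> ('a, 'm::finite) chart \<Rightarrow> ('b, 'n::finite) chart \<Rightarrow> real^'m \<Rightarrow> real^'n" where
  "frep F \<phi> \<psi> = cmap \<psi> \<circ> F \<circ> cinv \<phi>"

lemma push_frep: "push M1 M2 F p = fd (frep F (chart_at M1 p) (chart_at M2 (F p))) (pt M1 p)"
  by (rule ext) (simp add: push_def frep_def)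

locale smooth_between = M1: riemannian M1 + M2: riemannian M2
  for M1 :: "('a::{t2_space, second_countable_topology}, 'm::finite) riem_mfd"
    and M2 :: "('b::{t2_space, second_countable_topology}, 'n::finite) riem_mfd" +
  fixes F :: "'a \<Rightarrow> 'b"
  assumes smooth_F: "smooth_map M1 M2 F"
begin

abbreviation frep_dom where "frep_dom \<phi> \<psi> \<equiv> cmap \<phi> ` (cdom \<phi> \<inter> F -` cdom \<psi>)"

lemma F_carr: "p \<in> carr M1 \<Longrightarrow> F p \<in> carr M2"
  using smooth_F by (auto simp: smooth_map_def)

lemma open_frep_dom:
  assumes "\<phi> \<in> atlas M1" "\<psi> \<in> atlas M2" "open W"
  shows "open (cmap \<phi> ` (cdom \<phi> \<inter> F -` cdom \<psi> \<inter> W))"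
proof -
  have "open (F -` cdom \<psi> \<inter> carr M1)"
    using smooth_F M2.chart(1)[OF assms(2)] continuous_on_open_vimage[OF M1.open_carr]
    by (auto simp: smooth_map_def)
  then have "open (F -` cdom \<psi> \<inter> carr M1 \<inter> W)" using assms(3) by blast
  from M1.open_chart_image[OF assms(1) this] show ?thesis
    using M1.carrI[OF assms(1)] by (metis (no_types, lifting) Int_assoc Int_commute inf.orderE subsetI)
qed

lemma frep_smooth: "\<phi> \<in> atlas M1 \<Longrightarrow> \<psi> \<in> atlas M2 \<Longrightarrow> smooth_on (frep_dom \<phi> \<psi>) (frep F \<phi> \<psi>)"
  using smooth_F by (auto simp: smooth_map_def frep_def)

lemma frep_apply: "\<phi> \<in> atlas M1 \<Longrightarrow> p \<in> cdom \<phi> \<Longrightarrow> frep F \<phi> \<psi> (cmap \<phi> p) = cmap \<psi> (F p)"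
  by (simp add: frep_def M1.chart)

lemma frep_differentiable:
  "\<phi> \<in> atlas M1 \<Longrightarrow> \<psi> \<in> atlas M2 \<Longrightarrow> p \<in> cdom \<phi> \<Longrightarrow> F p \<in> cdom \<psi> \<Longrightarrow> frep F \<phi> \<psi> differentiable at (cmap \<phi> p)"
  by (rule smooth_on_differentiable[OF frep_smooth]) auto

lemma map_on_charts:
  assumes "\<phi> \<in> atlas M1" "\<psi> \<in> atlas M2"
  shows "map_on (frep_dom \<phi> \<psi>) (metric_rep M1 \<phi>) (cmap \<psi> ` cdom \<psi>) (metric_rep M2 \<psi>) (frep F \<phi> \<psi>)"
  unfolding map_on_def map_on_axioms_def
  using metric_on_subset[OF M1.metric_on_chart[OF assms(1)]] open_frep_dom[OF assms open_UNIV]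
    M2.metric_on_chart[OF assms(2)] frep_smooth[OF assms]
  by (auto simp: frep_apply assms)

lemma frep_chain:
  assumes "\<phi> \<in> atlas M1" "\<phi>' \<in> atlas M1" "\<psi> \<in> atlas M2" "\<psi>' \<in> atlas M2"
    and "p \<in> cdom \<phi>" "p \<in> cdom \<phi>'" "F p \<in> cdom \<psi>" "F p \<in> cdom \<psi>'"
  shows "fd (ctrans \<psi>' \<psi>) (cmap \<psi>' (F p)) (fd (frep F \<phi>' \<psi>') (cmap \<phi>' p) v)
    = fd (frep F \<phi> \<psi>) (cmap \<phi> p) (fd (ctrans \<phi>' \<phi>) (cmap \<phi>' p) v)"
proof -
  let ?N = "cmap \<phi>' ` (cdom \<phi>' \<inter> F -` cdom \<psi>' \<inter> cdom \<phi>)"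
  have "fd (\<lambda>y. ctrans \<psi>' \<psi> (frep F \<phi>' \<psi>' y)) (cmap \<phi>' p) = fd (\<lambda>y. frep F \<phi> \<psi> (ctrans \<phi>' \<phi> y)) (cmap \<phi>' p)"
    by (rule fd_cong[of ?N])
      (use open_frep_dom[OF assms(2,4) M1.chart(1)[OF assms(1)]] assms
        in \<open>auto simp: frep_apply M1.trans_apply M2.trans_apply\<close>)
  moreover have "fd (\<lambda>y. ctrans \<psi>' \<psi> (frep F \<phi>' \<psi>' y)) (cmap \<phi>' p)
      = (\<lambda>u. fd (ctrans \<psi>' \<psi>) (frep F \<phi>' \<psi>' (cmap \<phi>' p)) (fd (frep F \<phi>' \<psi>') (cmap \<phi>' p) u))"
    by (rule fd_compose)
      (use assms in \<open>auto simp: frep_apply intro: frep_differentiable M2.trans_differentiable\<close>)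
  moreover have "fd (\<lambda>y. frep F \<phi> \<psi> (ctrans \<phi>' \<phi> y)) (cmap \<phi>' p)
      = (\<lambda>u. fd (frep F \<phi> \<psi>) (ctrans \<phi>' \<phi> (cmap \<phi>' p)) (fd (ctrans \<phi>' \<phi>) (cmap \<phi>' p) u))"
    by (rule fd_compose)
      (use assms in \<open>auto simp: M1.trans_apply intro: frep_differentiable M1.trans_differentiable\<close>)
  ultimately show ?thesis
    using assms by (metis frep_apply M1.trans_apply)
qed

lemma push_comps:
  assumes "\<phi> \<in> atlas M1" "\<psi> \<in> atlas M2" "q \<in> cdom \<phi>" "F q \<in> cdom \<psi>"
  shows "comps M2 \<psi> (F q) (push M1 M2 F q v) = fd (frep F \<phi> \<psi>) (cmap \<phi> q) (comps M1 \<phi> q v)"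
proof -
  note q = M1.carrI[OF assms(1,3)]
  show ?thesis
    unfolding comps_trans push_frep pt_def
    by (rule frep_chain[OF assms(1) M1.chart_at(1)[OF q] assms(2) M2.chart_at(1)[OF F_carr[OF q]]
          assms(3) M1.chart_at(2)[OF q] assms(4) M2.chart_at(2)[OF F_carr[OF q]]])
qed

lemma pt_frep_dom: "p \<in> carr M1 \<Longrightarrow> pt M1 p \<in> frep_dom (chart_at M1 p) (chart_at M2 (F p))"
  by (simp add: pt_def M1.chart_at M2.chart_at F_carr)

lemma frep_pt: "p \<in> carr M1 \<Longrightarrow> frep F (chart_at M1 p) (chart_at M2 (F p)) (pt M1 p) = pt M2 (F p)"
  by (simp add: pt_def M1.chart_at frep_apply)

section \<open>Pullback derivative, second fundamental form and tension field in charts\<close>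

lemma cov_pb_eq:
  assumes "p \<in> carr M1"
  shows "cov_pb M1 M2 F v V p =
     fd (sec_rep M2 F (chart_at M1 p) (chart_at M2 (F p)) V) (pt M1 p) v
     + chr (metric_rep M2 (chart_at M2 (F p))) (frep F (chart_at M1 p) (chart_at M2 (F p)) (pt M1 p))
         (push M1 M2 F p v) (V p)"
  by (simp add: cov_pb_def christoffel_chr frep_pt assms)

lemma sec_rep_apply:
  "\<phi> \<in> atlas M1 \<Longrightarrow> q \<in> cdom \<phi> \<Longrightarrow> sec_rep M2 F \<phi> \<psi> V (cmap \<phi> q) = comps M2 \<psi> (F q) (V q)"
  by (simp add: sec_rep_def M1.chart)

lemma sec_rep_pt: "p \<in> carr M1 \<Longrightarrow> sec_rep M2 F (chart_at M1 p) (chart_at M2 (F p)) V (pt M1 p) = V p"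
  by (simp add: sec_rep_def M1.cinv_pt F_carr)

lemma sec_rep_push_ext:
  assumes p: "p \<in> carr M1" and y: "y \<in> frep_dom (chart_at M1 p) (chart_at M2 (F p))"
  shows "sec_rep M2 F (chart_at M1 p) (chart_at M2 (F p)) (\<lambda>q. push M1 M2 F q (ext M1 p v q)) y
    = fd (frep F (chart_at M1 p) (chart_at M2 (F p))) y v"
proof -
  note \<phi> = M1.chart_at(1)[OF p] and \<psi> = M2.chart_at(1)[OF F_carr[OF p]]
  obtain q where q: "q \<in> cdom (chart_at M1 p)" "F q \<in> cdom (chart_at M2 (F p))" "y = cmap (chart_at M1 p) q"
    using y by blast
  show ?thesis
    by (simp add: q(3) sec_rep_apply[OF \<phi> q(1)] push_comps[OF \<phi> \<psi> q(1,2)] ext_def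
        M1.comps_of_comps[OF \<phi> q(1)])
qed

lemma sff_at_eq:
  assumes p: "p \<in> carr M1"
  shows "sff_at M1 M2 F p u v = lsff (frep F (chart_at M1 p) (chart_at M2 (F p)))
     (metric_rep M1 (chart_at M1 p)) (metric_rep M2 (chart_at M2 (F p))) (pt M1 p) u v"
proof -
  note \<phi> = M1.chart_at(1)[OF p] and \<psi> = M2.chart_at(1)[OF F_carr[OF p]]
  have "fd (sec_rep M2 F (chart_at M1 p) (chart_at M2 (F p)) (\<lambda>q. push M1 M2 F q (ext M1 p v q))) (pt M1 p)
     = fd (\<lambda>y. fd (frep F (chart_at M1 p) (chart_at M2 (F p))) y v) (pt M1 p)"
    by (rule fd_cong[OF _ pt_frep_dom[OF p] sec_rep_push_ext[OF p]])
      (use open_frep_dom[OF \<phi> \<psi> open_UNIV] in simp_all)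
  then show ?thesis
    by (simp add: sff_at_def sff_def cov_pb_eq[OF p] lsff_def M1.cov_ext p push_frep)
qed

text \<open>\<open>sff_at\<close> at q is computed in the charts at q; \<open>lsff_transform\<close>
  moves it to any other pair. Keeping that pair fixed while q moves expresses all values by one
  local formula.\<close>

lemma sff_at_comps:
  assumes \<phi>: "\<phi> \<in> atlas M1" and \<psi>: "\<psi> \<in> atlas M2" and q: "q \<in> cdom \<phi>" "F q \<in> cdom \<psi>"
  shows "comps M2 \<psi> (F q) (sff_at M1 M2 F q u v) =
    lsff (frep F \<phi> \<psi>) (metric_rep M1 \<phi>) (metric_rep M2 \<psi>) (cmap \<phi> q) (comps M1 \<phi> q u) (comps M1 \<phi> q v)"
proof -
  let ?\<phi>' = "chart_at M1 q" and ?\<psi>' = "chart_at M2 (F q)"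
  note qc = M1.carrI[OF \<phi> q(1)]
  note \<phi>' = M1.chart_at[OF qc] and \<psi>' = M2.chart_at[OF F_carr[OF qc]]
  \<comment> \<open>Neighbourhoods on which all four charts are defined: \<open>?U\<close> lies over
    both source charts and F sends it into both target charts. Continuity of F is given on the
    carrier, hence the intersection with \<open>carr M1\<close>.\<close>
  let ?U = "cmap ?\<phi>' ` (cdom ?\<phi>' \<inter> F -` cdom ?\<psi>' \<inter> (cdom \<phi> \<inter> (F -` cdom \<psi> \<inter> carr M1)))"
  let ?V = "cmap ?\<psi>' ` (cdom ?\<psi>' \<inter> cdom \<psi>)"
  have W: "open (F -` cdom \<psi> \<inter> carr M1)"
    using smooth_F M2.chart(1)[OF \<psi>] continuous_on_open_vimage[OF M1.open_carr]
    by (auto simp: smooth_map_def)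
  have oU: "open ?U"
    by (rule open_frep_dom[OF \<phi>'(1) \<psi>'(1)]) (use W M1.chart(1)[OF \<phi>] in blast)
  have oV: "open ?V" by (rule M2.open_chart_image[OF \<psi>'(1) M2.chart(1)[OF \<psi>]])
  have qU: "pt M1 q \<in> ?U" using q qc \<phi>' \<psi>' by (auto simp: pt_def)
  have s: "ctrans ?\<phi>' \<phi> (pt M1 q) = cmap \<phi> q" by (simp add: pt_def M1.trans_apply \<phi>')
  have m: "map_on ?U (metric_rep M1 ?\<phi>') ?V (metric_rep M2 ?\<psi>') (frep F ?\<phi>' ?\<psi>')"
    unfolding map_on_def map_on_axioms_def
    using metric_on_subset[OF M1.metric_on_chart[OF \<phi>'(1)] oU] metric_on_subset[OF M2.metric_on_chart[OF \<psi>'(1)] oV]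
      smooth_on_mono[OF frep_smooth[OF \<phi>'(1) \<psi>'(1)], of ?U]
    by (auto simp: frep_apply \<phi>')
  have "lsff (frep F \<phi> \<psi>) (metric_rep M1 \<phi>) (metric_rep M2 \<psi>) (ctrans ?\<phi>' \<phi> (pt M1 q))
      (fd (ctrans ?\<phi>' \<phi>) (pt M1 q) u) (fd (ctrans ?\<phi>' \<phi>) (pt M1 q) v)
    = fd (ctrans ?\<psi>' \<psi>) (frep F ?\<phi>' ?\<psi>' (pt M1 q))
        (lsff (frep F ?\<phi>' ?\<psi>') (metric_rep M1 ?\<phi>') (metric_rep M2 ?\<psi>') (pt M1 q) u v)"
  proof (rule lsff_transform[OF m map_on_charts[OF \<phi> \<psi>] _ _ _ _ _ _ _ _ _ qU])
    show "smooth_on ?U (ctrans ?\<phi>' \<phi>)"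
      by (rule smooth_on_mono[OF M1.trans_smooth[OF \<phi>'(1) \<phi>]]) auto
    show "smooth_on ?V (ctrans ?\<psi>' \<psi>)" by (rule M2.trans_smooth[OF \<psi>'(1) \<psi>])
    show "surj (fd (ctrans ?\<phi>' \<phi>) (pt M1 q))"
      unfolding pt_def by (rule M1.trans_surj[OF \<phi>'(1) \<phi> \<phi>'(2) q(1)])
    show "surj (fd (ctrans ?\<psi>' \<psi>) (frep F ?\<phi>' ?\<psi>' (pt M1 q)))"
      unfolding pt_def frep_apply[OF \<phi>'] by (rule M2.trans_surj[OF \<psi>'(1) \<psi> \<psi>'(2) q(2)])
    show "metric_rep M1 ?\<phi>' y a b = metric_rep M1 \<phi> (ctrans ?\<phi>' \<phi> y) (fd (ctrans ?\<phi>' \<phi>) y a) (fd (ctrans ?\<phi>' \<phi>) y b)"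
      if "y \<in> ?U" for y a b
      by (rule M1.metric_rep_trans[OF \<phi>'(1) \<phi>]) (use that in blast)
    show "metric_rep M2 ?\<psi>' y a b = metric_rep M2 \<psi> (ctrans ?\<psi>' \<psi> y) (fd (ctrans ?\<psi>' \<psi>) y a) (fd (ctrans ?\<psi>' \<psi>) y b)"
      if "y \<in> ?V" for y a b
      by (rule M2.metric_rep_trans[OF \<psi>'(1) \<psi> that])
  qed (auto simp: frep_apply M1.trans_apply M2.trans_apply \<phi> \<phi>' \<psi> \<psi>')
  then show ?thesis
    by (simp add: comps_trans sff_at_eq[OF qc] frep_pt[OF qc] s)
qed

text \<open>The basis picked at q varies erratically with q. Its image in the chart is orthonormal
  for the local metric, so \<open>onb_trace_dual\<close> turns the trace into a contraction with the
  inverse metric, whose dependence on q is explicit.\<close>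

lemma tension_comps:
  assumes \<phi>: "\<phi> \<in> atlas M1" and \<psi>: "\<psi> \<in> atlas M2" and q: "q \<in> cdom \<phi>" "F q \<in> cdom \<psi>"
  shows "comps M2 \<psi> (F q) (tension M1 M2 F q) =
    (\<Sum>b\<in>Basis. lsff (frep F \<phi> \<psi>) (metric_rep M1 \<phi>) (metric_rep M2 \<psi>) (cmap \<phi> q) b
       (sharp (metric_rep M1 \<phi> (cmap \<phi> q)) (\<lambda>v. v \<bullet> b)))"
proof -
  note qc = M1.carrI[OF \<phi> q(1)]
  let ?x = "cmap \<phi> q"
  interpret m: map_on "frep_dom \<phi> \<psi>" "metric_rep M1 \<phi>" "cmap \<psi> ` cdom \<psi>" "metric_rep M2 \<psi>" "frep F \<phi> \<psi>"
    by (rule map_on_charts[OF \<phi> \<psi>])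
  have x: "?x \<in> frep_dom \<phi> \<psi>" using q by auto
  define E where "E = (SOME E. is_onb (metric M1 q) UNIV E)"
  have E: "is_onb (metric M1 q) UNIV E"
    unfolding E_def by (rule someI_ex[OF onb_exists[OF M1.metric_inner[OF qc] subspace_UNIV]])
  have lc: "linear (comps M1 \<phi> q)" and inj: "inj (comps M1 \<phi> q)" and surj: "surj (comps M1 \<phi> q)"
    using M1.linear_comps[OF \<phi> q(1)] M1.of_comps_comps[OF \<phi> q(1)] M1.comps_of_comps[OF \<phi> q(1)]
    by (metis injI, metis injI, metis surjI)
  have onb: "is_onb (metric_rep M1 \<phi> ?x) UNIV (comps M1 \<phi> q ` E)"
    using E surj unfolding is_onb_def
    by (auto simp: M1.metric_rep_comps[OF \<phi> q(1)] inj_eq[OF inj] linear_span_image[OF lc])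
  have "comps M2 \<psi> (F q) (tension M1 M2 F q) = (\<Sum>e\<in>E. comps M2 \<psi> (F q) (sff_at M1 M2 F q e e))"
    by (simp add: tension_def trace_on_def E_def[symmetric] linear_sum[OF M2.linear_comps[OF \<psi> q(2)]])
  also have "\<dots> = (\<Sum>e\<in>comps M1 \<phi> q ` E. m.S ?x e e)"
    by (subst sum.reindex) (auto simp: inj_on_def inj_eq[OF inj] sff_at_comps[OF \<phi> \<psi> q])
  also have "\<dots> = (\<Sum>b\<in>Basis. m.S ?x b (sharp (metric_rep M1 \<phi> ?x) (\<lambda>v. v \<bullet> b)))"
    by (rule onb_trace_dual[OF m.g.inner[OF x] onb m.S_bilinear[OF x]])
      (rule sharp[OF m.g.inner[OF x]], simp add: linear_iff inner_add_left)
  finally show ?thesis .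
qed

lemma tension_differentiable:
  assumes \<phi>: "\<phi> \<in> atlas M1" and \<psi>: "\<psi> \<in> atlas M2" and q: "q \<in> cdom \<phi>" "F q \<in> cdom \<psi>"
  shows "sec_rep M2 F \<phi> \<psi> (tension M1 M2 F) differentiable at (cmap \<phi> q)"
proof -
  interpret m: map_on "frep_dom \<phi> \<psi>" "metric_rep M1 \<phi>" "cmap \<psi> ` cdom \<psi>" "metric_rep M2 \<psi>" "frep F \<phi> \<psi>"
    by (rule map_on_charts[OF \<phi> \<psi>])
  have x: "cmap \<phi> q \<in> frep_dom \<phi> \<psi>" using q by auto
  have "(\<lambda>y. m.S y b (sharp (metric_rep M1 \<phi> y) (\<lambda>v. v \<bullet> b))) differentiable at (cmap \<phi> q)" for b
  proof -
    have "(\<lambda>y. sharp (metric_rep M1 \<phi> y) (\<lambda>v. v \<bullet> b)) differentiable at (cmap \<phi> q)"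
      unfolding sharp_def
      by (rule differentiable_matrix_inv[OF m.g.open_U x invertible_gram[OF m.g.inner]])
        (auto simp: gram_def m.g.g_differentiable[OF x])
    then show ?thesis
      using m.S_bilinear
      by (intro differentiableI[OF has_derivative_param_linear[OF m.g.open_U x _ m.S_differentiable[OF x]
          has_derivative_ident]]) (auto simp: bilinear_def frechet_derivative_works)
  qed
  then have "(\<lambda>y. \<Sum>b\<in>Basis. m.S y b (sharp (metric_rep M1 \<phi> y) (\<lambda>v. v \<bullet> b))) differentiable at (cmap \<phi> q)"
    by (intro differentiable_sum) auto
  then show ?thesis
    by (rule differentiable_cong_open[OF m.g.open_U x, rotated])
      (auto simp: sec_rep_apply[OF \<phi>] tension_comps[OF \<phi> \<psi>])
qed

lemma riem_charts:
  assumes r: "riemannian_map M1 M2 F" and \<phi>: "\<phi> \<in> atlas M1" and \<psi>: "\<psi> \<in> atlas M2"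
  shows "map_on.riem (frep_dom \<phi> \<psi>) (metric_rep M1 \<phi>) (metric_rep M2 \<psi>) (frep F \<phi> \<psi>)"
proof -
  interpret m: map_on "frep_dom \<phi> \<psi>" "metric_rep M1 \<phi>" "cmap \<psi> ` cdom \<psi>" "metric_rep M2 \<psi>" "frep F \<phi> \<psi>"
    by (rule map_on_charts[OF \<phi> \<psi>])
  show ?thesis
    unfolding m.riem_def
  proof (intro ballI)
    fix x u v assume x: "x \<in> frep_dom \<phi> \<psi>" and uv: "u \<in> m.hor x" "v \<in> m.hor x"
    obtain q where q: "q \<in> cdom \<phi>" "F q \<in> cdom \<psi>" "x = cmap \<phi> q" using x by blast
    note qc = M1.carrI[OF \<phi> q(1)]
    define u' v' where "u' = of_comps M1 \<phi> q u" and "v' = of_comps M1 \<phi> q v"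
    have uv': "u = comps M1 \<phi> q u'" "v = comps M1 \<phi> q v'"
      using M1.comps_of_comps[OF \<phi> q(1)] by (simp_all add: u'_def v'_def)
    have hor: "w \<in> hor_sp M1 M2 F q" if "comps M1 \<phi> q w \<in> m.hor x" for w
    proof -
      have "metric M1 q w k = 0" if "push M1 M2 F q k = 0" for k
      proof -
        have "fd (frep F \<phi> \<psi>) x (comps M1 \<phi> q k) = 0"
          using push_comps[OF \<phi> \<psi> q(1,2), of k] that linear_0[OF M2.linear_comps[OF \<psi> q(2)]] q(3) by simp
        then show ?thesis
          using \<open>comps M1 \<phi> q w \<in> m.hor x\<close>
          by (simp add: m.hor_def orth_compl_def q(3) M1.metric_rep_comps[OF \<phi> q(1), symmetric])
      qed
      then show ?thesis by (simp add: hor_sp_def ker_sp_def orth_compl_def)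
    qed
    have "m.pull x u v = metric M2 (F q) (push M1 M2 F q u') (push M1 M2 F q v')"
      by (simp add: m.pull_def q(3) frep_apply[OF \<phi> q(1)] uv' push_comps[OF \<phi> \<psi> q(1,2), symmetric]
          M2.metric_rep_comps[OF \<psi> q(2)])
    also have "\<dots> = metric M1 q u' v'"
      using r qc hor uv uv' by (simp add: riemannian_map_def)
    finally show "m.pull x u v = metric_rep M1 \<phi> x u v"
      by (simp add: q(3) uv' M1.metric_rep_comps[OF \<phi> q(1)])
  qed
qed

end


section \<open>Pseudo-umbilical biharmonic Riemannian maps\<close>

locale biharmonic_riem = smooth_between M1 M2 F
  for M1 :: "('a::{t2_space, second_countable_topology}, 'm::finite) riem_mfd"
    and M2 :: "('b::{t2_space, second_countable_topology}, 'n::finite) riem_mfd"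
    and F :: "'a \<Rightarrow> 'b" +
  fixes c :: real and r :: nat and lam :: "'a \<Rightarrow> real"
  assumes sf: "space_form M2 c"
    and rm: "riemannian_map M1 M2 F"
    and rank: "p \<in> carr M1 \<Longrightarrow> dim (range_sp M1 M2 F p) = r" and r: "0 < r"
    and lam: "smooth_fun M1 lam"
    and umb: "p \<in> carr M1 \<Longrightarrow> v \<in> hor_sp M1 M2 F p \<Longrightarrow>
       shape_op M1 M2 F (range_mean_curv M1 M2 F) p v = lam p *\<^sub>R push M1 M2 F p v"
    and bih: "biharmonic M1 M2 F" and minimal: "ker_minimal M1 M2 F"
    and parallel: "parallel_mean_curv M1 M2 F"
begin

abbreviation H where "H \<equiv> range_mean_curv M1 M2 F"
abbreviation sf2 where "sf2 \<equiv> sff_at M1 M2 F"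

end

text \<open>The point has a locale of its own so that facts proved at p can be instantiated at every
  nearby q; this is how pointwise identities come to be differentiated.\<close>

locale biharmonic_riem_at = biharmonic_riem M1 M2 F c r lam
  for M1 :: "('a::{t2_space, second_countable_topology}, 'm::finite) riem_mfd"
    and M2 :: "('b::{t2_space, second_countable_topology}, 'n::finite) riem_mfd"
    and F :: "'a \<Rightarrow> 'b" and c r lam +
  fixes p :: 'a
  assumes p: "p \<in> carr M1"
begin

abbreviation "\<phi> \<equiv> chart_at M1 p"
abbreviation "\<psi> \<equiv> chart_at M2 (F p)"
abbreviation "x \<equiv> pt M1 p"
abbreviation "U \<equiv> frep_dom \<phi> \<psi>"
abbreviation "f \<equiv> frep F \<phi> \<psi>"
abbreviation "g1 \<equiv> metric M1 p"
abbreviation "g2 \<equiv> metric M2 (F p)"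
abbreviation "push_p \<equiv> push M1 M2 F p"

lemma Fp: "F p \<in> carr M2" using F_carr[OF p] .

lemmas \<phi> = M1.chart_at[OF p] and \<psi> = M2.chart_at[OF Fp]

sublocale m: map_on U "metric_rep M1 \<phi>" "cmap \<psi> ` cdom \<psi>" "metric_rep M2 \<psi>" f
  by (rule map_on_charts[OF \<phi>(1) \<psi>(1)])

lemma xU: "x \<in> U" by (rule pt_frep_dom[OF p])

lemma g1_x: "metric_rep M1 \<phi> x = g1" by (rule M1.metric_rep_chart_at[OF p])

lemma g2_x: "metric_rep M2 \<psi> (f x) = g2" by (simp add: frep_pt[OF p] M2.metric_rep_chart_at[OF Fp])

lemma g1: "inner_form g1" and g2: "inner_form g2"
  using M1.metric_inner[OF p] M2.metric_inner[OF Fp] .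

lemma push_p: "push_p = fd f x" by (rule push_frep)

lemma linear_push: "linear push_p"
  unfolding push_p by (rule m.df_linear[OF xU])

lemma sf2_x: "sf2 p = m.S x"
  by (intro ext) (rule sff_at_eq[OF p])

lemma sf2_bilinear: "bilinear (sf2 p)" unfolding sf2_x by (rule m.S_bilinear[OF xU])

lemma sf2_sym: "sf2 p u v = sf2 p v u" unfolding sf2_x by (rule m.S_sym[OF xU])

lemma hor_x: "hor_sp M1 M2 F p = m.hor x"
  by (simp add: hor_sp_def m.hor_def ker_sp_def g1_x push_p)

lemma ker_subspace: "subspace (ker_sp M1 M2 F p)"
  unfolding ker_sp_def push_p by (rule m.ker_subspace[OF xU])

lemma range_subspace: "subspace (range_sp M1 M2 F p)"
  unfolding range_sp_def by (rule linear_subspace_image[OF linear_push subspace_UNIV])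

lemma push_proj_hor: "push_p (orth_proj g1 (hor_sp M1 M2 F p) v) = push_p v"
proof -
  have "push_p (orth_proj g1 (ker_sp M1 M2 F p) v) = 0"
    using orth_proj(1)[OF g1 ker_subspace] by (simp add: ker_sp_def)
  then show ?thesis
    by (simp add: hor_sp_def orth_proj_compl[OF g1 ker_subspace] linear_diff[OF linear_push])
qed

lemma push_hor: "\<exists>w \<in> hor_sp M1 M2 F p. push_p w = push_p v"
  using push_proj_hor orth_proj(1)[OF g1 orth_compl_subspace[OF g1]] unfolding hor_sp_def by blast

lemma dim_hor: "dim (hor_sp M1 M2 F p) = r"
proof -
  have "inj_on push_p (hor_sp M1 M2 F p)"
  proof (rule inj_onI)
    fix u v assume uv: "u \<in> hor_sp M1 M2 F p" "v \<in> hor_sp M1 M2 F p" "push_p u = push_p v"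
    have "u - v \<in> ker_sp M1 M2 F p" by (simp add: ker_sp_def linear_diff[OF linear_push] uv(3))
    moreover have "u - v \<in> hor_sp M1 M2 F p"
      using uv subspace_diff[OF orth_compl_subspace[OF g1]] unfolding hor_sp_def by blast
    ultimately have "u - v = 0" unfolding hor_sp_def using orth_compl_Int[OF g1] by blast
    then show "u = v" by simp
  qed
  moreover have "span (hor_sp M1 M2 F p) = hor_sp M1 M2 F p"
    unfolding hor_sp_def by (rule span_eq_iff[THEN iffD2, OF orth_compl_subspace[OF g1]])
  ultimately have "dim (push_p ` hor_sp M1 M2 F p) = dim (hor_sp M1 M2 F p)"
    using dim_image_eq[OF linear_push, of "hor_sp M1 M2 F p"] by metis
  then show ?thesis using rm rank[OF p] p by (simp add: riemannian_map_def)
qed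

text \<open>The trace of the pulled back metric is the rank: vertical unit vectors contribute 0 and
  horizontal ones 1. The factor r in the curvature term of the bitension originates here.\<close>

lemma sum_push_onb:
  assumes E: "is_onb g1 UNIV E"
  shows "(\<Sum>e\<in>E. g2 (push_p e) (push_p e)) = r"
proof -
  let ?B = "\<lambda>u v. g2 (push_p u) (push_p v)"
  have B: "bilinear ?B"
    unfolding bilinear_def
    by (auto intro!: linearI simp: linear_add[OF linear_push] linear_cmul[OF linear_push] inner_form_simps[OF g2])
  obtain K where K: "is_onb g1 (ker_sp M1 M2 F p) K" using onb_exists[OF g1 ker_subspace] by blast
  obtain E' where E': "is_onb g1 (hor_sp M1 M2 F p) E'"
    using onb_exists[OF g1 orth_compl_subspace[OF g1]] unfolding hor_sp_def by blast
  have "(\<Sum>e\<in>E. ?B e e) = (\<Sum>e\<in>K. ?B e e) + (\<Sum>e\<in>E'. ?B e e)"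
    using trace_on_split[OF g1 ker_subspace B] E' unfolding hor_sp_def[symmetric]
    by (simp add: trace_on_eq[OF g1 E B] trace_on_eq[OF g1 K B] trace_on_eq[OF g1 E' B])
  also have "(\<Sum>e\<in>K. ?B e e) = 0"
    using onb_subset[OF K] by (intro sum.neutral) (auto simp: ker_sp_def inner_form_simps[OF g2])
  also have "(\<Sum>e\<in>E'. ?B e e) = (\<Sum>e\<in>E'. 1)"
  proof (rule sum.cong[OF refl])
    fix e assume e: "e \<in> E'"
    then have "?B e e = g1 e e" using rm p onb_subset[OF E'] by (auto simp: riemannian_map_def)
    then show "?B e e = 1" using E' e by (simp add: is_onb_def)
  qed
  finally show ?thesis using onb_card[OF g1 E'] dim_hor by simp
qed

text \<open>The image of Y vanishes throughout W; the derivative of this identity eliminates the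
  pullback term of the second fundamental form.\<close>

lemma sf2_ker_frame:
  assumes W: "open W" "p \<in> W" and Y: "smooth_vf M1 W Y" and ker: "\<And>q. q \<in> W \<Longrightarrow> q \<in> carr M1 \<Longrightarrow> push M1 M2 F q (Y q) = 0"
  shows "sf2 p v (Y p) = - push_p (cov M1 v Y p)"
proof -
  let ?Y = "vf_rep M1 \<phi> Y"
  let ?N = "cmap \<phi> ` (cdom \<phi> \<inter> F -` cdom \<psi> \<inter> W)"
  have oN: "open ?N" by (rule open_frep_dom[OF \<phi>(1) \<psi>(1) W(1)])
  have xN: "x \<in> ?N" using \<phi> \<psi> W(2) by (simp add: pt_def)
  have dY: "?Y differentiable at x"
  proof (rule smooth_on_differentiable)
    show "smooth_on (cmap \<phi> ` (W \<inter> cdom \<phi>)) ?Y" using Y \<phi>(1) by (simp add: smooth_vf_def)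
  qed (use \<phi> W(2) in \<open>simp add: pt_def\<close>)
  have Yx: "?Y x = Y p" by (simp add: vf_rep_def M1.cinv_pt p)
  have "fd (\<lambda>y. fd f y (?Y y)) x = fd (\<lambda>_. 0) x"
  proof (rule fd_cong[OF oN xN])
    fix y assume "y \<in> ?N"
    then obtain q where q: "q \<in> cdom \<phi>" "F q \<in> cdom \<psi>" "q \<in> W" "y = cmap \<phi> q" by blast
    have "fd f y (?Y y) = comps M2 \<psi> (F q) (push M1 M2 F q (Y q))"
      by (simp add: q(4) vf_rep_def M1.chart(5)[OF \<phi>(1) q(1)] push_comps[OF \<phi>(1) \<psi>(1) q(1,2)])
    then show "fd f y (?Y y) = 0"
      using ker[OF q(3) M1.carrI[OF \<phi>(1) q(1)]] linear_0[OF M2.linear_comps[OF \<psi>(1) q(2)]] by simp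
  qed
  then have 1: "fd (\<lambda>y. fd f y (?Y x)) x v + fd f x (fd ?Y x v) = 0"
    using fd_eqI[OF has_derivative_param_linear[OF m.g.open_U xU m.df_linear m.df_differentiable[OF xU]
        has_derivative_ident dY[unfolded frechet_derivative_works]]]
    by (simp add: fun_eq_iff)
  have 2: "fd f x (Y p) = 0" using ker[OF W(2) p] by (simp add: push_p)
  show ?thesis
    using 1 by (simp add: sf2_x lsff_def 2 Yx cov_def christoffel_chr push_p linear_add[OF m.df_linear[OF xU]]
      bilinear_rzero[OF m.h.chr_bilinear[OF m.maps[OF xU]]] add_eq_0_iff)
qed

text \<open>On the kernel, the trace of the second fundamental form is minus the image of the summed
  covariant derivatives of a vertical frame. Only the horizontal part of that sum has an image, and
  it is a multiple of the mean curvature of the kernel.\<close>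

lemma tension_eq: "tension M1 M2 F p = r *\<^sub>R H p"
proof -
  let ?K = "ker_sp M1 M2 F p"
  define k where "k = dim ?K"
  obtain W E where W: "p \<in> W" "local_onf M1 (ker_sp M1 M2 F) W k E"
    and 0: "0 = (1 / real k) *\<^sub>R (\<Sum>j<k. orth_proj g1 (hor_sp M1 M2 F p) (cov M1 (E j p) (E j) p))"
    using minimal p unfolding ker_minimal_def ker_mean_curvature_def Let_def k_def by blast
  \<comment> \<open>For \<open>k = 0\<close> the factor \<open>1 / real k\<close> is 0 and gives no
    information, but then the sum is empty.\<close>
  have sum0: "(\<Sum>j<k. orth_proj g1 (hor_sp M1 M2 F p) (cov M1 (E j p) (E j) p)) = 0"
    using 0 by (cases "k = 0") auto
  have on: "g1 (E i p) (E j p) = (if i = j then 1 else 0)" if "i < k" "j < k" for i j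
    using W that by (auto simp: local_onf_def)
  \<comment> \<open>Orthonormal vectors with different indices differ, so a sum over indices is a
    sum over the basis as a set.\<close>
  have inj: "inj_on (\<lambda>j. E j p) {..<k}"
    using on by (intro inj_onI) (metis lessThan_iff zero_neq_one)
  have onb: "is_onb g1 ?K ((\<lambda>j. E j p) ` {..<k})"
    using W on inj by (auto simp: is_onb_def local_onf_def inj_on_def)
  have "trace_on g1 ?K (sf2 p) = (\<Sum>j<k. sf2 p (E j p) (E j p))"
    by (simp add: trace_on_eq[OF g1 onb sf2_bilinear] sum.reindex[OF inj])
  also have "\<dots> = (\<Sum>j<k. - push_p (orth_proj g1 (hor_sp M1 M2 F p) (cov M1 (E j p) (E j) p)))"
  proof (rule sum.cong[OF refl])
    fix j assume j: "j \<in> {..<k}"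
    have "E j q \<in> ker_sp M1 M2 F q" if "q \<in> W" for q
      using W(2) j that span_base[of "E j q" "(\<lambda>j. E j q) ` {..<k}"] by (auto simp: local_onf_def)
    then show "sf2 p (E j p) (E j p) = - push_p (orth_proj g1 (hor_sp M1 M2 F p) (cov M1 (E j p) (E j) p))"
      unfolding push_proj_hor using W j
      by (intro sf2_ker_frame[of W]) (auto simp: local_onf_def ker_sp_def)
  qed
  also have "\<dots> = 0"
    using sum0 by (simp add: sum_negf linear_sum[OF linear_push, symmetric] linear_0[OF linear_push])
  finally have "tension M1 M2 F p = trace_on g1 (hor_sp M1 M2 F p) (sf2 p)"
    unfolding tension_def hor_sp_def using trace_on_split[OF g1 ker_subspace sf2_bilinear] by simp
  then show ?thesis using r by (simp add: range_mean_curv_def rank[OF p])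
qed

text \<open>The trace defining H runs over the horizontal space, and w may be replaced by a
  horizontal vector with the same image; so \<open>S_normal\<close> applies to each summand.\<close>

lemma H_normal: "g2 (H p) (push_p w) = 0"
proof -
  obtain E where E: "is_onb g1 (hor_sp M1 M2 F p) E"
    using onb_exists[OF g1 orth_compl_subspace[OF g1]] unfolding hor_sp_def by blast
  obtain w' where w': "w' \<in> hor_sp M1 M2 F p" "push_p w' = push_p w" using push_hor by blast
  have "g2 (sf2 p e e) (push_p w') = 0" if "e \<in> E" for e
    using m.S_normal[OF riem_charts[OF rm \<phi>(1) \<psi>(1)] xU, of e e w'] that onb_subset[OF E] w'(1)
    by (auto simp: sf2_x push_p g2_x hor_x)
  then show ?thesis
    by (simp add: range_mean_curv_def trace_on_eq[OF g1 E sf2_bilinear] w'(2)[symmetric] inner_form_simps[OF g2]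
        inner_form_sum_left[OF g2])
qed

end

context biharmonic_riem
begin

lemma at_point: "q \<in> carr M1 \<Longrightarrow> biharmonic_riem_at M1 M2 F c r lam q"
  by unfold_locales

end

context biharmonic_riem_at
begin

section \<open>Derivatives of the mean curvature field and of the tension field\<close>

abbreviation "Hr \<equiv> sec_rep M2 F \<phi> \<psi> H"

lemma tension_rep:
  assumes "y \<in> U"
  shows "sec_rep M2 F \<phi> \<psi> (tension M1 M2 F) y = r *\<^sub>R Hr y"
proof -
  obtain q where q: "q \<in> cdom \<phi>" "F q \<in> cdom \<psi>" "y = cmap \<phi> q" using assms by blast
  show ?thesis
    using biharmonic_riem_at.tension_eq[OF at_point[OF M1.carrI[OF \<phi>(1) q(1)]]]
    by (simp add: q(3) sec_rep_apply[OF \<phi>(1) q(1)] linear_cmul[OF M2.linear_comps[OF \<psi>(1) q(2)]])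
qed

text \<open>H is defined through a chosen horizontal orthonormal basis, about which nothing is known
  as the point moves. Its regularity is inherited from the tension field, whose trace runs over the
  full tangent space.\<close>

lemma Hr_differentiable: "Hr differentiable at x"
proof (rule differentiable_cong_open[OF m.g.open_U xU])
  show "(\<lambda>y. (1 / real r) *\<^sub>R sec_rep M2 F \<phi> \<psi> (tension M1 M2 F) y) differentiable at x"
    using tension_differentiable[OF \<phi>(1) \<psi>(1) \<phi>(2) \<psi>(2)] unfolding pt_def
    by (intro differentiable_scaleR) auto
qed (use r in \<open>simp add: tension_rep\<close>)

lemma cov_tension: "cov_pb M1 M2 F v (tension M1 M2 F) p = r *\<^sub>R cov_pb M1 M2 F v H p"
proof -
  have "fd (sec_rep M2 F \<phi> \<psi> (tension M1 M2 F)) x = fd (\<lambda>y. r *\<^sub>R Hr y) x"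
    by (rule fd_cong[OF m.g.open_U xU tension_rep])
  also have "\<dots> = (\<lambda>u. r *\<^sub>R fd Hr x u)"
    by (rule fd_eqI[OF has_derivative_scaleR_right[OF Hr_differentiable[unfolded frechet_derivative_works]]])
  finally show ?thesis
    by (simp add: cov_pb_eq[OF p] tension_eq bilinear_rmul[OF m.h.chr_bilinear[OF m.maps[OF xU]]] scaleR_right_distrib)
qed

lemma cov_H_linear: "linear (\<lambda>v. cov_pb M1 M2 F v H p)"
  unfolding cov_pb_eq[OF p]
  by (rule linearI)
    (simp_all add: linear_add[OF linear_fd[OF Hr_differentiable]] linear_cmul[OF linear_fd[OF Hr_differentiable]]
      linear_add[OF linear_push] linear_cmul[OF linear_push] bilinear_ladd[OF m.h.chr_bilinear[OF m.maps[OF xU]]]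
      bilinear_lmul[OF m.h.chr_bilinear[OF m.maps[OF xU]]] algebra_simps)

text \<open>Differentiate \<open>g\<^sub>2(H\<^sub>2, F\<^sub>* b) = 0\<close> in the direction a.\<close>

lemma cov_H_push: "g2 (cov_pb M1 M2 F a H p) (push_p b) = - g2 (H p) (sf2 p a b)"
proof -
  have "fd (\<lambda>y. metric_rep M2 \<psi> (f y) (Hr y) (fd f y b)) x = fd (\<lambda>_. 0) x"
  proof (rule fd_cong[OF m.g.open_U xU])
    fix y assume "y \<in> U"
    then obtain q where q: "q \<in> cdom \<phi>" "F q \<in> cdom \<psi>" "y = cmap \<phi> q" by blast
    note H = biharmonic_riem_at.H_normal[OF at_point[OF M1.carrI[OF \<phi>(1) q(1)]], of "of_comps M1 \<phi> q b"]
    have "fd f y b = comps M2 \<psi> (F q) (push M1 M2 F q (of_comps M1 \<phi> q b))"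
      by (simp add: push_comps[OF \<phi>(1) \<psi>(1) q(1,2)] M1.comps_of_comps[OF \<phi>(1) q(1)] q(3))
    then show "metric_rep M2 \<psi> (f y) (Hr y) (fd f y b) = 0"
      using H by (simp add: q(3) frep_apply[OF \<phi>(1) q(1)] sec_rep_apply[OF \<phi>(1) q(1)]
          M2.metric_rep_comps[OF \<psi>(1) q(2)])
  qed
  then have "g2 (cov_pb M1 M2 F a H p) (push_p b)
      + g2 (H p) (fd (\<lambda>y. fd f y b) x a + chr (metric_rep M2 \<psi>) (f x) (push_p a) (push_p b)) = 0"
    using m.h.metric_compatible[OF m.maps[OF xU] m.f_differentiable[OF xU] Hr_differentiable
        m.df_differentiable[OF xU], of b a]
    by (simp add: g2_x sec_rep_pt[OF p] cov_pb_eq[OF p] push_p)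
  \<comment> \<open>The Christoffel term of M1 enters through its image, which is orthogonal to H;
    so it may be subtracted to complete the second fundamental form.\<close>
  moreover have "g2 (H p) (fd f x (chr (metric_rep M1 \<phi>) x a b)) = 0"
    using H_normal by (simp add: push_p)
  ultimately show ?thesis
    by (simp add: sf2_x lsff_def push_p inner_form_simps[OF g2])
qed

lemma cov_H_range: "cov_pb M1 M2 F v H p = - shape_op M1 M2 F H p v"
proof -
  have "normal_cov M1 M2 F v H p = 0" using parallel p by (simp add: parallel_mean_curv_def)
  then show ?thesis
    by (simp add: normal_cov_def normal_sp_def shape_op_def orth_proj_compl[OF g2 range_subspace])
qed

lemma cov_H: "cov_pb M1 M2 F v H p = - (lam p *\<^sub>R push_p v)"
proof -
  obtain k where k: "k \<in> ker_sp M1 M2 F p" "v - k \<in> hor_sp M1 M2 F p"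
    using orth_decomposition[OF g1 ker_subspace] unfolding hor_sp_def by blast
  have pk: "push_p k = 0" using k(1) by (simp add: ker_sp_def)
  have "cov_pb M1 M2 F k H p \<in> range_sp M1 M2 F p"
    using cov_H_range[of k] orth_proj(1)[OF g2 range_subspace, of "cov_pb M1 M2 F k H p"]
    by (metis add.inverse_inverse shape_op_def)
  then obtain b where b: "cov_pb M1 M2 F k H p = push_p b" by (auto simp: range_sp_def)
  \<comment> \<open>As the derivative along k is itself the image of b, the symmetry of the pairing
    turns its squared length into a pairing with \<open>push_p k\<close>, which is 0.\<close>
  have "g2 (push_p b) (push_p b) = g2 (cov_pb M1 M2 F b H p) (push_p k)"
    using cov_H_push[of b k] cov_H_push[of k b] sf2_sym[of b k] b by simp
  then have "cov_pb M1 M2 F k H p = 0"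
    using inner_form_eq_0[OF g2] by (simp add: b pk inner_form_simps[OF g2])
  moreover have "cov_pb M1 M2 F (v - k) H p = - (lam p *\<^sub>R push_p (v - k))"
    using cov_H_range[of "v - k"] umb[OF p k(2)] by metis
  ultimately show ?thesis
    by (simp add: linear_diff[OF cov_H_linear] linear_diff[OF linear_push] pk)
qed

lemma sum_sf2_onb: "is_onb g1 UNIV E \<Longrightarrow> (\<Sum>e\<in>E. sf2 p e e) = tension M1 M2 F p"
  unfolding tension_def by (rule trace_on_eq[OF g1 _ sf2_bilinear, symmetric])

lemma lam_eq: "lam p = g2 (H p) (H p)"
proof -
  obtain E where E: "is_onb g1 UNIV E" using onb_exists[OF g1 subspace_UNIV] by blast
  have "r * lam p = (\<Sum>e\<in>E. lam p * g2 (push_p e) (push_p e))"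
    by (simp add: sum_distrib_left[symmetric] sum_push_onb[OF E])
  also have "\<dots> = (\<Sum>e\<in>E. g2 (H p) (sf2 p e e))"
  proof (rule sum.cong[OF refl])
    fix e show "lam p * g2 (push_p e) (push_p e) = g2 (H p) (sf2 p e e)"
      using cov_H_push[of e e] unfolding cov_H by (simp add: inner_form_simps[OF g2])
  qed
  also have "\<dots> = g2 (H p) (tension M1 M2 F p)"
    by (simp add: inner_form_sum_right[OF g2, symmetric] sum_sf2_onb[OF E])
  also have "\<dots> = r * g2 (H p) (H p)" by (simp add: tension_eq inner_form_simps[OF g2])
  finally show ?thesis using r by simp
qed

text \<open>At every point the derivative of \<tau> is the differential of F times - r \<lambda>.
  Differentiating once more gives the derivative of \<lambda> and, after subtraction of the term
  with \<open>cov\<close>, the second fundamental form.\<close>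

lemma second_cov_tension:
  defines "dlam \<equiv> fd (lam \<circ> cinv \<phi>) x"
  shows "cov_pb M1 M2 F u (\<lambda>q. cov_pb M1 M2 F (ext M1 p v q) (tension M1 M2 F) q) p
      - cov_pb M1 M2 F (cov M1 u (ext M1 p v) p) (tension M1 M2 F) p
    = - (r *\<^sub>R (dlam u *\<^sub>R push_p v + lam p *\<^sub>R sf2 p u v))"
proof -
  let ?V = "\<lambda>q. cov_pb M1 M2 F (ext M1 p v q) (tension M1 M2 F) q"
  have V: "?V q = - ((r * lam q) *\<^sub>R push M1 M2 F q (ext M1 p v q))" if "q \<in> carr M1" for q
    using biharmonic_riem_at.cov_tension[OF at_point[OF that]] biharmonic_riem_at.cov_H[OF at_point[OF that]]
    by simp
  have dl: "(lam \<circ> cinv \<phi>) differentiable at x"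
    using lam smooth_on_differentiable M1.pt_in[OF p] \<phi>(1) unfolding smooth_fun_def by blast
  have "fd (sec_rep M2 F \<phi> \<psi> ?V) x = fd (\<lambda>y. - (r *\<^sub>R ((lam \<circ> cinv \<phi>) y *\<^sub>R fd f y v))) x"
  proof (rule fd_cong[OF m.g.open_U xU])
    fix y assume y: "y \<in> U"
    then obtain q where q: "q \<in> cdom \<phi>" "F q \<in> cdom \<psi>" "y = cmap \<phi> q" by blast
    note l = M2.linear_comps[OF \<psi>(1) q(2)]
    have "comps M2 \<psi> (F q) (push M1 M2 F q (ext M1 p v q)) = fd f y v"
      using sec_rep_push_ext[OF p y, of v] by (simp add: q(3) sec_rep_apply[OF \<phi>(1) q(1)])
    then show "sec_rep M2 F \<phi> \<psi> ?V y = - (r *\<^sub>R ((lam \<circ> cinv \<phi>) y *\<^sub>R fd f y v))"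
      unfolding q(3) sec_rep_apply[OF \<phi>(1) q(1)] V[OF M1.carrI[OF \<phi>(1) q(1)]]
      by (simp add: linear_neg[OF l] linear_cmul[OF l] M1.chart(5)[OF \<phi>(1) q(1)])
  qed
  also have "\<dots> = (\<lambda>u. - (r *\<^sub>R ((lam \<circ> cinv \<phi>) x *\<^sub>R fd (\<lambda>y. fd f y v) x u + dlam u *\<^sub>R fd f x v)))"
    unfolding dlam_def
    by (intro fd_eqI has_derivative_minus has_derivative_scaleR_right has_derivative_scaleR)
      (use dl m.df_differentiable[OF xU] in \<open>simp_all only: frechet_derivative_works\<close>)
  finally have D: "fd (sec_rep M2 F \<phi> \<psi> ?V) x u = - (r *\<^sub>R (lam p *\<^sub>R fd (\<lambda>y. fd f y v) x u + dlam u *\<^sub>R push_p v))"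
    by (simp add: M1.cinv_pt p push_p)
  note b = m.h.chr_bilinear[OF m.maps[OF xU]]
  show ?thesis
    unfolding cov_pb_eq[OF p, of u ?V] D V[OF p] cov_tension cov_H M1.cov_ext[OF p] sf2_x lsff_def
    by (simp add: p bilinear_rneg[OF b] bilinear_rmul[OF b] push_p algebra_simps)
qed

text \<open>The bitension contains R(u, v)u paired with v, sectional curvature R(u, v)v paired with
  u; skew symmetry in the last two slots accounts for the sign. Orthogonality reduces the
  denominator of the sectional curvature to \<open>g2 u u * g2 v v\<close>.\<close>

lemma curv_sectional:
  assumes u: "g2 u v = 0" and v: "v \<noteq> 0"
  shows "g2 (curv_at M2 (F p) u v u) v = - (c * g2 u u * g2 v v)"
proof (cases "u = 0")
  case True
  then show ?thesis by (simp add: M2.curv_at_zero[OF Fp] inner_form_simps[OF g2])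
next
  case False
  have pos: "g2 u u > 0" "g2 v v > 0" using False v g2 by (auto simp: inner_form_def)
  have ne: "u \<noteq> v" using u pos by auto
  have ind: "independent {u, v}"
  proof (rule ccontr)
    assume "\<not> independent {u, v}"
    then have "u \<in> span {v}"
      using v ne by (auto simp: independent_insert dest!: iffD1[OF independent_insert])
    then obtain k where "u = k *\<^sub>R v" by (auto simp: span_singleton)
    then show False using u pos by (simp add: inner_form_simps[OF g2])
  qed
  have "sectional_curv M2 (F p) u v = c" using sf Fp ne ind by (simp add: space_form_def)
  then have "g2 (curv_at M2 (F p) u v v) u = c * (g2 u u * g2 v v)"
    using pos u by (simp add: sectional_curv_def field_simps)
  then show ?thesis using M2.curv_at_skew[OF Fp, of u v u v] by simp
qed

lemma lam_cases: "H p = 0 \<or> lam p = c"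
proof (cases "H p = 0")
  case False
  let ?\<tau> = "tension M1 M2 F p"
  have \<tau>: "?\<tau> \<noteq> 0" "g2 (push_p w) ?\<tau> = 0" for w
    using False r H_normal inner_form_sym[OF g2, of "push_p w"] by (simp_all add: tension_eq inner_form_simps[OF g2])
  \<comment> \<open>This is the very basis selected inside \<open>trace_on\<close>, so the traces in
    the bitension unfold to sums over E without an appeal to bilinearity.\<close>
  define E where "E = (SOME E. is_onb g1 UNIV E)"
  have E: "is_onb g1 UNIV E"
    unfolding E_def by (rule someI_ex[OF onb_exists[OF g1 subspace_UNIV]])
  have "0 = g2 (bitension M1 M2 F p) ?\<tau>"
    using bih p by (simp add: biharmonic_def inner_form_simps[OF g2])
  \<comment> \<open>The term with the derivative of \<lambda> is tangent to the range, so pairing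
    with \<tau> removes it.\<close>
  also have "\<dots> = (\<Sum>e\<in>E. - (r * (lam p * g2 (sf2 p e e) ?\<tau>)))
      - (\<Sum>e\<in>E. g2 (curv_at M2 (F p) (push_p e) ?\<tau> (push_p e)) ?\<tau>)"
    by (simp add: bitension_def laplacian_pb_def trace_on_def E_def[symmetric] second_cov_tension
        inner_form_simps[OF g2] inner_form_sum_left[OF g2] \<tau>(2))
  also have "(\<Sum>e\<in>E. - (r * (lam p * g2 (sf2 p e e) ?\<tau>))) = - (r * lam p * g2 ?\<tau> ?\<tau>)"
    using sum_sf2_onb[OF E] inner_form_sum_left[OF g2, of "\<lambda>e. sf2 p e e" E ?\<tau>]
    by (simp add: sum_negf sum_distrib_left[symmetric])
  also have "(\<Sum>e\<in>E. g2 (curv_at M2 (F p) (push_p e) ?\<tau> (push_p e)) ?\<tau>) = - (c * r * g2 ?\<tau> ?\<tau>)"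
    using sum_push_onb[OF E]
    by (simp add: curv_sectional[OF \<tau>(2,1)] sum_negf sum_distrib_left[symmetric] sum_distrib_right[symmetric])
  finally have "r * (c - lam p) * g2 ?\<tau> ?\<tau> = 0" by (auto simp: algebra_simps)
  then show ?thesis using \<tau>(1) r inner_form_eq_0[OF g2] by simp
qed simp

end

context biharmonic_riem
begin

section \<open>From single points to the whole manifold\<close>

lemma lam_continuous: "continuous_on (carr M1) lam"
  unfolding carr_def
proof (rule continuous_on_open_UN)
  fix \<phi> assume \<phi>: "\<phi> \<in> atlas M1"
  show "open (cdom \<phi>)" by (rule M1.chart(1)[OF \<phi>])
  have "continuous_on (cdom \<phi>) (\<lambda>q. (lam \<circ> cinv \<phi>) (cmap \<phi> q))"
    by (rule continuous_on_compose2[OF smooth_on_continuous M1.chart(4)[OF \<phi>] subset_refl])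
      (use lam \<phi> in \<open>simp only: smooth_fun_def\<close>)
  then show "continuous_on (cdom \<phi>) lam"
    by (rule continuous_on_eq) (simp add: M1.chart(5)[OF \<phi>])
qed

lemma harmonic_or_curvature:
  assumes "connected (carr M1)"
  shows "harmonic M1 M2 F \<or> (\<forall>p\<in>carr M1. c = metric M2 (F p) (H p) (H p))"
proof -
  note lam_eq = biharmonic_riem_at.lam_eq[OF at_point]
  \<comment> \<open>With this, the pointwise alternative becomes a statement about the values of
    \<lambda> alone.\<close>
  have H0: "H q = 0 \<longleftrightarrow> lam q = 0" if "q \<in> carr M1" for q
    using lam_eq[OF that] inner_form_eq_0[OF M2.metric_inner[OF F_carr[OF that]]] by simp
  have "lam ` carr M1 \<subseteq> {0, c}"
    using biharmonic_riem_at.lam_cases[OF at_point] H0 by blast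
  moreover have "connected (lam ` carr M1)"
    by (rule connected_continuous_image[OF lam_continuous assms])
  \<comment> \<open>A connected finite set has at most one element. The empty case is that of an
    empty manifold, where both alternatives hold vacuously.\<close>
  ultimately have "lam ` carr M1 = {} \<or> (\<exists>a. lam ` carr M1 = {a})"
    using connected_finite_iff_sing finite_subset by (metis finite.emptyI finite.insertI)
  then have "(\<forall>q\<in>carr M1. lam q = 0) \<or> (\<forall>q\<in>carr M1. lam q = c)"
  proof
    assume "\<exists>a. lam ` carr M1 = {a}"
    then obtain a where a: "lam ` carr M1 = {a}" by blast
    then have "a \<in> {0, c}" using \<open>lam ` carr M1 \<subseteq> {0, c}\<close> by (metis insertI1 subsetD)
    moreover have "\<forall>q\<in>carr M1. lam q = a" using a by (metis imageI singletonD)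
    ultimately show ?thesis by (metis insertE singletonD)
  qed simp
  then consider "\<forall>q\<in>carr M1. lam q = 0" | "\<forall>q\<in>carr M1. lam q = c" by argo
  then show ?thesis
  proof cases
    case 1
    then have "tension M1 M2 F q = 0" if "q \<in> carr M1" for q
      using biharmonic_riem_at.tension_eq[OF at_point[OF that]] H0[OF that] that by simp
    then show ?thesis by (simp add: harmonic_def)
  next
    case 2
    then show ?thesis using lam_eq by auto
  qed
qed

end

theorem theorem4p2:
  fixes M1 :: "('a::{t2_space, second_countable_topology}, 'm::finite) riem_mfd"
    and M2 :: "('b::{t2_space, second_countable_topology}, 'n::finite) riem_mfd"
    and F :: "'a \<Rightarrow> 'b" and c :: real and r :: nat
  assumes "riemannian_manifold M1" and "connected (carr M1)"
    and "space_form M2 c"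
    and "riemannian_map M1 M2 F"
    and "\<forall>p\<in>carr M1. dim (range_sp M1 M2 F p) = r"
    and "0 < r" and "r < min CARD('m) CARD('n)"
    and "pseudo_umbilical M1 M2 F"
    and "biharmonic M1 M2 F"
    and "ker_minimal M1 M2 F"
    and "parallel_mean_curv M1 M2 F"
  shows "harmonic M1 M2 F \<or>
    (\<forall>p\<in>carr M1. c = metric M2 (F p) (range_mean_curv M1 M2 F p) (range_mean_curv M1 M2 F p))"
proof -
  obtain lam where lam: "smooth_fun M1 lam" "\<forall>p\<in>carr M1. \<forall>v\<in>hor_sp M1 M2 F p.
      shape_op M1 M2 F (range_mean_curv M1 M2 F) p v = lam p *\<^sub>R push M1 M2 F p v"
    using assms(8) unfolding pseudo_umbilical_def by blast
  interpret biharmonic_riem M1 M2 F c r lam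
    using assms lam
    by unfold_locales (auto simp: space_form_def riemannian_map_def)
  show ?thesis by (rule harmonic_or_curvature[OF assms(2)])
qed

end
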